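(* Let $F$ be an algebraically closed field of characteristic $0$, let $H$ be an associative $F$-algebra with $1$, and let $A$ be a finite dimensional non-nilpotent associative $F$-algebra with a generalized $H$-action. Suppose that $A/J^H(A) = B_1 \oplus \ldots \oplus B_q$ (direct sum of $H$-invariant ideals) for some $H$-simple algebras $B_i$ satisfying Property ( * ). Let $\pi\colon A\to A/J^H(A)$ be the natural surjection, let $B\subseteq A/J^H(A)$ be a maximal semisimple subalgebra with $A/J^H(A)=B\oplus J(A/J^H(A))$ (direct sum of subspaces), and let $\varkappa\colon A/J^H(A)\hookrightarrow A$ be an $F$-linear embedding with $\pi\varkappa=\mathrm{id}_{A/J^H(A)}$ and $\varkappa(ba)=\varkappa(b)\varkappa(a)$, $\varkappa(ab)=\varkappa(a)\varkappa(b)$ for all $a\in A/J^H(A)$, $b\in B$ (such $B$ and $\varkappa$ exist). Let $d$ be the maximum of $\dim(B_{i_1}\oplus\ldots\oplus B_{i_r})$ over all $r\geqslant1$ and all pairwise distinct $i_1,\ldots,i_r\in\{1,\ldots,q\}$ with $$(H\varkappa(B_{i_1}))A^+(H\varkappa(B_{i_2}))A^+\ldots (H\varkappa(B_{i_{r-1}}))A^+(H\varkappa(B_{i_r}))\ne 0,$$ where $A^+:=A+F\cdot1$. Then the limit $\lim_{n\to\infty}\sqrt[n]{c_n^H(A)}$ exists and equals the integer $d$.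
   Context: Generalized $H$-action: for an associative unital $F$-algebra $H$, an algebra $A$ has a generalized $H$-action if there is a homomorphism $H\to \mathrm{End}_F(A)$ and for every $h\in H$ there are $k\in\mathbb N$ and $h_i',h_i'',h_i''',h_i''''\in H$ ($1\leqslant i\leqslant k$) with $h(ab)=\sum_{i=1}^k\bigl((h_i'a)(h_i''b)+(h_i'''b)(h_i''''a)\bigr)$ for all $a,b\in A$. A subspace $V\subseteq A$ is $H$-invariant if it is an $H$-submodule. $J^H(A)$ is the maximal nilpotent $H$-invariant two-sided ideal of $A$; $J(\cdot)$ is the ordinary Jacobson radical. $A$ is $H$-simple if $A^2\neq 0$ and $A$ has no non-trivial two-sided $H$-invariant ideals. $H\varkappa(V)$ denotes the span of all $h\varkappa(b)$, $h\in H$, $b\in V$; products of subspaces are linear spans of products. $A^+$ is $A$ with the formal unity $1$ adjoined. $H$-polynomials and codimensions: $F\langle X|H\rangle=\bigoplus_{n\ge1}H^{\otimes n}\otimes F\langle X\rangle^{(n)}$, where $X=\{x_1,x_2,\ldots\}$ and $F\langle X\rangle^{(n)}$ is the span of noncommutative monomials of degree $n$, with multiplication $(u_1\otimes w_1)(u_2\otimes w_2)=(u_1\otimes u_2)\otimes w_1w_2$. One writes $x_{i_1}^{h_1}\cdots x_{i_n}^{h_n}:=(h_1\otimes\cdots\otimes h_n)\otimes x_{i_1}\cdots x_{i_n}$ and $x_i=x_i^{1_H}$. Elements are $H$-polynomials; they are evaluated in $A$ by letting $x_i^h\mapsto h a_i$ when $x_i\mapsto a_i$. $\mathrm{Id}^H(A)$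 is the set of $H$-polynomials vanishing under all evaluations in $A$. $P_n^H$ is the span of all $x_{\sigma(1)}^{h_1}\cdots x_{\sigma(n)}^{h_n}$, $h_i\in H$, $\sigma\in S_n$, and $c_n^H(A):=\dim\bigl(P_n^H/(P_n^H\cap\mathrm{Id}^H(A))\bigr)$. Property ( * ): a finite dimensional algebra $B$ with a generalized $H$-action and with basis $a_1,\ldots,a_\ell$ satisfies Property ( * ) if $B$ is unital and there is $n_0\in\mathbb N$ such that for every $k\in\mathbb N$ there exist a multilinear $H$-polynomial $f=f(x_1^{(1)},\ldots,x_\ell^{(1)};\ldots;x_1^{(2k)},\ldots,x_\ell^{(2k)};z_1,\ldots,z_{n_1})$ and elements $\bar z_i\in B$, $1\leqslant i\leqslant n_1$, $0\leqslant n_1\leqslant n_0$, such that $f$ is alternating in $x_1^{(i)},\ldots,x_\ell^{(i)}$ for each $1\leqslant i\leqslant 2k$ and $f(a_1,\ldots,a_\ell;\ldots;a_1,\ldots,a_\ell;\bar z_1,\ldots,\bar z_{n_1})\neq0$. *)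

theory Defs
  imports
    Complex_Main
    "HOL-Library.FuncSet"
    "HOL-Library.Poly_Mapping"
    "HOL-Combinatorics.Transposition"
    "HOL-Computational_Algebra.Polynomial"
begin

section \<open>Associative algebras, not necessarily unital\<close>

text \<open>The class \<^class>\<open>ring\<close> does not require a unit. The value for the empty list is a dummy;
  all uses below are restricted to nonempty lists.\<close>

fun nprod :: "'a::ring list \<Rightarrow> 'a" where
  "nprod [] = 0"
| "nprod [a] = a"
| "nprod (a # b # as) = a * nprod (b # as)"

definition nilpotent_set :: "'a::ring set \<Rightarrow> bool" where
  "nilpotent_set I \<longleftrightarrow> (\<exists>n\<ge>1. \<forall>as. length as = n \<and> set as \<subseteq> I \<longrightarrow> nprod as = 0)"

definition unital_on :: "'a::ring set \<Rightarrow> bool" where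
  "unital_on R \<longleftrightarrow> (\<exists>e\<in>R. \<forall>x\<in>R. e * x = x \<and> x * e = x)"

text \<open>\<open>dim (V / W)\<close> for subspaces \<open>W \<subseteq> V\<close>: the number of elements of a basis of the quotient,
  given by representatives in \<open>V\<close> (and \<open>0\<close> if the quotient is infinite dimensional).\<close>

definition basis_modulo ::
    "('f::field \<Rightarrow> 'b::ab_group_add \<Rightarrow> 'b) \<Rightarrow> 'b set \<Rightarrow> 'b set \<Rightarrow> 'b set \<Rightarrow> bool" where
  "basis_modulo scale V W S \<longleftrightarrow>
     S \<subseteq> V \<and> \<not> module.dependent scale S \<and> module.span scale S \<inter> W = {0} \<and>
     V \<subseteq> module.span scale (S \<union> W)"

definition quotient_dim ::
    "('f::field \<Rightarrow> 'b::ab_group_add \<Rightarrow> 'b) \<Rightarrow> 'b set \<Rightarrow> 'b set \<Rightarrow> nat" where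
  "quotient_dim scale V W = card (SOME S. basis_modulo scale V W S)"

locale assoc_algebra = vector_space scale
  for scale :: "'f::field \<Rightarrow> 'a::ring \<Rightarrow> 'a" +
  assumes scale_mult_left: "scale c x * y = scale c (x * y)"
    and scale_mult_right: "x * scale c y = scale c (x * y)"
begin

definition is_basis_family :: "'a set \<Rightarrow> nat \<Rightarrow> (nat \<Rightarrow> 'a) \<Rightarrow> bool" where
  "is_basis_family V l a \<longleftrightarrow>
     inj_on a {1..l} \<and> independent (a ` {1..l}) \<and> span (a ` {1..l}) = V"

text \<open>The whole algebra is the direct sum of the subspaces \<open>B\<^sub>1, \<dots>, B\<^sub>q\<close>.\<close>

definition internal_direct_sum :: "nat \<Rightarrow> (nat \<Rightarrow> 'a set) \<Rightarrow> bool" where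
  "internal_direct_sum q B \<longleftrightarrow>
     (\<forall>i\<in>{1..q}. subspace (B i)) \<and>
     (\<forall>x. \<exists>!b. b \<in> (\<Pi>\<^sub>E i\<in>{1..q}. B i) \<and> x = (\<Sum>i\<in>{1..q}. b i))"

definition subalgebra :: "'a set \<Rightarrow> bool" where
  "subalgebra R \<longleftrightarrow> subspace R \<and> (\<forall>x\<in>R. \<forall>y\<in>R. x * y \<in> R)"

definition left_ideal :: "'a set \<Rightarrow> 'a set \<Rightarrow> bool" where
  "left_ideal R L \<longleftrightarrow> subspace L \<and> L \<subseteq> R \<and> (\<forall>r\<in>R. \<forall>x\<in>L. r * x \<in> L)"

definition ideal :: "'a set \<Rightarrow> 'a set \<Rightarrow> bool" where
  "ideal R I \<longleftrightarrow> subspace I \<and> I \<subseteq> R \<and> (\<forall>r\<in>R. \<forall>x\<in>I. r * x \<in> I \<and> x * r \<in> I)"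

text \<open>The Jacobson radical of a subalgebra \<open>R\<close> that need not be unital is the intersection of
  the modular maximal left ideals of \<open>R\<close> (and \<open>R\<close> itself if there are none).\<close>

definition modular_maximal_left_ideal :: "'a set \<Rightarrow> 'a set \<Rightarrow> bool" where
  "modular_maximal_left_ideal R L \<longleftrightarrow>
     left_ideal R L \<and> L \<noteq> R \<and>
     (\<exists>e\<in>R. \<forall>r\<in>R. r - r * e \<in> L) \<and>
     (\<forall>M. left_ideal R M \<and> L \<subseteq> M \<longrightarrow> M = L \<or> M = R)"

definition jacobson_radical :: "'a set \<Rightarrow> 'a set" where
  "jacobson_radical R = {x \<in> R. \<forall>L. modular_maximal_left_ideal R L \<longrightarrow> x \<in> L}"

text \<open>The notion for finite dimensional algebras.\<close>

definition semisimple :: "'a set \<Rightarrow> bool" where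
  "semisimple R \<longleftrightarrow> subalgebra R \<and> jacobson_radical R = {0}"

definition maximal_semisimple :: "'a set \<Rightarrow> bool" where
  "maximal_semisimple R \<longleftrightarrow>
     semisimple R \<and> (\<forall>R'. semisimple R' \<and> R \<subseteq> R' \<longrightarrow> R' = R)"

definition radical_complement :: "'a set \<Rightarrow> bool" where
  "radical_complement R \<longleftrightarrow>
     R \<inter> jacobson_radical UNIV = {0} \<and> {r + j |r j. r \<in> R \<and> j \<in> jacobson_radical UNIV} = UNIV"

definition prod_space :: "'a set \<Rightarrow> 'a set \<Rightarrow> 'a set" where
  "prod_space V W = span {v * w |v w. v \<in> V \<and> w \<in> W}"

text \<open>\<open>V A\<^sup>+\<close> for the algebra \<open>A\<^sup>+ = A + F 1\<close> with formally adjoined unit: an element of \<open>A\<^sup>+\<close>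
  is \<open>a + c 1\<close>, and \<open>v (a + c 1) = v a + c v\<close> lies in \<open>A\<close>.\<close>

definition prod_plus :: "'a set \<Rightarrow> 'a set" where
  "prod_plus V = span {v * a + scale c v |v a c. v \<in> V}"

text \<open>\<open>V\<^sub>1 A\<^sup>+ V\<^sub>2 A\<^sup>+ \<dots> A\<^sup>+ V\<^sub>r\<close> for a nonempty list of subspaces.\<close>

fun plus_chain :: "'a set list \<Rightarrow> 'a set" where
  "plus_chain [] = {0}"
| "plus_chain [V] = V"
| "plus_chain (V # W # Vs) = prod_space (prod_plus V) (plus_chain (W # Vs))"

end

section \<open>H-polynomials\<close>

text \<open>The monomial \<open>x\<^bsub>i1\<^esub>\<^bsup>h1\<^esup> \<dots> x\<^bsub>in\<^esub>\<^bsup>hn\<^esup>\<close> is the nonempty list \<open>[(i1, h1), \<dots>, (in, hn)]\<close>. The space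
  \<open>F\<langle>X|H\<rangle> = \<Oplus>\<^sub>n H\<^bsup>\<otimes>n\<^esup> \<otimes> F\<langle>X\<rangle>\<^bsup>(n)\<^esup>\<close>, with \<open>X\<close> indexed by the type \<open>'v\<close>, is the free vector space on
  these monomials modulo the subspace \<open>tensor_relations\<close>, which makes a monomial linear in each
  \<open>h\<close>. An H-polynomial is given by a representative in the free vector space, and a subspace of
  \<open>F\<langle>X|H\<rangle>\<close> by its full preimage there.\<close>

type_synonym ('v, 'h, 'f) hpoly = "('v \<times> 'h) list \<Rightarrow>\<^sub>0 'f"

definition hpscale :: "'f::field \<Rightarrow> ('v, 'h, 'f) hpoly \<Rightarrow> ('v, 'h, 'f) hpoly" where
  "hpscale c f = Poly_Mapping.map (\<lambda>x. c * x) f"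

lemma lookup_hpscale: "Poly_Mapping.lookup (hpscale c f) m = c * Poly_Mapping.lookup f m"
  unfolding hpscale_def by (transfer) (auto simp: when_def)

global_interpretation hp: vector_space hpscale
  by unfold_locales
    (auto intro!: poly_mapping_eqI simp: lookup_hpscale lookup_add algebra_simps)

definition monomial :: "('v \<times> 'h) list \<Rightarrow> ('v, 'h, 'f::field) hpoly" where
  "monomial m = Poly_Mapping.single m 1"

lemma lookup_monomial_Nil: "m \<noteq> [] \<Longrightarrow> Poly_Mapping.lookup (monomial m) [] = 0"
  by (simp add: monomial_def lookup_single)

definition tensor_relations ::
    "('f::field \<Rightarrow> 'h::ring_1 \<Rightarrow> 'h) \<Rightarrow> ('v, 'h, 'f) hpoly set" where
  "tensor_relations scaleH = hp.span
     ({monomial (u @ (x, h + h') # w) - monomial (u @ (x, h) # w) - monomial (u @ (x, h') # w)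
        |u x h h' w. True} \<union>
      {monomial (u @ (x, scaleH c h) # w) - hpscale c (monomial (u @ (x, h) # w))
        |u x c h w. True})"

text \<open>The H-polynomials that are multilinear in exactly the variables from \<open>V\<close>.\<close>

definition multilinear_hpolys ::
    "('f::field \<Rightarrow> 'h::ring_1 \<Rightarrow> 'h) \<Rightarrow> 'v set \<Rightarrow> ('v, 'h, 'f) hpoly set" where
  "multilinear_hpolys scaleH V = hp.span
     ({monomial m |m. m \<noteq> [] \<and> distinct (map fst m) \<and> set (map fst m) = V} \<union>
      tensor_relations scaleH)"

definition PH :: "('f::field \<Rightarrow> 'h::ring_1 \<Rightarrow> 'h) \<Rightarrow> nat \<Rightarrow> (nat, 'h, 'f) hpoly set" where
  "PH scaleH n = multilinear_hpolys scaleH {1..n}"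

definition rename_vars :: "('v \<Rightarrow> 'w) \<Rightarrow> ('v, 'h, 'f::field) hpoly \<Rightarrow> ('w, 'h, 'f) hpoly" where
  "rename_vars \<tau> f =
     (\<Sum>m\<in>Poly_Mapping.keys f.
        hpscale (Poly_Mapping.lookup f m) (monomial (map (\<lambda>(x, h). (\<tau> x, h)) m)))"

text \<open>\<open>f\<close> is alternating in the variables from \<open>V\<close>: interchanging two of them changes its sign
  (as an element of \<open>F\<langle>X|H\<rangle>\<close>, that is, modulo the tensor relations).\<close>

definition alternating_in ::
    "('f::field \<Rightarrow> 'h::ring_1 \<Rightarrow> 'h) \<Rightarrow> 'v set \<Rightarrow> ('v, 'h, 'f) hpoly \<Rightarrow> bool" where
  "alternating_in scaleH V f \<longleftrightarrow>
     (\<forall>x\<in>V. \<forall>y\<in>V. x \<noteq> y \<longrightarrow> rename_vars (transpose x y) f + f \<in> tensor_relations scaleH)"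

text \<open>Names for the variables \<open>x\<^sub>j\<^bsup>(i)\<^esup>\<close> (as \<open>XVar i j\<close>) and \<open>z\<^sub>m\<close>.\<close>

datatype star_var = XVar nat nat | ZVar nat

section \<open>Generalized H-actions\<close>

text \<open>The homomorphism \<open>H \<rightarrow> End(A)\<close> is unital, as usual for modules over an algebra with \<open>1\<close>.\<close>

locale gen_H_action = assoc_algebra scale + H: assoc_algebra scaleH
  for scaleH :: "'f::field \<Rightarrow> 'h::ring_1 \<Rightarrow> 'h"
    and scale :: "'f \<Rightarrow> 'a::ring \<Rightarrow> 'a"
    and act :: "'h \<Rightarrow> 'a \<Rightarrow> 'a" +
  assumes act_linear: "Vector_Spaces.linear scale scale (act h)"
    and act_plus: "act (h + h') a = act h a + act h' a"
    and act_scale: "act (scaleH c h) a = scale c (act h a)"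
    and act_mult: "act (h * h') a = act h (act h' a)"
    and act_one: "act 1 a = a"
    and act_product: "\<exists>(k::nat) h1 h2 h3 h4. \<forall>a b.
      act h (a * b) = (\<Sum>i\<in>{1..k}. act (h1 i) a * act (h2 i) b + act (h3 i) b * act (h4 i) a)"
begin

definition H_invariant :: "'a set \<Rightarrow> bool" where
  "H_invariant V \<longleftrightarrow> (\<forall>h. \<forall>v\<in>V. act h v \<in> V)"

definition H_ideal :: "'a set \<Rightarrow> 'a set \<Rightarrow> bool" where
  "H_ideal R I \<longleftrightarrow> ideal R I \<and> H_invariant I"

definition H_simple :: "'a set \<Rightarrow> bool" where
  "H_simple R \<longleftrightarrow>
     subalgebra R \<and> H_invariant R \<and> (\<exists>x\<in>R. \<exists>y\<in>R. x * y \<noteq> 0) \<and>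
     (\<forall>I. H_ideal R I \<longrightarrow> I = {0} \<or> I = R)"

text \<open>\<open>J\<^sup>H(A)\<close>; it exists when \<open>A\<close> is finite dimensional, since the sum of two nilpotent
  H-invariant ideals is again one.\<close>

definition JH :: "'a set" where
  "JH = (GREATEST I. H_ideal UNIV I \<and> nilpotent_set I)"

definition H_span :: "'a set \<Rightarrow> 'a set" where
  "H_span V = span {act h v |h v. v \<in> V}"

definition eval_hp :: "('v \<Rightarrow> 'a) \<Rightarrow> ('v, 'h, 'f) hpoly \<Rightarrow> 'a" where
  "eval_hp a f = (\<Sum>m\<in>Poly_Mapping.keys f.
     scale (Poly_Mapping.lookup f m) (nprod (map (\<lambda>(x, h). act h (a x)) m)))"

text \<open>H-polynomials have no constant term.\<close>

definition IdH :: "(nat, 'h, 'f) hpoly set" where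
  "IdH = {f. [] \<notin> Poly_Mapping.keys f \<and> (\<forall>a. eval_hp a f = 0)}"

text \<open>Both \<open>PH\<close> and \<open>IdH\<close> are full preimages (for \<open>IdH\<close> see \<open>eval_tensor_relations\<close> below), so
  the tensor relations cancel from this quotient.\<close>

definition codimH :: "nat \<Rightarrow> nat" where
  "codimH n = quotient_dim hpscale (PH scaleH n) (PH scaleH n \<inter> IdH)"

text \<open>Property star of a finite dimensional H-invariant subalgebra \<open>R\<close>. The choice of the basis
  is irrelevant, since a change of basis multiplies the value of \<open>f\<close> by the power \<open>2k\<close> of a
  nonzero determinant.\<close>

definition property_star :: "'a set \<Rightarrow> bool" where
  "property_star R \<longleftrightarrow>
     unital_on R \<and>
     (\<exists>l a. is_basis_family R l a \<and>
       (\<exists>n0. \<forall>k\<ge>1. \<exists>n1\<le>n0. \<exists>f z.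
          f \<in> multilinear_hpolys scaleH
                ({XVar i j |i j. i \<in> {1..2*k} \<and> j \<in> {1..l}} \<union> {ZVar m |m. m \<in> {1..n1}}) \<and>
          (\<forall>i\<in>{1..2*k}. alternating_in scaleH {XVar i j |j. j \<in> {1..l}} f) \<and>
          (\<forall>m\<in>{1..n1}. z m \<in> R) \<and>
          eval_hp (\<lambda>v. case v of XVar i j \<Rightarrow> a j | ZVar m \<Rightarrow> z m) f \<noteq> 0))"

lemma eval_hp_superset:
  assumes "finite S" "Poly_Mapping.keys f \<subseteq> S"
  shows "eval_hp a f = (\<Sum>m\<in>S.
    scale (Poly_Mapping.lookup f m) (nprod (map (\<lambda>(x, h). act h (a x)) m)))"
  unfolding eval_hp_def
  by (rule sum.mono_neutral_left) (use assms in \<open>auto simp: in_keys_iff\<close>)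

lemma eval_hp_add: "eval_hp a (f + g) = eval_hp a f + eval_hp a g"
proof -
  let ?S = "Poly_Mapping.keys f \<union> Poly_Mapping.keys g"
  have "Poly_Mapping.keys (f + g) \<subseteq> ?S" by (rule Poly_Mapping.keys_add)
  then show ?thesis
    by (simp add: eval_hp_superset[of ?S] lookup_add scale_left_distrib sum.distrib)
qed

lemma eval_hp_scale: "eval_hp a (hpscale c f) = scale c (eval_hp a f)"
proof -
  have "Poly_Mapping.keys (hpscale c f) \<subseteq> Poly_Mapping.keys f" by (auto simp: in_keys_iff lookup_hpscale)
  then show ?thesis
    by (simp add: eval_hp_superset[of "Poly_Mapping.keys f"] lookup_hpscale scale_sum_right)
qed

lemma eval_hp_diff: "eval_hp a (f - g) = eval_hp a f - eval_hp a g"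
  by (metis add_diff_cancel diff_add_cancel eval_hp_add)

lemma eval_hp_monomial: "eval_hp a (monomial m) = nprod (map (\<lambda>(x, h). act h (a x)) m)"
  unfolding eval_hp_def monomial_def by simp

lemma nprod_Cons: "as \<noteq> [] \<Longrightarrow> nprod (b # as) = b * nprod as"
  by (cases as) auto

lemma nprod_add:
  "nprod (u @ (b + c) # w) = nprod (u @ b # w) + nprod (u @ (c::'a) # w)"
proof (induction u)
  case Nil
  then show ?case by (cases w) (simp_all add: distrib_right)
next
  case (Cons x u)
  then show ?case by (simp add: nprod_Cons distrib_left)
qed

lemma nprod_scale: "nprod (u @ scale c b # w) = scale c (nprod (u @ b # w))"
proof (induction u)
  case Nil
  then show ?case by (cases w) (simp_all add: scale_mult_left)
next
  case (Cons x u)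
  then show ?case by (simp add: nprod_Cons scale_mult_right)
qed

text \<open>Evaluation is well defined on \<open>F\<langle>X|H\<rangle>\<close>.\<close>

lemma eval_tensor_relations:
  assumes "f \<in> tensor_relations scaleH"
  shows "[] \<notin> Poly_Mapping.keys f" "eval_hp a f = 0"
proof -
  have "Poly_Mapping.lookup f [] = 0 \<and> eval_hp a f = 0"
    using assms unfolding tensor_relations_def
  proof (induction rule: hp.span_induct_alt)
    case base
    then show ?case by (simp add: eval_hp_def)
  next
    case (step c g f)
    then have "Poly_Mapping.lookup g [] = 0 \<and> eval_hp a g = 0"
      by (auto simp: eval_hp_diff eval_hp_scale eval_hp_monomial act_plus act_scale nprod_add
          nprod_scale lookup_minus lookup_hpscale lookup_monomial_Nil)
    with step show ?case
      by (simp add: eval_hp_add eval_hp_scale lookup_add lookup_hpscale)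
  qed
  then show "[] \<notin> Poly_Mapping.keys f" "eval_hp a f = 0" by (auto simp: in_keys_iff)
qed

end

text \<open>\<open>p\<close> presents the codomain as the quotient of the domain by the H-invariant ideal \<open>I\<close>,
  together with the induced operations and action.\<close>

definition quotient_map ::
    "('f::field \<Rightarrow> 'a::ring \<Rightarrow> 'a) \<Rightarrow> ('h \<Rightarrow> 'a \<Rightarrow> 'a) \<Rightarrow> ('f \<Rightarrow> 'q::ring \<Rightarrow> 'q) \<Rightarrow> ('h \<Rightarrow> 'q \<Rightarrow> 'q) \<Rightarrow>
     'a set \<Rightarrow> ('a \<Rightarrow> 'q) \<Rightarrow> bool" where
  "quotient_map scaleA actA scaleQ actQ I p \<longleftrightarrow>
     Vector_Spaces.linear scaleA scaleQ p \<and>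
     (\<forall>x y. p (x * y) = p x * p y) \<and>
     (\<forall>h x. p (actA h x) = actQ h (p x)) \<and>
     surj p \<and> {x. p x = 0} = I"

end

theory Submission
  imports Defs "HOL-Combinatorics.Multiset_Permutations" "HOL-Real_Asymp.Real_Asymp"
begin

text \<open>
  Evaluation identifies \<open>c\<^sub>n\<close> with the dimension of the space of multilinear maps \<open>A\<^sup>n \<rightarrow> A\<close> given by
  H-polynomials, so neither bound needs the representation theory of the symmetric group.

  Upper bound. Such a map is determined by its values on tuples from a spanning set that consists
  of bases of the \<open>\<kappa>(B\<^sub>i)\<close> and of the nilpotent ideal \<open>J\<close>. A nonzero value allows only boundedly many
  entries from \<open>J\<close>, and the remaining entries come from summands whose chain product is nonzero.
  There are at most polynomially many times \<open>d\<^sup>n\<close> such tuples.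

  Lower bound. The units of the \<open>B\<^sub>i\<close> lie in \<open>B\<close>, so their images \<open>\<epsilon>\<^sub>i\<close> are idempotents with
  \<open>c\<^sub>1 \<epsilon>\<^sub>1 c\<^sub>2 \<epsilon>\<^sub>2 \<dots> c\<^sub>r \<epsilon>\<^sub>r \<noteq> 0\<close>. If the \<open>c\<^sub>i\<close> have maximal \<open>J\<close>-degree, then the product vanishes whenever
  an \<open>\<epsilon>\<^sub>i\<close> is replaced by an element of \<open>J\<close>; modulo \<open>J\<close> each \<open>\<epsilon>\<^sub>i\<close> is a sum of values of the
  polynomial from Property star, multiplied by elements of \<open>B\<^sub>i\<close>. The resulting multilinear function
  is nonzero at basis vectors only if each of its \<open>2 k\<close> columns of \<open>d\<close> variables receives a
  permutation of the basis. Distributing the columns over \<open>n\<close> positions according to suitable words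
  gives a triangular, hence independent, family, and the number of these words has exponential
  growth rate arbitrarily close to \<open>d\<close>.
\<close>

section \<open>Dimension counts\<close>

text \<open>Alternation says only that each column must receive all \<open>d\<close> letters in some
  order, and several words can satisfy this for one distribution of the columns. Taking letter
  \<open>i\<close> of a column from time \<open>t + i\<close> makes the intended word the unique
  maximizer of the sum of letter times time among them; this sum is the rank of the triangular
  system. The price is at most \<open>d - 1\<close> incomplete blocks at each end, a number
  independent of \<open>n\<close>. With \<open>b\<close> copies of each letter per block the count
  loses a factor of about (e b)^(-1/b) per letter, which tends to 1; so \<open>b\<close> is fixed
  before \<open>n\<close> grows. A letter placed in the slot of a wrong summand makes the value
  vanish in the quotient only. Maximality of the \<open>J\<close>-degree turns this into vanishing
  in \<open>A\<close>. H-polynomials have no coefficients from \<open>A\<close>, and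
  \<open>A\<close> need not have a unit. The multipliers are therefore values of additional
  variables; together with the \<open>z\<close> variables their number stays bounded because the
  bound in Property star does not depend on \<open>k\<close>.\<close>

context vector_space
begin

lemma span_Diff_Int_span:
  assumes "independent C" "B \<subseteq> C"
  shows "span (C - B) \<inter> span B = {0}"
proof -
  have "x = 0" if x: "x \<in> span (C - B)" "x \<in> span B" for x
  proof -
    have C: "x \<in> span C" using x(2) assms(2) span_mono by blast
    have "representation C x = representation (C - B) x"
      using assms x by (intro representation_extend) auto
    moreover have "representation C x = representation B x"
      using assms x by (intro representation_extend) auto
    ultimately have "representation C x b = 0" for b
      using representation_ne_zero[of "C - B" x b] representation_ne_zero[of B x b] by auto
    then show "x = 0" using sum_nonzero_representation_eq[OF assms(1) C] by simp
  qed
  then show ?thesis using span_zero by blast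
qed

lemma exists_basis_modulo:
  assumes "subspace V" "subspace W" "W \<subseteq> V"
  shows "\<exists>S. basis_modulo scale V W S"
proof -
  obtain B where B: "B \<subseteq> W" "independent B" "W \<subseteq> span B"
    using maximal_independent_subset by blast
  obtain C where C: "B \<subseteq> C" "C \<subseteq> V" "independent C" "V \<subseteq> span C"
    using maximal_independent_subset_extend[of B V] B assms by blast
  have W: "W = span B" using B assms(2) span_minimal by blast
  have "basis_modulo scale V W (C - B)"
    unfolding basis_modulo_def
  proof (intro conjI)
    show "span (C - B) \<inter> W = {0}" using span_Diff_Int_span C W by blast
    show "V \<subseteq> span (C - B \<union> W)"
    proof -
      have "C \<subseteq> C - B \<union> W" using B by blast
      then show ?thesis using C(4) span_mono by blast
    qed
    show "independent (C - B)" using C(3) independent_mono by blast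
  qed (use C in auto)
  then show ?thesis ..
qed

text \<open>Finiteness of \<open>S\<close> belongs to the conclusion because \<open>card\<close> of
  an infinite set is 0: a codimension is a cardinality, and lower bounds for it make sense only once
  the basis is known to be finite.\<close>

lemma card_le_separating_functionals:
  fixes \<phi> :: "'i \<Rightarrow> 'b \<Rightarrow> 'a"
  assumes fin: "finite I" and lin: "\<And>i. i \<in> I \<Longrightarrow> Vector_Spaces.linear scale (*) (\<phi> i)"
    and S: "independent S"
    and sep: "\<And>x. x \<in> span S \<Longrightarrow> \<forall>i\<in>I. \<phi> i x = 0 \<Longrightarrow> x = 0"
  shows "finite S \<and> card S \<le> card I"
proof -
  \<comment> \<open>\<open>hpscale\<close> with the one-point type in place of \<open>H\<close>
    serves as a coordinate space: the words of length one over \<open>I\<close> are coordinate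
    vectors, and \<open>T x\<close> lists the values of all functionals at \<open>x\<close>.\<close>
  define T :: "'b \<Rightarrow> ('i, unit, 'a) hpoly"
    where "T x = (\<Sum>i\<in>I. hpscale (\<phi> i x) (monomial [(i, ())]))" for x
  let ?E = "(\<lambda>i. monomial [(i, ())]) ` I :: ('i, unit, 'a) hpoly set"
  have add: "\<phi> i (x + y) = \<phi> i x + \<phi> i y" and sc: "\<phi> i (scale c x) = c * \<phi> i x" if "i \<in> I" for i x y c
    using lin[OF that] by (auto simp: Vector_Spaces.linear_iff)
  have "Vector_Spaces.linear scale hpscale T"
    by (auto simp: Vector_Spaces.linear_iff vector_space_axioms hp.vector_space_axioms T_def add sc hp.scale_left_distrib sum.distrib hp.scale_sum_right)
  then interpret T: Vector_Spaces.linear scale hpscale T .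
  have lookupT: "Poly_Mapping.lookup (T x) [(i, ())] = \<phi> i x" if "i \<in> I" for i x
    using that fin by (simp add: T_def lookup_sum lookup_hpscale monomial_def lookup_single when_def
        if_distrib sum.delta cong: if_cong)
  have inj: "inj_on T (span S)"
  proof (rule inj_onI)
    fix x y assume xy: "x \<in> span S" "y \<in> span S" "T x = T y"
    have "x - y = 0"
    proof (rule sep)
      show "x - y \<in> span S" using xy span_diff by blast
      have "T (x - y) = 0" using xy T.diff by simp
      then show "\<forall>i\<in>I. \<phi> i (x - y) = 0" using lookupT by (metis lookup_zero)
    qed
    then show "x = y" by simp
  qed
  have ind: "hp.independent (T ` S)"
    using T.independent_injective_image S inj by blast
  have "T ` S \<subseteq> hp.span ?E"
  proof (rule image_subsetI)
    fix x
    show "T x \<in> hp.span ?E"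
      unfolding T_def by (rule hp.span_sum, rule hp.span_scale, rule hp.span_base, rule imageI)
  qed
  then have "finite (T ` S) \<and> card (T ` S) \<le> card ?E"
    using hp.independent_span_bound[of ?E "T ` S"] ind fin by blast
  moreover have "inj_on T S" using inj inj_on_subset span_superset by blast
  moreover have "card ?E \<le> card I" using fin by (rule card_image_le)
  ultimately show ?thesis
    by (auto simp: card_image dest: finite_imageD)
qed

end

text \<open>Modulo \<open>W\<close> the \<open>g i\<close> are independent: in a vanishing
  combination take the index \<open>k\<close> of largest rank among the nonzero coefficients; then
  \<open>\<phi> k\<close> annihilates all other terms and isolates the diagonal one. Representatives
  \<open>s i\<close> in the span of \<open>S\<close> have the same values, since each
  \<open>\<phi> i\<close> vanishes on \<open>W\<close>.\<close>

lemma (in vector_space_pair) card_le_triangular: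
  fixes \<phi> :: "'i \<Rightarrow> 'b \<Rightarrow> 'c" and rank :: "'i \<Rightarrow> nat"
  assumes S: "finite S" and V: "V \<subseteq> vs1.span (S \<union> W)" and W: "vs1.subspace W"
    and fin: "finite I" and lin: "\<And>i. i \<in> I \<Longrightarrow> Vector_Spaces.linear s1 s2 (\<phi> i)"
    and null: "\<And>i x. i \<in> I \<Longrightarrow> x \<in> W \<Longrightarrow> \<phi> i x = 0"
    and g: "\<And>i. i \<in> I \<Longrightarrow> g i \<in> V" and diag: "\<And>i. i \<in> I \<Longrightarrow> \<phi> i (g i) \<noteq> 0"
    and tri: "\<And>i j. i \<in> I \<Longrightarrow> j \<in> I \<Longrightarrow> \<phi> i (g j) \<noteq> 0 \<Longrightarrow> i = j \<or> rank i < rank j"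
  shows "card I \<le> card S"
proof -
  have "\<exists>x. x \<in> vs1.span S \<and> g i - x \<in> W" if "i \<in> I" for i
  proof -
    have "g i \<in> vs1.span (S \<union> W)" using g[OF that] V by blast
    then obtain x y where "g i = x + y" "x \<in> vs1.span S" "y \<in> vs1.span W"
      unfolding vs1.span_Un by blast
    moreover have "vs1.span W = W" using W vs1.span_eq_iff by blast
    ultimately show ?thesis by (metis add_diff_cancel_left')
  qed
  then have "\<forall>i\<in>I. \<exists>x. x \<in> vs1.span S \<and> g i - x \<in> W" by blast
  then obtain s where s: "\<forall>i\<in>I. s i \<in> vs1.span S \<and> g i - s i \<in> W"
    by (rule bchoice[THEN exE])
  have phi_s: "\<phi> i (s j) = \<phi> i (g j)" if "i \<in> I" "j \<in> I" for i j
  proof -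
    interpret P: Vector_Spaces.linear s1 s2 "\<phi> i" using lin that by blast
    have "\<phi> i (g j - s j) = 0" using null that s by blast
    then show ?thesis by (simp add: P.diff)
  qed
  have inj: "inj_on s I"
  proof (rule inj_onI, rule ccontr)
    fix i j assume ij: "i \<in> I" "j \<in> I" "s i = s j" "i \<noteq> j"
    then have "\<phi> i (g j) \<noteq> 0" "\<phi> j (g i) \<noteq> 0"
      using phi_s diag by (metis+)
    then show False using tri ij by (metis less_asym)
  qed
  have "vs1.independent (s ` I)"
    unfolding vs1.dependent_explicit
  proof
    assume "\<exists>t u. finite t \<and> t \<subseteq> s ` I \<and> (\<Sum>v\<in>t. s1 (u v) v) = 0 \<and> (\<exists>v\<in>t. u v \<noteq> 0)"
    then obtain t u where tu: "finite t" "t \<subseteq> s ` I" "(\<Sum>v\<in>t. s1 (u v) v) = 0" "\<exists>v\<in>t. u v \<noteq> 0"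
      by blast
    obtain T where T: "T \<subseteq> I" "t = s ` T" using tu(2) subset_image_iff by metis
    have injT: "inj_on s T" using inj T inj_on_subset by blast
    have finT: "finite T" using T fin finite_subset by blast
    have sum0: "(\<Sum>i\<in>T. s1 (u (s i)) (s i)) = 0"
      using tu(3) unfolding T(2) by (simp add: sum.reindex[OF injT])
    let ?N = "{i\<in>T. u (s i) \<noteq> 0}"
    have N: "finite ?N" "?N \<noteq> {}" using finT tu(4) T by auto
    have "Max (rank ` ?N) \<in> rank ` ?N" using N by (intro Max_in) auto
    then obtain k where kN: "k \<in> ?N" "rank k = Max (rank ` ?N)" by force
    have kmax: "rank i \<le> rank k" if "i \<in> ?N" for i
      unfolding kN(2) using N that by (intro Max_ge) auto
    note k = kN(1) kmax
    have kI: "k \<in> I" using k T by blast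
    interpret P: Vector_Spaces.linear s1 s2 "\<phi> k" using lin kI .
    have "0 = \<phi> k (\<Sum>i\<in>T. s1 (u (s i)) (s i))" using sum0 P.zero by simp
    also have "\<dots> = (\<Sum>i\<in>T. s2 (u (s i)) (\<phi> k (g i)))"
      using phi_s kI T by (auto simp: P.sum P.scale intro!: sum.cong)
    also have "\<dots> = (\<Sum>i\<in>T. if i = k then s2 (u (s i)) (\<phi> k (g i)) else 0)"
    proof (intro sum.cong refl)
      fix i assume i: "i \<in> T"
      show "s2 (u (s i)) (\<phi> k (g i)) = (if i = k then s2 (u (s i)) (\<phi> k (g i)) else 0)"
      proof (cases "i = k \<or> u (s i) = 0")
        case False
        then have "rank i \<le> rank k" using k(2) i by blast
        then have "\<phi> k (g i) = 0" using tri[of k i] kI i T False by force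
        then show ?thesis using False by simp
      qed auto
    qed
    also have "\<dots> = s2 (u (s k)) (\<phi> k (g k))" using k finT by simp
    finally show False using diag[OF kI] k by simp
  qed
  moreover have "s ` I \<subseteq> vs1.span S" using s by blast
  ultimately have "card (s ` I) \<le> card S" using vs1.independent_span_bound S by blast
  then show ?thesis using card_image[OF inj] by simp
qed

section \<open>Codimensions bounded through evaluations on finitely many tuples\<close>

context gen_H_action
begin

lemma linear_eval_hp: "Vector_Spaces.linear hpscale scale (eval_hp a)"
  by (auto simp: Vector_Spaces.linear_iff vector_space_axioms hp.vector_space_axioms eval_hp_add eval_hp_scale)

lemma subspace_PH: "hp.subspace (PH scaleH n)"
  unfolding PH_def multilinear_hpolys_def by (rule hp.subspace_span)

lemma IdH_iff: "f \<in> IdH \<longleftrightarrow> Poly_Mapping.lookup f [] = 0 \<and> (\<forall>a. eval_hp a f = 0)"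
  by (auto simp: IdH_def in_keys_iff)

lemma subspace_IdH: "hp.subspace IdH"
  by (auto simp: hp.subspace_def IdH_iff eval_hp_add eval_hp_scale lookup_add lookup_hpscale)
    (simp add: eval_hp_def)

lemma lookup_multilinear_Nil:
  assumes "f \<in> multilinear_hpolys scaleH V"
  shows "Poly_Mapping.lookup f [] = 0"
  using assms unfolding multilinear_hpolys_def
proof (induction rule: hp.span_induct_alt)
  case (step c g f)
  then have "Poly_Mapping.lookup g [] = 0"
    using eval_tensor_relations(1)[of g] by (auto simp: lookup_monomial_Nil in_keys_iff)
  with step show ?case by (simp add: lookup_add lookup_hpscale)
qed simp

lemma obtain_codimH:
  obtains S where "basis_modulo hpscale (PH scaleH n) (PH scaleH n \<inter> IdH) S" "codimH n = card S"
proof -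
  have "\<exists>S. basis_modulo hpscale (PH scaleH n) (PH scaleH n \<inter> IdH) S"
    by (rule hp.exists_basis_modulo)
      (auto intro: subspace_PH subspace_IdH hp.subspace_inter)
  from someI_ex[OF this] show ?thesis
    using that unfolding codimH_def quotient_dim_def by blast
qed

text \<open>The separating functionals are the coordinates of the values at the tuples in
  \<open>T\<close>. A combination of \<open>S\<close> on which all of them vanish is an identity by
  \<open>det\<close>, and the span of \<open>S\<close> meets the identities only in 0.\<close>

lemma card_basis_modulo_le:
  assumes S: "basis_modulo hpscale (PH scaleH n) (PH scaleH n \<inter> IdH) S"
    and fd: "finite_dimensional_vector_space scale Basis"
    and T: "finite T"
    and det: "\<And>f a. f \<in> PH scaleH n \<Longrightarrow> \<forall>t\<in>T. eval_hp t f = 0 \<Longrightarrow> eval_hp a f = 0"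
  shows "finite S \<and> card S \<le> card T * card Basis"
proof -
  interpret fd: finite_dimensional_vector_space scale Basis by (rule fd)
  have Basis: "independent Basis" "span Basis = UNIV" "finite Basis"
    using fd.independent_Basis fd.span_Basis fd.finite_Basis by auto
  let ?\<phi> = "\<lambda>(t, b) f. representation Basis (eval_hp t f) b"
  have "finite S \<and> card S \<le> card (T \<times> Basis)"
  proof (rule hp.card_le_separating_functionals[where \<phi> = ?\<phi>])
    show "finite (T \<times> Basis)" using T Basis by simp
    show "hp.independent S" using S by (simp add: basis_modulo_def)
    show "Vector_Spaces.linear hpscale (*) (?\<phi> i)" for i
      unfolding Vector_Spaces.linear_iff
      by (intro conjI hp.vector_space_axioms, unfold_locales)
        (auto simp: eval_hp_add eval_hp_scale representation_add representation_scale Basis algebra_simps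
         split: prod.split)
    fix f assume f: "f \<in> hp.span S" "\<forall>i\<in>T \<times> Basis. ?\<phi> i f = 0"
    have PH: "f \<in> PH scaleH n"
      using f(1) S hp.span_minimal[OF _ subspace_PH] by (auto simp: basis_modulo_def)
    have "eval_hp t f = 0" if "t \<in> T" for t
    proof -
      have "representation Basis (eval_hp t f) b = 0" for b
        using f(2) that representation_ne_zero[of Basis "eval_hp t f" b] by fastforce
      then show ?thesis using sum_nonzero_representation_eq[OF Basis(1), of "eval_hp t f"] Basis(2) by simp
    qed
    then have "f \<in> IdH"
      using det PH lookup_multilinear_Nil by (auto simp: IdH_iff PH_def)
    then show "f = 0" using S f(1) PH by (auto simp: basis_modulo_def)
  qed
  then show ?thesis by (simp add: card_cartesian_product)
qed

lemma codimH_le: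
  assumes "finite_dimensional_vector_space scale Basis" "finite T"
    and "\<And>f a. f \<in> PH scaleH n \<Longrightarrow> \<forall>t\<in>T. eval_hp t f = 0 \<Longrightarrow> eval_hp a f = 0"
  shows "codimH n \<le> card T * card Basis"
  using obtain_codimH[of n] card_basis_modulo_le[OF _ assms] by metis

text \<open>\<open>T\<close> supplies the finiteness of the basis whose cardinality is
  \<open>codimH n\<close>; the count itself comes from the triangular matrix of the values of the
  \<open>g j\<close> at the assignments \<open>a i\<close>.\<close>

lemma codimH_ge:
  fixes rank :: "'i \<Rightarrow> nat"
  assumes "finite_dimensional_vector_space scale Basis" "finite T"
    and "\<And>f a. f \<in> PH scaleH n \<Longrightarrow> \<forall>t\<in>T. eval_hp t f = 0 \<Longrightarrow> eval_hp a f = 0"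
    and "finite I"
    and "\<And>i. i \<in> I \<Longrightarrow> g i \<in> PH scaleH n" and "\<And>i. i \<in> I \<Longrightarrow> eval_hp (a i) (g i) \<noteq> 0"
    and "\<And>i j. i \<in> I \<Longrightarrow> j \<in> I \<Longrightarrow> eval_hp (a i) (g j) \<noteq> 0 \<Longrightarrow> i = j \<or> rank i < rank j"
  shows "card I \<le> codimH n"
proof -
  obtain S where S: "basis_modulo hpscale (PH scaleH n) (PH scaleH n \<inter> IdH) S" "codimH n = card S"
    using obtain_codimH .
  interpret vector_space_pair hpscale scale by unfold_locales
  have "card I \<le> card S"
  proof (rule card_le_triangular[where V = "PH scaleH n" and W = "PH scaleH n \<inter> IdH"
        and \<phi> = "\<lambda>i. eval_hp (a i)" and g = g and rank = rank])
    show "finite S" using card_basis_modulo_le[OF S(1) assms(1-3)] by blast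
    show "PH scaleH n \<subseteq> hp.span (S \<union> (PH scaleH n \<inter> IdH))" using S(1) by (simp add: basis_modulo_def)
    show "hp.subspace (PH scaleH n \<inter> IdH)" by (intro hp.subspace_inter subspace_PH subspace_IdH)
    show "eval_hp (a i) f = 0" if "f \<in> PH scaleH n \<inter> IdH" for i f
      using that by (simp add: IdH_iff)
    show "i = j \<or> rank i < rank j" if "i \<in> I" "j \<in> I" "eval_hp (a i) (g j) \<noteq> 0" for i j
      using assms(7) that by blast
  qed (use assms(4-6) linear_eval_hp in blast)+
  then show ?thesis using S(2) by simp
qed

end

section \<open>Words and columns\<close>

lemma exp_power_le_fact: "(real n / exp 1) ^ n \<le> fact n"
proof -
  \<comment> \<open>The left side is a single term of the exponential series at
    \<open>n\<close>.\<close>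
  have "real n ^ n / fact n \<le> (\<Sum>k\<in>{n}. real n ^ k / fact k)" by simp
  also have "\<dots> \<le> exp (real n)"
    using sum_le_suminf[OF summable_exp_generic[of "real n"], of "{n}"]
    by (simp add: exp_def divide_inverse mult.commute)
  finally show ?thesis
    by (simp add: power_divide exp_of_nat_mult[symmetric] field_simps)
qed

text \<open>The induction step amounts to e \<le> (1 + 1/n)^(n+1), which is
  \<open>ln x \<le> x - 1\<close> at \<open>x = n / (n + 1)\<close>.\<close>

lemma fact_le_exp_power:
  assumes "n \<ge> 1"
  shows "fact n \<le> exp 1 * real n * (real n / exp 1) ^ n"
  using assms
proof (induction n rule: dec_induct)
  case base
  then show ?case by simp
next
  case (step n)
  have n: "real n > 0" using step by simp
  have "1 - real n / real (Suc n) \<le> - ln (real n / real (Suc n))"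
    using ln_le_minus_one[of "real n / real (Suc n)"] n by simp
  then have "1 \<le> real (Suc n) * (ln (real (Suc n)) - ln (real n))"
    using n by (simp add: ln_div field_simps)
  then have "exp 1 \<le> exp (real (Suc n) * (ln (real (Suc n)) - ln (real n)))" by simp
  also have "\<dots> = (real (Suc n) / real n) ^ Suc n"
    using n by (subst exp_of_nat_mult) (simp add: exp_diff)
  finally have e: "exp 1 * real n ^ Suc n \<le> real (Suc n) ^ Suc n"
    using n by (simp add: power_divide field_simps)
  have "fact (Suc n) = real (Suc n) * fact n" by simp
  also have "\<dots> \<le> real (Suc n) * (exp 1 * real n * (real n / exp 1) ^ n)"
    using step by (intro mult_left_mono) auto
  also have "\<dots> = exp 1 * real (Suc n) * ((exp 1 * real n ^ Suc n) / exp 1 ^ Suc n)"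
    by (simp add: power_divide)
  also have "\<dots> \<le> exp 1 * real (Suc n) * (real (Suc n) ^ Suc n / exp 1 ^ Suc n)"
    using e by (intro mult_left_mono divide_right_mono) auto
  finally show ?case by (simp add: power_divide)
qed

definition balanced_words :: "nat \<Rightarrow> nat \<Rightarrow> nat list set" where
  "balanced_words d b = {v. length v = d * b \<and> set v \<subseteq> {..<d} \<and> (\<forall>i<d. count_list v i = b)}"

lemma card_balanced_words: "real (card (balanced_words d b)) * fact b ^ d = fact (d * b)"
proof (cases "b = 0")
  case True
  then have "balanced_words d b = {[]}" by (auto simp: balanced_words_def)
  then show ?thesis using True by simp
next
  case False
  define M where "M = (\<Sum>i\<in>{..<d}. replicate_mset b i)"
  have count: "count M i = (if i < d then b else 0)" for i
    by (simp add: M_def count_sum)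
  have set: "set_mset M = {..<d}"
    using False by (auto simp: set_mset_def count split: if_splits)
  have size: "size M = d * b"
    unfolding M_def by (induction d) auto
  have "balanced_words d b = permutations_of_multiset M"
  proof (intro set_eqI iffI)
    fix v assume v: "v \<in> balanced_words d b"
    have "count (mset v) i = count M i" for i
      using v by (cases "i < d") (auto simp: balanced_words_def count count_mset count_list_0_iff)
    then show "v \<in> permutations_of_multiset M"
      by (simp add: permutations_of_multiset_def multiset_eqI)
  next
    fix v assume "v \<in> permutations_of_multiset M"
    then have v: "mset v = M" by (simp add: permutations_of_multiset_def)
    have "length v = d * b" using size v by (metis size_mset)
    moreover have "set v = {..<d}" using set v by (metis set_mset_mset)
    moreover have "count_list v i = b" if "i < d" for i
      using count[of i] v that by (metis count_mset)
    ultimately show "v \<in> balanced_words d b" by (simp add: balanced_words_def)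
  qed
  moreover have "(\<Prod>x\<in>set_mset M. fact (count M x)) = (fact b ^ d :: nat)"
    unfolding set by (simp add: count)
  ultimately have "card (balanced_words d b) * fact b ^ d = (fact (d * b) :: nat)"
    using card_permutations_of_multiset[of M] size by (metis dvd_div_mult_self)
  then show ?thesis by (metis of_nat_fact of_nat_mult of_nat_power)
qed

text \<open>In the multinomial coefficient the powers of \<open>b / e\<close> cancel between the two
  factorial estimates. What remains is the full count of words up to a denominator polynomial in
  \<open>b\<close>, so that the growth per letter approaches \<open>d\<close> for large
  \<open>b\<close>.\<close>

lemma card_balanced_words_ge:
  assumes "b \<ge> 1"
  shows "real d ^ (d * b) / (exp 1 * real b) ^ d \<le> real (card (balanced_words d b))"
proof -
  have "fact b ^ d \<le> (exp 1 * real b * (real b / exp 1) ^ b) ^ d"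
    using fact_le_exp_power[OF assms] by (intro power_mono) auto
  then have "real d ^ (d * b) * fact b ^ d
      \<le> real d ^ (d * b) * (exp 1 * real b * (real b / exp 1) ^ b) ^ d"
    by (intro mult_left_mono) auto
  also have "\<dots> = (exp 1 * real b) ^ d * (real (d * b) / exp 1) ^ (d * b)"
    by (simp add: power_mult_distrib power_divide power_mult[symmetric] mult.commute)
  also have "\<dots> \<le> (exp 1 * real b) ^ d * fact (d * b)"
    using exp_power_le_fact[of "d * b"] by (intro mult_left_mono) auto
  also have "\<dots> = (exp 1 * real b) ^ d * (real (card (balanced_words d b)) * fact b ^ d)"
    by (simp add: card_balanced_words)
  finally show ?thesis
    using assms by (simp add: field_simps)
qed

lemma card_div_eq:
  assumes "b > 0" "i < d"
  shows "card {q. q < d * b \<and> q div b = i} = (b::nat)"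
proof -
  have "{q. q < d * b \<and> q div b = i} = {i * b..<i * b + b}"
  proof (intro set_eqI iffI)
    fix q assume "q \<in> {q. q < d * b \<and> q div b = i}"
    then show "q \<in> {i * b..<i * b + b}"
      using assms by (auto simp: dividend_less_div_times intro: order.trans[OF _ times_div_less_eq_dividend])
        (metis add.commute dividend_less_div_times)
  next
    fix q assume q: "q \<in> {i * b..<i * b + b}"
    then have "q div b = i" using assms by (intro div_nat_eqI) (auto simp: mult.commute)
    moreover have "i * b + b \<le> d * b" using assms by (metis Suc_leI add.commute mult_Suc mult_le_mono1)
    ultimately show "q \<in> {q. q < d * b \<and> q div b = i}" using q by auto
  qed
  then show ?thesis by simp
qed

text \<open>A cell \<open>(t, q)\<close> is the \<open>q\<close>-th cell of the block at time \<open>t\<close>. Letter \<open>i\<close> occurs \<open>b\<close> times in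
  each of the blocks \<open>i, \<dots>, i + s - 1\<close>, so that the letters \<open>0, \<dots>, d - 1\<close> of a column can be taken
  from consecutive blocks; in the blocks with all letters the arrangement is arbitrary.\<close>

definition cells :: "nat \<Rightarrow> nat \<Rightarrow> nat \<Rightarrow> (nat \<times> nat) set" where
  "cells d b s = {(t, q). q < d * b \<and> q div b \<le> t \<and> t < s + q div b}"

definition block_words :: "nat \<Rightarrow> nat \<Rightarrow> nat \<Rightarrow> (nat \<times> nat \<Rightarrow> nat) set" where
  "block_words d b s = {w \<in> cells d b s \<rightarrow>\<^sub>E {..<d}.
     \<forall>i<d. \<forall>t. card {q. (t, q) \<in> cells d b s \<and> w (t, q) = i} = (if i \<le> t \<and> t < s + i then b else 0)}"

text \<open>\<open>\<tau> (c, i)\<close> is the cell that supplies letter \<open>i\<close> to column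
  \<open>c\<close>. Column \<open>c\<close> starts at time \<open>c div b\<close>, and inside a
  column time equals the letter up to this constant; the comparison of moments rests on
  this.\<close>

definition column_bijection ::
    "nat \<Rightarrow> nat \<Rightarrow> nat \<Rightarrow> (nat \<times> nat \<Rightarrow> nat) \<Rightarrow> (nat \<times> nat \<Rightarrow> nat \<times> nat) \<Rightarrow> bool" where
  "column_bijection d b s w \<tau> \<longleftrightarrow>
     bij_betw \<tau> ({..<s * b} \<times> {..<d}) (cells d b s) \<and>
     (\<forall>c<s * b. \<forall>i<d. w (\<tau> (c, i)) = i \<and> fst (\<tau> (c, i)) = c div b + i)"

lemma finite_cells: "finite (cells d b s)"
proof (rule finite_subset)
  show "cells d b s \<subseteq> {..<s + d * b} \<times> {..<d * b}"
    by (auto simp: cells_def) (metis add_less_cancel_left div_le_dividend le_less_trans less_le_trans nat_add_left_cancel_le order_less_imp_le)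
qed simp

lemma finite_block_words: "finite (block_words d b s)"
  by (rule finite_subset[of _ "cells d b s \<rightarrow>\<^sub>E {..<d}"])
    (auto simp: block_words_def intro!: finite_PiE finite_cells)

lemma finite_cells_row: "finite {q. (t, q) \<in> cells d b s \<and> P q}"
  by (rule finite_subset[of _ "{..<d * b}"]) (auto simp: cells_def)

text \<open>Letter \<open>i\<close> occupies \<open>b\<close> cells in each of the \<open>s\<close>
  blocks from time \<open>i\<close> on. Once these are enumerated, the \<open>\<beta>\<close>-th of
  them at time \<open>t\<close> goes to column \<open>(t - i) * b + \<beta>\<close>.\<close>

lemma column_bijection_exists:
  assumes b: "b > 0" and w: "w \<in> block_words d b s"
  shows "\<exists>\<tau>. column_bijection d b s w \<tau>"
proof -
  let ?R = "\<lambda>t i. {q. (t, q) \<in> cells d b s \<and> w (t, q) = i}"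
  have card: "card (?R t i) = (if i \<le> t \<and> t < s + i then b else 0)" if "i < d" for t i
    using w that by (simp add: block_words_def)
  have "\<exists>h. bij_betw h {..<b} (?R t i)" if "i < d" "i \<le> t" "t < s + i" for t i
  proof -
    obtain h where "bij_betw h {0..<card (?R t i)} (?R t i)"
      using ex_bij_betw_nat_finite[OF finite_cells_row[of t d b s "\<lambda>q. w (t, q) = i"]] by blast
    moreover have "card (?R t i) = b" using card[OF that(1), of t] that by simp
    ultimately show ?thesis by (auto simp: atLeast0LessThan)
  qed
  then have "\<forall>t i. \<exists>h. i < d \<longrightarrow> i \<le> t \<longrightarrow> t < s + i \<longrightarrow> bij_betw h {..<b} (?R t i)" by blast
  then obtain h where h: "\<And>t i. i < d \<Longrightarrow> i \<le> t \<Longrightarrow> t < s + i \<Longrightarrow> bij_betw (h t i) {..<b} (?R t i)"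
    unfolding choice_iff by blast
  define \<tau> where "\<tau> = (\<lambda>(c, i). (c div b + i, h (c div b + i) i (c mod b)))"
  have cdiv: "c div b < s" if "c < s * b" for c using that b by (simp add: less_mult_imp_div_less)
  have cmod: "c mod b < b" for c using b by simp
  have hR: "h (c div b + i) i (c mod b) \<in> ?R (c div b + i) i" if "c < s * b" "i < d" for c i
    using h[OF that(2), of "c div b + i"] cdiv[OF that(1)] cmod[of c]
    by (auto simp: bij_betw_def)
  have w\<tau>: "w (\<tau> (c, i)) = i" "fst (\<tau> (c, i)) = c div b + i" "\<tau> (c, i) \<in> cells d b s"
    if "c < s * b" "i < d" for c i
    using hR[OF that] by (auto simp: \<tau>_def)
  have "inj_on \<tau> ({..<s * b} \<times> {..<d})"
  proof (rule inj_onI, clarsimp)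
    fix c i c' i' assume A: "c < s * b" "i < d" "c' < s * b" "i' < d" "\<tau> (c, i) = \<tau> (c', i')"
    have i: "i = i'" using w\<tau>(1)[OF A(1,2)] w\<tau>(1)[OF A(3,4)] A(5) by simp
    have div: "c div b = c' div b" using w\<tau>(2)[OF A(1,2)] w\<tau>(2)[OF A(3,4)] A(5) i by simp
    have "h (c div b + i) i (c mod b) = h (c div b + i) i (c' mod b)"
      using A(5) i div by (simp add: \<tau>_def)
    then have "c mod b = c' mod b"
      using h[OF A(2), of "c div b + i"] cdiv[OF A(1)] cmod by (auto simp: bij_betw_def inj_on_def)
    with div i show "c = c' \<and> i = i'" by (metis mult_div_mod_eq)
  qed
  moreover have "\<tau> ` ({..<s * b} \<times> {..<d}) = cells d b s"
  proof (intro equalityI subsetI)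
    fix x assume x: "x \<in> cells d b s"
    obtain t q where tq: "x = (t, q)" by (cases x)
    let ?i = "w (t, q)"
    have i: "?i < d" using w x tq by (auto simp: block_words_def PiE_iff)
    have q: "q \<in> ?R t ?i" using x tq by simp
    then have "card (?R t ?i) \<noteq> 0" using finite_cells_row[of t d b s "\<lambda>q. w (t, q) = ?i"] by (metis (no_types, lifting) card_0_eq empty_iff)
    then have t: "?i \<le> t" "t < s + ?i" using card[OF i, of t] by (auto split: if_splits)
    obtain \<beta> where \<beta>: "\<beta> < b" "q = h t ?i \<beta>"
      using h[OF i t] q by (auto simp: bij_betw_def)
    let ?c = "(t - ?i) * b + \<beta>"
    have c: "?c div b = t - ?i" "?c mod b = \<beta>" using \<beta> by auto
    have "?c < s * b"
    proof -
      have "t - ?i < s" using t by simp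
      then have "(t - ?i + 1) * b \<le> s * b" by (intro mult_right_mono) auto
      then show ?thesis using \<beta> by (simp add: algebra_simps)
    qed
    moreover have "\<tau> (?c, ?i) = x" unfolding \<tau>_def using c t \<beta> tq by simp
    ultimately show "x \<in> \<tau> ` ({..<s * b} \<times> {..<d})" using i by force
  qed (use w\<tau> in auto)
  ultimately show ?thesis
    unfolding column_bijection_def bij_betw_def using w\<tau> by blast
qed

text \<open>All letters are present exactly in the blocks at times \<open>d - 1, ..., s - 1\<close>,
  where any balanced word may be written; truncated subtraction gives the bound 1 if there is no
  such block. Elsewhere \<open>F\<close> writes \<open>q div b\<close>, which has the required
  letter counts because the cell \<open>(t, q)\<close> exists exactly if letter
  \<open>q div b\<close> is present at time \<open>t\<close>.\<close>

lemma card_block_words_ge: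
  assumes b: "b > 0" and d: "d > 0"
  shows "card (balanced_words d b) ^ (Suc s - d) \<le> card (block_words d b s)"
proof -
  let ?M = "{d - 1..<s}"
  let ?V = "?M \<rightarrow>\<^sub>E balanced_words d b"
  define F :: "(nat \<Rightarrow> nat list) \<Rightarrow> nat \<times> nat \<Rightarrow> nat"
    where "F v = (\<lambda>x\<in>cells d b s. if fst x \<in> ?M then v (fst x) ! snd x else snd x div b)" for v
  have divd: "q div b < d" if "q < d * b" for q using that by (simp add: less_mult_imp_div_less)
  have row: "(t, q) \<in> cells d b s \<longleftrightarrow> q < d * b" if "t \<in> ?M" for t q
    using divd[of q] that d by (auto simp: cells_def)
  have V: "length (v t) = d * b" "set (v t) \<subseteq> {..<d}" "\<And>i. i < d \<Longrightarrow> count_list (v t) i = b"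
    if "v \<in> ?V" "t \<in> ?M" for v t
    using that by (auto simp: balanced_words_def PiE_iff)
  have "F v \<in> block_words d b s" if v: "v \<in> ?V" for v
    unfolding block_words_def mem_Collect_eq
  proof (intro conjI allI impI)
    show "F v \<in> cells d b s \<rightarrow>\<^sub>E {..<d}"
    proof (rule PiE_I)
      fix x assume x: "x \<in> cells d b s"
      then have q: "snd x < d * b" by (auto simp: cells_def)
      then show "F v x \<in> {..<d}"
        using x V(1,2)[OF v, of "fst x"] divd[OF q] nth_mem[of "snd x" "v (fst x)"]
        by (auto simp: F_def simp del: nth_mem)
    qed (simp add: F_def)
    fix i t assume i: "i < d"
    show "card {q. (t, q) \<in> cells d b s \<and> F v (t, q) = i} = (if i \<le> t \<and> t < s + i then b else 0)"
    proof (cases "t \<in> ?M")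
      case True
      have "{q. (t, q) \<in> cells d b s \<and> F v (t, q) = i} = {q. q < length (v t) \<and> i = v t ! q}"
        using True V(1)[OF v True] by (auto simp: F_def row)
      then have "card {q. (t, q) \<in> cells d b s \<and> F v (t, q) = i} = count_list (v t) i"
        by (simp add: count_list_eq_length_filter length_filter_conv_card)
      also have "\<dots> = b" using V(3)[OF v True i] .
      finally show ?thesis using True i d by auto
    next
      case False
      have "{q. (t, q) \<in> cells d b s \<and> F v (t, q) = i}
          = (if i \<le> t \<and> t < s + i then {q. q < d * b \<and> q div b = i} else {})"
        using False by (auto simp: F_def cells_def)
      then show ?thesis using card_div_eq[OF b i] by simp
    qed
  qed
  moreover have "inj_on F ?V"
  proof (rule inj_onI)
    fix v v' assume v: "v \<in> ?V" "v' \<in> ?V" "F v = F v'"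
    show "v = v'"
    proof (rule PiE_ext[OF v(1,2)])
      fix t assume t: "t \<in> ?M"
      show "v t = v' t"
      proof (rule nth_equalityI)
        show "length (v t) = length (v' t)" using V(1)[OF v(1) t] V(1)[OF v(2) t] by simp
        fix q assume "q < length (v t)"
        then have "(t, q) \<in> cells d b s" using V(1)[OF v(1) t] row[OF t] by simp
        then show "v t ! q = v' t ! q"
          using fun_cong[OF v(3), of "(t, q)"] t by (simp add: F_def)
      qed
    qed
  qed
  ultimately have "card ?V \<le> card (block_words d b s)"
    using finite_block_words by (intro card_inj_on_le[of F]) auto
  moreover have "card ?V = card (balanced_words d b) ^ (Suc s - d)"
    using d by (simp add: card_PiE)
  ultimately show ?thesis by simp
qed

text \<open>If \<open>u\<close> permutes the letters of the columns of \<open>w\<close>, then \<open>\<Sum> i \<pi>(i) \<le> \<Sum> i\<^sup>2\<close> in every column,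
  with equality only for \<open>\<pi> = id\<close>, because \<open>2 (\<Sum> i\<^sup>2 - \<Sum> i \<pi>(i)) = \<Sum> (\<pi>(i) - i)\<^sup>2\<close>.\<close>

definition moment :: "nat \<Rightarrow> nat \<Rightarrow> nat \<Rightarrow> (nat \<times> nat \<Rightarrow> nat) \<Rightarrow> nat" where
  "moment d b s u = (\<Sum>x\<in>cells d b s. u x * fst x)"

lemma moment_less:
  assumes u: "u \<in> block_words d b s" and w: "w \<in> block_words d b s"
    and \<tau>: "column_bijection d b s w \<tau>"
    and inj: "\<And>c. c < s * b \<Longrightarrow> inj_on (\<lambda>i. u (\<tau> (c, i))) {..<d}"
  shows "u = w \<or> moment d b s u < moment d b s w"
proof -
  have bij: "bij_betw \<tau> ({..<s * b} \<times> {..<d}) (cells d b s)"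
    and w\<tau>: "\<And>c i. c < s * b \<Longrightarrow> i < d \<Longrightarrow> w (\<tau> (c, i)) = i"
    and t\<tau>: "\<And>c i. c < s * b \<Longrightarrow> i < d \<Longrightarrow> fst (\<tau> (c, i)) = c div b + i"
    using \<tau> by (auto simp: column_bijection_def)
  have \<tau>cell: "\<tau> (c, i) \<in> cells d b s" if "c < s * b" "i < d" for c i
    using bij that by (auto simp: bij_betw_def)
  have ud: "u (\<tau> (c, i)) < d" if "c < s * b" "i < d" for c i
    using u \<tau>cell[OF that] by (auto simp: block_words_def PiE_iff)
  have perm: "(\<lambda>i. u (\<tau> (c, i))) ` {..<d} = {..<d}" if c: "c < s * b" for c
    using ud[OF c] inj[OF c] by (intro card_subset_eq) (auto simp: card_image)
  have mom: "int (moment d b s v) = (\<Sum>c<s * b. \<Sum>i<d. int (v (\<tau> (c, i))) * (int (c div b) + int i))" for v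
  proof -
    have "int (moment d b s v) = (\<Sum>x\<in>cells d b s. int (v x) * int (fst x))"
      by (simp add: moment_def)
    also have "\<dots> = (\<Sum>y\<in>{..<s * b} \<times> {..<d}. int (v (\<tau> y)) * int (fst (\<tau> y)))"
      by (rule sum.reindex_bij_betw[OF bij, symmetric])
    also have "\<dots> = (\<Sum>(c, i)\<in>{..<s * b} \<times> {..<d}. int (v (\<tau> (c, i))) * (int (c div b) + int i))"
      using t\<tau> by (intro sum.cong) auto
    finally show ?thesis by (simp add: sum.cartesian_product)
  qed
  \<comment> \<open>The starting time \<open>k\<close> of the column contributes equally to both
    sums, because \<open>u\<close> permutes the letters of the column.\<close>
  have col: "2 * ((\<Sum>i<d. int i * (k + int i)) - (\<Sum>i<d. int (u (\<tau> (c, i))) * (k + int i)))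
      = (\<Sum>i<d. (int (u (\<tau> (c, i))) - int i)\<^sup>2)" if c: "c < s * b" for c k
  proof -
    have re: "(\<Sum>i<d. f (u (\<tau> (c, i)))) = (\<Sum>i<d. f i)" for f :: "nat \<Rightarrow> int"
      using sum.reindex[OF inj[OF c], of f] perm[OF c] by simp
    have 1: "(\<Sum>i<d. int (u (\<tau> (c, i)))) = (\<Sum>i<d. int i)" using re[of int] .
    have 2: "(\<Sum>i<d. (int (u (\<tau> (c, i))))\<^sup>2) = (\<Sum>i<d. (int i)\<^sup>2)" using re[of "\<lambda>i. (int i)\<^sup>2"] .
    have "(\<Sum>i<d. (int (u (\<tau> (c, i))) - int i)\<^sup>2)
       = (\<Sum>i<d. (int (u (\<tau> (c, i))))\<^sup>2) + (\<Sum>i<d. (int i)\<^sup>2) - 2 * (\<Sum>i<d. int (u (\<tau> (c, i))) * int i)"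
      by (simp add: power2_diff sum.distrib sum_subtractf sum_distrib_left mult.assoc)
    also have "\<dots> = 2 * ((\<Sum>i<d. (int i)\<^sup>2) - (\<Sum>i<d. int (u (\<tau> (c, i))) * int i))"
      using 2 by simp
    finally show ?thesis
      using 1 by (simp add: distrib_left sum.distrib power2_eq_square sum_distrib_right[symmetric] sum_distrib_left[symmetric] algebra_simps)
  qed
  let ?D = "\<lambda>c. \<Sum>i<d. (int (u (\<tau> (c, i))) - int i)\<^sup>2"
  have diff: "2 * (int (moment d b s w) - int (moment d b s u)) = (\<Sum>c<s * b. ?D c)"
  proof -
    have "int (moment d b s w) = (\<Sum>c<s * b. \<Sum>i<d. int i * (int (c div b) + int i))"
      unfolding mom using w\<tau> by (intro sum.cong) auto
    then have "2 * (int (moment d b s w) - int (moment d b s u))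
       = (\<Sum>c<s * b. 2 * ((\<Sum>i<d. int i * (int (c div b) + int i)) - (\<Sum>i<d. int (u (\<tau> (c, i))) * (int (c div b) + int i))))"
      unfolding mom by (simp add: sum_subtractf sum_distrib_left right_diff_distrib)
    also have "\<dots> = (\<Sum>c<s * b. ?D c)" using col by (intro sum.cong) auto
    finally show ?thesis .
  qed
  have nonneg: "(\<Sum>c<s * b. ?D c) \<ge> 0" by (intro sum_nonneg) auto
  have eq: "u = w" if "(\<Sum>c<s * b. ?D c) = 0"
  proof -
    have D: "?D c = 0" if "c < s * b" for c
      using \<open>(\<Sum>c<s * b. ?D c) = 0\<close> that by (subst (asm) sum_nonneg_eq_0_iff) (auto intro: sum_nonneg)
    have ui: "u (\<tau> (c, i)) = i" if "c < s * b" "i < d" for c i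
      using D[OF that(1)] that(2) by (subst (asm) sum_nonneg_eq_0_iff) auto
    show "u = w"
    proof (rule PiE_ext[of u "cells d b s" _ w])
      show "u \<in> cells d b s \<rightarrow>\<^sub>E {..<d}" "w \<in> cells d b s \<rightarrow>\<^sub>E {..<d}"
        using u w by (auto simp: block_words_def)
      fix x assume "x \<in> cells d b s"
      then obtain c i where "c < s * b" "i < d" "x = \<tau> (c, i)"
        using bij unfolding bij_betw_def by blast
      then show "u x = w x" using ui w\<tau> by simp
    qed
  qed
  show ?thesis
  proof (cases "(\<Sum>c<s * b. ?D c) = 0")
    case False
    have "(\<Sum>c<s * b. ?D c) > 0" using le_neq_trans[OF nonneg False[symmetric]] .
    moreover have "y < x" if "2 * (int x - int y) = S" "0 < S" for x y S
      using that by presburger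
    ultimately have "moment d b s u < moment d b s w" using diff by blast
    then show ?thesis ..
  qed (use eq in blast)
qed

section \<open>Multilinear functions given by H-polynomials\<close>

lemma nprod_append:
  fixes as bs :: "'a::ring list"
  assumes "as \<noteq> []" "bs \<noteq> []"
  shows "nprod (as @ bs) = nprod as * nprod bs"
  using assms
proof (induction as rule: nprod.induct)
  case (2 a)
  then show ?case by (cases bs) auto
qed (auto simp: mult.assoc)

context assoc_algebra
begin

lemma ideal_mult_left: "ideal UNIV I \<Longrightarrow> x \<in> I \<Longrightarrow> r * x \<in> I"
  and ideal_mult_right: "ideal UNIV I \<Longrightarrow> x \<in> I \<Longrightarrow> x * r \<in> I"
  by (auto simp: ideal_def)

lemma nprod_in_ideal:
  assumes "ideal UNIV I" "x \<in> set as" "x \<in> I"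
  shows "nprod as \<in> I"
  using assms(2)
proof (induction as rule: nprod.induct)
  case (3 a b as)
  then show ?case using assms(1,3) by (auto intro: ideal_mult_left ideal_mult_right)
qed (use assms in auto)

end

context gen_H_action
begin

lemma act_add: "act h (x + y) = act h x + act h y"
  and act_scale_right: "act h (scale c x) = scale c (act h x)"
  using act_linear[of h] by (auto simp: Vector_Spaces.linear_iff)

lemma act_zero: "act h 0 = 0"
  by (metis act_add add_cancel_right_right)

text \<open>Passing from polynomials to functions divides out the tensor relations and the
  identities at once, and turns products, the action and substitutions into pointwise operations
  under which these sets are closed.\<close>

definition hfunctions :: "'v set \<Rightarrow> (('v \<Rightarrow> 'a) \<Rightarrow> 'a) set" where
  "hfunctions V = {g. \<exists>f\<in>multilinear_hpolys scaleH V. \<forall>a. g a = eval_hp a f}"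

definition monomial_value :: "('v \<times> 'h) list \<Rightarrow> ('v \<Rightarrow> 'a) \<Rightarrow> 'a" where
  "monomial_value m a = nprod (map (\<lambda>(x, h). act h (a x)) m)"

lemma hfunctions_zero: "(\<lambda>a. 0) \<in> hfunctions V"
proof -
  have "(0 :: ('b, 'h, 'f) hpoly) \<in> multilinear_hpolys scaleH V"
    unfolding multilinear_hpolys_def by (rule hp.span_zero)
  then show ?thesis
    unfolding hfunctions_def by (auto intro!: bexI[of _ 0] simp: eval_hp_def)
qed

lemma hfunctions_add:
  assumes "g \<in> hfunctions V" "g' \<in> hfunctions V"
  shows "(\<lambda>a. g a + g' a) \<in> hfunctions V"
proof -
  obtain f f' where f: "f \<in> multilinear_hpolys scaleH V" "\<And>a. g a = eval_hp a f"
    and f': "f' \<in> multilinear_hpolys scaleH V" "\<And>a. g' a = eval_hp a f'"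
    using assms by (auto simp: hfunctions_def)
  have "f + f' \<in> multilinear_hpolys scaleH V"
    using f(1) f'(1) unfolding multilinear_hpolys_def by (rule hp.span_add)
  then show ?thesis
    unfolding hfunctions_def using f(2) f'(2) by (auto simp: eval_hp_add intro!: bexI[of _ "f + f'"])
qed

lemma hfunctions_scale:
  assumes "g \<in> hfunctions V"
  shows "(\<lambda>a. scale c (g a)) \<in> hfunctions V"
proof -
  obtain f where f: "f \<in> multilinear_hpolys scaleH V" "\<And>a. g a = eval_hp a f"
    using assms by (auto simp: hfunctions_def)
  have "hpscale c f \<in> multilinear_hpolys scaleH V"
    using f(1) unfolding multilinear_hpolys_def by (rule hp.span_scale)
  then show ?thesis
    unfolding hfunctions_def using f(2) by (auto simp: eval_hp_scale intro!: bexI[of _ "hpscale c f"])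
qed

lemma hfunctions_sum:
  assumes "\<And>i. i \<in> S \<Longrightarrow> g i \<in> hfunctions V"
  shows "(\<lambda>a. \<Sum>i\<in>S. g i a) \<in> hfunctions V"
  using assms
  by (induction S rule: infinite_finite_induct) (auto simp: hfunctions_zero hfunctions_add)

lemma monomial_value_hfunctions:
  assumes "m \<noteq> []" "distinct (map fst m)" "set (map fst m) = V"
  shows "monomial_value m \<in> hfunctions V"
proof -
  have "monomial m \<in> multilinear_hpolys scaleH V"
    unfolding multilinear_hpolys_def using assms by (intro hp.span_base) auto
  then show ?thesis
    unfolding hfunctions_def by (auto simp: eval_hp_monomial monomial_value_def intro!: bexI[of _ "monomial m"])
qed

text \<open>Only the monomials among the generators have to be treated, because the tensor relations
  evaluate to 0.\<close>

lemma hfunctions_induct [consumes 1, case_names zero add]: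
  assumes g: "g \<in> hfunctions V"
    and zero: "P (\<lambda>a. 0)"
    and add: "\<And>c m g. m \<noteq> [] \<Longrightarrow> distinct (map fst m) \<Longrightarrow> set (map fst m) = V \<Longrightarrow> P g \<Longrightarrow>
      P (\<lambda>a. scale c (monomial_value m a) + g a)"
  shows "P g"
proof -
  obtain f where f: "f \<in> multilinear_hpolys scaleH V" "g = (\<lambda>a. eval_hp a f)"
    using g by (auto simp: hfunctions_def)
  from f(1) have "P (\<lambda>a. eval_hp a f)"
    unfolding multilinear_hpolys_def
  proof (induction rule: hp.span_induct_alt)
    case base
    then show ?case using zero by (simp add: eval_hp_def)
  next
    case (step c x y)
    from step(1) show ?case
    proof
      assume "x \<in> {monomial m |m. m \<noteq> [] \<and> distinct (map fst m) \<and> set (map fst m) = V}"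
      then obtain m where "x = monomial m" "m \<noteq> []" "distinct (map fst m)" "set (map fst m) = V" by blast
      with add[of m _ c] step(2) show ?case
        by (simp add: eval_hp_add eval_hp_scale eval_hp_monomial monomial_value_def)
    next
      assume "x \<in> tensor_relations scaleH"
      then have "eval_hp a x = 0" for a by (rule eval_tensor_relations(2))
      then show ?case using step(2) by (simp add: eval_hp_add eval_hp_scale)
    qed
  qed
  then show ?thesis using f(2) by simp
qed

lemma hfunctions_mult_monomial:
  assumes "g \<in> hfunctions W" "V \<inter> W = {}"
    and m: "m \<noteq> []" "distinct (map fst m)" "set (map fst m) = V"
  shows "(\<lambda>a. monomial_value m a * g a) \<in> hfunctions (V \<union> W)"
  using assms(1)
proof (induction rule: hfunctions_induct)
  case zero
  then show ?case by (simp add: hfunctions_zero)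
next
  case (add c m' g)
  have "monomial_value (m @ m') \<in> hfunctions (V \<union> W)"
    using add(1-3) m assms(2) by (intro monomial_value_hfunctions) auto
  moreover have "monomial_value (m @ m') a = monomial_value m a * monomial_value m' a" for a
    using m(1) add(1) by (simp add: monomial_value_def nprod_append)
  ultimately have "(\<lambda>a. monomial_value m a * monomial_value m' a) \<in> hfunctions (V \<union> W)"
    by (metis (no_types, lifting) ext)
  from hfunctions_add[OF hfunctions_scale[OF this, of c] add(4)] show ?case
    by (simp add: distrib_left scale_mult_right)
qed

lemma hfunctions_mult:
  assumes "g \<in> hfunctions V" "g' \<in> hfunctions W" "V \<inter> W = {}"
  shows "(\<lambda>a. g a * g' a) \<in> hfunctions (V \<union> W)"
  using assms(1)
proof (induction rule: hfunctions_induct)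
  case zero
  then show ?case by (simp add: hfunctions_zero)
next
  case (add c m g)
  from hfunctions_add[OF hfunctions_scale[OF hfunctions_mult_monomial[OF assms(2,3) add(1-3)], of c] add(4)]
  show ?case by (simp add: distrib_right scale_mult_left)
qed

text \<open>Induction on the length: the generalized product rule is applied to the first factor
  times the rest. Its terms with exchanged factors do no harm, because multilinearity in a set of
  variables does not depend on their order.\<close>

lemma act_monomial_value_hfunctions:
  assumes "m \<noteq> []" "distinct (map fst m)"
  shows "(\<lambda>a. act h (monomial_value m a)) \<in> hfunctions (set (map fst m))"
  using assms
proof (induction m arbitrary: h)
  case (Cons y m)
  obtain x h' where y: "y = (x, h')" by (cases y)
  have single: "(\<lambda>a. act k (act h' (a x))) \<in> hfunctions {x}" for k
  proof -
    have "monomial_value [(x, k * h')] = (\<lambda>a. act k (act h' (a x)))"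
      by (auto simp: monomial_value_def act_mult)
    then show ?thesis using monomial_value_hfunctions[of "[(x, k * h')]"] by simp
  qed
  show ?case
  proof (cases "m = []")
    case True
    then show ?thesis using single y by (simp add: monomial_value_def)
  next
    case False
    have IH: "(\<lambda>a. act k (monomial_value m a)) \<in> hfunctions (set (map fst m))" for k
      using Cons False by simp
    have disj: "{x} \<inter> set (map fst m) = {}" using Cons(3) y by auto
    from act_product[of h] obtain k :: nat and h1 h2 h3 h4 where prod: "\<forall>a b.
        act h (a * b) = (\<Sum>i\<in>{1..k}. act (h1 i) a * act (h2 i) b + act (h3 i) b * act (h4 i) a)"
      by (elim exE)
    have "act h (monomial_value (y # m) a) = (\<Sum>i\<in>{1..k}. act (h1 i) (act h' (a x)) * act (h2 i) (monomial_value m a)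
        + act (h3 i) (monomial_value m a) * act (h4 i) (act h' (a x)))" for a
      using False y by (simp add: monomial_value_def nprod_Cons prod)
    moreover have "(\<lambda>a. \<Sum>i\<in>{1..k}. act (h1 i) (act h' (a x)) * act (h2 i) (monomial_value m a)
        + act (h3 i) (monomial_value m a) * act (h4 i) (act h' (a x))) \<in> hfunctions (insert x (set (map fst m)))"
      using hfunctions_mult[OF single IH disj] hfunctions_mult[OF IH single, unfolded Int_commute[of "set _"], OF disj]
      by (intro hfunctions_sum hfunctions_add) auto
    ultimately show ?thesis using y by simp
  qed
qed simp

lemma hfunctions_act:
  assumes "g \<in> hfunctions V"
  shows "(\<lambda>a. act h (g a)) \<in> hfunctions V"
  using assms
proof (induction rule: hfunctions_induct)
  case zero
  then show ?case by (simp add: hfunctions_zero act_zero)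
next
  case (add c m g)
  from hfunctions_add[OF hfunctions_scale[OF act_monomial_value_hfunctions[OF add(1,2)], of c h, unfolded add(3)] add(4)]
  show ?case by (simp add: act_add act_scale_right)
qed

lemma hfunctions_var: "(\<lambda>a. a x) \<in> hfunctions {x}"
proof -
  have "monomial_value [(x, 1)] = (\<lambda>a. a x)"
    by (auto simp: monomial_value_def act_one)
  then show ?thesis using monomial_value_hfunctions[of "[(x, 1)]"] by simp
qed

lemma hfunctions_rename:
  assumes "g \<in> hfunctions V" "inj_on \<rho> V"
  shows "(\<lambda>a. g (\<lambda>x. a (\<rho> x))) \<in> hfunctions (\<rho> ` V)"
  using assms(1)
proof (induction rule: hfunctions_induct)
  case zero
  then show ?case by (simp add: hfunctions_zero)
next
  case (add c m g)
  let ?m = "map (\<lambda>(x, h). (\<rho> x, h)) m"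
  have fst: "map fst ?m = map \<rho> (map fst m)" by (auto simp: case_prod_unfold)
  have "monomial_value ?m \<in> hfunctions (\<rho> ` V)"
  proof (rule monomial_value_hfunctions)
    show "distinct (map fst ?m)" unfolding fst distinct_map[of \<rho>] using add(2,3) assms(2) by simp
    show "set (map fst ?m) = \<rho> ` V" unfolding fst using add(3) by (metis list.set_map)
  qed (use add(1) in simp)
  moreover have "monomial_value ?m = (\<lambda>a. monomial_value m (\<lambda>x. a (\<rho> x)))"
    by (auto simp: monomial_value_def case_prod_unfold comp_def)
  ultimately show ?case using hfunctions_add[OF hfunctions_scale add(4)] by simp
qed

lemma hfunctions_cong:
  assumes "g \<in> hfunctions V" "\<And>x. x \<in> V \<Longrightarrow> a x = b x"
  shows "g a = g b"
  using assms(1)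
proof (induction rule: hfunctions_induct)
  case (add c m g)
  have "map (\<lambda>(x, h). act h (a x)) m = map (\<lambda>(x, h). act h (b x)) m"
    using add(3) assms(2) by (intro map_cong refl) force
  then have "monomial_value m a = monomial_value m b" unfolding monomial_value_def by (rule arg_cong)
  then show ?case using add(4) by simp
qed simp

text \<open>With \<open>U = {0}\<close> this extracts a nonzero monomial from a nonzero value; with
  an ideal for \<open>U\<close> it locates values.\<close>

lemma hfunctions_subspace:
  assumes "g \<in> hfunctions V" "subspace U"
    and "\<And>m. m \<noteq> [] \<Longrightarrow> distinct (map fst m) \<Longrightarrow> set (map fst m) = V \<Longrightarrow> monomial_value m a \<in> U"
  shows "g a \<in> U"
  using assms(1)
proof (induction rule: hfunctions_induct)
  case (add c m g)
  then show ?case using assms(2,3) by (simp add: subspace_add subspace_scale)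
qed (use assms(2) subspace_0 in auto)

lemma linear_hfunctions_upd:
  assumes "g \<in> hfunctions V" "x \<in> V"
  shows "Vector_Spaces.linear scale scale (\<lambda>u. g (a(x := u)))"
  using assms(1)
proof (induction rule: hfunctions_induct)
  case zero
  then show ?case by (auto simp: Vector_Spaces.linear_iff vector_space_axioms)
next
  case (add c m g)
  obtain h where "(x, h) \<in> set m" using add(3) assms(2) by auto
  then obtain u w where m: "m = u @ (x, h) # w" by (meson split_list)
  have x: "x \<notin> fst ` set u" "x \<notin> fst ` set w" using add(2) m by auto
  have upd: "map (\<lambda>(y, h). act h ((a(x := v)) y)) m'
      = map (\<lambda>(y, h). act h (a y)) m'" if "x \<notin> fst ` set m'" for v m'
    using that by (intro map_cong) (auto simp: image_iff)
  have val: "monomial_value m (a(x := v)) = nprod (map (\<lambda>(y, h). act h (a y)) u @ act h v # map (\<lambda>(y, h). act h (a y)) w)" for v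
    unfolding monomial_value_def m map_append list.map upd[OF x(1)] upd[OF x(2)] by simp
  show ?case
    using add(4)
    unfolding val by (auto simp: Vector_Spaces.linear_iff act_add act_scale_right nprod_add nprod_scale scale_right_distrib scale_left_commute algebra_simps)
qed

lemma eval_rename_vars: "eval_hp a (rename_vars \<tau> f) = eval_hp (a \<circ> \<tau>) f"
proof -
  have sum: "eval_hp a (sum F S) = (\<Sum>x\<in>S. eval_hp a (F x))" for F :: "('c \<times> 'h) list \<Rightarrow> ('b, 'h, 'f) hpoly" and S
    by (induction S rule: infinite_finite_induct) (auto simp: eval_hp_add, auto simp: eval_hp_def)
  show ?thesis
    unfolding rename_vars_def sum eval_hp_scale eval_hp_monomial
    by (simp add: eval_hp_def case_prod_unfold comp_def)
qed

text \<open>Interchanging two variables with equal values leaves the assignment unchanged, so the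
  value equals its own negative; as 2 is invertible, it is 0.\<close>

lemma eval_alternating_eq:
  assumes "alternating_in scaleH V f" "x \<in> V" "y \<in> V" "x \<noteq> y" "a x = a y" "(2 :: 'f) \<noteq> 0"
  shows "eval_hp a f = 0"
proof -
  have "a \<circ> transpose x y = a"
    using assms(5) by (auto simp: fun_eq_iff transpose_def)
  then have "eval_hp a f + eval_hp a f = 0"
    using assms(1-4) eval_tensor_relations(2)[of "rename_vars (transpose x y) f + f" a]
    unfolding alternating_in_def by (metis eval_hp_add eval_rename_vars)
  then have "scale 2 (eval_hp a f) = 0"
    by (metis one_add_one scale_left_distrib scale_one)
  then show ?thesis using assms(6) by simp
qed

end

section \<open>Nilpotent ideals and products with slots\<close>

lemma nprod_group:
  fixes J :: "'a::ring set"
  assumes J: "\<And>x r. x \<in> J \<Longrightarrow> r * x \<in> J \<and> x * r \<in> J"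
    and "1 \<le> k" "k \<le> length (filter (\<lambda>x. x \<in> J) as)"
  shows "\<exists>bs. length bs = k \<and> set bs \<subseteq> J \<and> nprod as = nprod bs"
  using assms(2,3)
proof (induction as arbitrary: k)
  case (Cons x as)
  have cons: "nprod (y # zs) = y * nprod zs" if "zs \<noteq> []" for y :: 'a and zs
    using that by (cases zs) auto
  show ?case
  proof (cases "as = []")
    case True
    with Cons(2,3) have "k = 1" "x \<in> J" by (auto split: if_splits)
    then show ?thesis using True by (intro exI[of _ "[x]"]) auto
  next
    case False
    show ?thesis
    proof (cases "k \<le> length (filter (\<lambda>x. x \<in> J) as)")
      case True
      then obtain bs where bs: "length bs = k" "set bs \<subseteq> J" "nprod as = nprod bs"
        using Cons by blast
      then obtain b bs' where b: "bs = b # bs'" using Cons(2) by (cases bs) auto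
      have "nprod (x * b # bs') = x * nprod bs"
        unfolding b by (cases bs') (auto simp: mult.assoc)
      then show ?thesis using bs b cons[OF False] J by (intro exI[of _ "x * b # bs'"]) auto
    next
      case F: False
      with Cons(3) have x: "x \<in> J" "k - 1 = length (filter (\<lambda>x. x \<in> J) as)" by (auto split: if_splits)
      show ?thesis
      proof (cases "k = 1")
        case True
        then show ?thesis using x(1) J cons[OF False] by (intro exI[of _ "[x * nprod as]"]) auto
      next
        case k: False
        then have "1 \<le> k - 1" "k - 1 \<le> length (filter (\<lambda>x. x \<in> J) as)" using x(2) Cons(2) by auto
        from Cons(1)[OF this] obtain bs where bs: "length bs = k - 1" "set bs \<subseteq> J" "nprod as = nprod bs"
          by blast
        then have "bs \<noteq> []" using k Cons(2) by auto
        then show ?thesis using bs x cons False k Cons(2) by (intro exI[of _ "x # bs"]) auto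
      qed
    qed
  qed
qed simp

lemma nprod_right_absorb:
  fixes e :: "'a::ring"
  assumes "as \<noteq> []" "last as * e = last as"
  shows "nprod as * e = nprod as"
  using assms by (induction as rule: nprod.induct) (auto simp: mult.assoc)

context assoc_algebra
begin

text \<open>Nilpotency in the form in which it is applied: the factors from \<open>J\<close> may be
  scattered over a product of arbitrary elements.\<close>

definition nilpotency_bound :: "'a set \<Rightarrow> nat \<Rightarrow> bool" where
  "nilpotency_bound J s \<longleftrightarrow> s \<ge> 1 \<and> (\<forall>as. s \<le> length (filter (\<lambda>x. x \<in> J) as) \<longrightarrow> nprod as = 0)"

lemma nilpotency_bound_exists:
  assumes "ideal UNIV J" "nilpotent_set J"
  shows "\<exists>s. nilpotency_bound J s"
proof -
  obtain n where n: "n \<ge> 1" "\<And>as. length as = n \<Longrightarrow> set as \<subseteq> J \<Longrightarrow> nprod as = 0"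
    using assms(2) by (auto simp: nilpotent_set_def)
  have "nilpotency_bound J n"
    unfolding nilpotency_bound_def
  proof (intro conjI allI impI)
    fix as assume "n \<le> length (filter (\<lambda>x. x \<in> J) as)"
    then obtain bs where "length bs = n" "set bs \<subseteq> J" "nprod as = nprod bs"
      using nprod_group[of J n as] n(1) ideal_mult_left[OF assms(1)] ideal_mult_right[OF assms(1)] by blast
    then show "nprod as = 0" using n(2) by simp
  qed (rule n(1))
  then show ?thesis ..
qed

lemma ideal_zero: "ideal UNIV {0}"
  by (auto simp: ideal_def)

lemma ideal_plus:
  assumes "ideal UNIV I" "ideal UNIV K"
  shows "ideal UNIV {x + y |x y. x \<in> I \<and> y \<in> K}"
proof -
  have "subspace {x + y |x y. x \<in> I \<and> y \<in> K}"
    using assms subspace_sums by (auto simp: ideal_def)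
  moreover have "r * (x + y) \<in> {x + y |x y. x \<in> I \<and> y \<in> K} \<and> (x + y) * r \<in> {x + y |x y. x \<in> I \<and> y \<in> K}"
    if "x \<in> I" "y \<in> K" for r x y
    using assms that unfolding distrib_left distrib_right ideal_def by blast
  ultimately show ?thesis unfolding ideal_def by blast
qed

text \<open>A product of \<open>s + t\<close> sums expands into products that have at least
  \<open>s\<close> factors from \<open>I\<close> or at least \<open>t\<close> factors from
  \<open>K\<close>.\<close>

lemma nilpotent_set_plus:
  assumes I: "ideal UNIV I" "nilpotent_set I" and K: "ideal UNIV K" "nilpotent_set K"
  shows "nilpotent_set {x + y |x y. x \<in> I \<and> y \<in> K}"
proof -
  obtain s t where s: "nilpotency_bound I s" and t: "nilpotency_bound K t"
    using nilpotency_bound_exists[OF I] nilpotency_bound_exists[OF K] by blast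
  let ?S = "\<lambda>n. {nprod bs |bs. length bs = n \<and> set bs \<subseteq> I \<union> K}"
  have exp: "nprod as \<in> span (?S (length as))"
    if "as \<noteq> []" "set as \<subseteq> {x + y |x y. x \<in> I \<and> y \<in> K}" for as
    using that
  proof (induction as rule: list_nonempty_induct)
    case (single a)
    then obtain x y where a: "a = x + y" "x \<in> I" "y \<in> K" by auto
    have "x \<in> ?S 1" "y \<in> ?S 1" using a by (auto intro!: exI[of _ "[_]"])
    then show ?case using a by (auto intro: span_add span_base)
  next
    case (cons a as)
    then obtain x y where a: "a = x + y" "x \<in> I" "y \<in> K" by auto
    have mult: "z * w \<in> span (?S (Suc (length as)))"
      if z: "z \<in> I \<union> K" and w: "w \<in> span (?S (length as))" for z w
      using w
    proof (induction rule: span_induct_alt)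
      case base
      then show ?case by (simp add: span_zero)
    next
      case (step c u v)
      then obtain bs where bs: "u = nprod bs" "length bs = length as" "set bs \<subseteq> I \<union> K" by blast
      have "z * u = nprod (z # bs)" using bs cons(1) by (cases bs) auto
      then have "z * u \<in> ?S (Suc (length as))" using bs z by (auto intro!: exI[of _ "z # bs"])
      then show ?case using step(2)
        by (simp add: distrib_left scale_mult_right span_add span_scale span_base)
    qed
    have "nprod (a # as) = x * nprod as + y * nprod as"
      using cons(1) a by (cases as) (auto simp: distrib_right)
    then show ?case using mult[of x] mult[of y] cons a by (simp add: span_add)
  qed
  have "nprod bs = 0" if "length bs = s + t" "set bs \<subseteq> I \<union> K" for bs
  proof -
    have "length bs \<le> length (filter (\<lambda>x. x \<in> I) bs) + length (filter (\<lambda>x. x \<in> K) bs)"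
      using that(2) by (induction bs) auto
    then have "s \<le> length (filter (\<lambda>x. x \<in> I) bs) \<or> t \<le> length (filter (\<lambda>x. x \<in> K) bs)"
      using that(1) by linarith
    then show ?thesis using s t by (auto simp: nilpotency_bound_def)
  qed
  then have "span (?S (s + t)) \<subseteq> {0}" by (intro span_minimal) auto
  moreover have "s + t \<ge> 1" using s by (simp add: nilpotency_bound_def)
  ultimately show ?thesis
    unfolding nilpotent_set_def
  proof (intro exI[of _ "s + t"] conjI allI impI)
    fix as assume as: "length as = s + t \<and> set as \<subseteq> {x + y |x y. x \<in> I \<and> y \<in> K}"
    then have "as \<noteq> []" using \<open>s + t \<ge> 1\<close> by auto
    then have "nprod as \<in> span (?S (s + t))" using exp[of as] as by simp
    then show "nprod as = 0" using \<open>span (?S (s + t)) \<subseteq> {0}\<close> by blast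
  qed
qed

text \<open>The power 0 is the whole algebra, so that every multiplier has some degree. New factors
  enter on the right, where a slot is adjacent to its multiplier.\<close>

fun ideal_power :: "'a set \<Rightarrow> nat \<Rightarrow> 'a set" where
  "ideal_power J 0 = UNIV"
| "ideal_power J (Suc n) = span {x * y |x y. x \<in> ideal_power J n \<and> y \<in> J}"

lemma subspace_ideal_power: "subspace (ideal_power J n)"
  by (cases n) auto

lemma ideal_power_Suc: "x \<in> ideal_power J n \<Longrightarrow> y \<in> J \<Longrightarrow> x * y \<in> ideal_power J (Suc n)"
  by (auto intro: span_base)

lemma ideal_power_mult_right:
  assumes "ideal UNIV J" "x \<in> ideal_power J n"
  shows "x * r \<in> ideal_power J n"
proof (cases n)
  case (Suc m)
  have "x \<in> span {x * y |x y. x \<in> ideal_power J m \<and> y \<in> J}" using assms(2) Suc by simp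
  then have "x * r \<in> span {x * y |x y. x \<in> ideal_power J m \<and> y \<in> J}"
  proof (induction rule: span_induct_alt)
    case (step c u v)
    then obtain x y where "u = x * y" "x \<in> ideal_power J m" "y \<in> J" by blast
    then have "u * r = x * (y * r)" "y * r \<in> J"
      using assms(1) by (auto simp: mult.assoc intro: ideal_mult_right)
    then have "u * r \<in> span {x * y |x y. x \<in> ideal_power J m \<and> y \<in> J}"
      using \<open>x \<in> ideal_power J m\<close> by (auto intro: span_base)
    with step(2) show ?case by (simp add: distrib_right scale_mult_left span_add span_scale)
  qed (simp add: span_zero)
  then show ?thesis using Suc by simp
qed simp

lemma ideal_power_eq_0:
  assumes "nilpotency_bound J s" "s \<le> n" "x \<in> ideal_power J n"
  shows "x = 0"
proof -
  let ?S = "\<lambda>n. {nprod as |as. as \<noteq> [] \<and> n \<le> length (filter (\<lambda>x. x \<in> J) as)}"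
  have sub: "ideal_power J n \<subseteq> span (?S n)" for n
  proof (induction n)
    case 0
    have "x \<in> ?S 0" for x by (auto intro!: exI[of _ "[x]"])
    then show ?case using span_superset by blast
  next
    case (Suc n)
    have "x * y \<in> span (?S (Suc n))" if "x \<in> ideal_power J n" and y: "y \<in> J" for x y
    proof -
      have "x \<in> span (?S n)" using Suc that by blast
      then show ?thesis
      proof (induction rule: span_induct_alt)
        case (step c u v)
        then obtain as where as: "u = nprod as" "as \<noteq> []" "n \<le> length (filter (\<lambda>x. x \<in> J) as)" by blast
        have "nprod (as @ [y]) = nprod as * y"
          using as(2) by (induction as rule: nprod.induct) (auto simp: mult.assoc)
        then have "u * y \<in> ?S (Suc n)" using as y by (auto intro!: exI[of _ "as @ [y]"])
        with step(2) show ?case by (simp add: distrib_right scale_mult_left span_add span_scale span_base)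
      qed (simp add: span_zero)
    qed
    then have "{x * y |x y. x \<in> ideal_power J n \<and> y \<in> J} \<subseteq> span (?S (Suc n))" by blast
    then show ?case unfolding ideal_power.simps by (rule span_minimal) simp
  qed
  have "span (?S n) \<subseteq> {0}"
    using assms(1,2) by (intro span_minimal) (auto simp: nilpotency_bound_def)
  then show ?thesis using sub[of n] assms(3) by blast
qed

definition slot_prod :: "nat \<Rightarrow> (nat \<Rightarrow> 'a) \<Rightarrow> (nat \<Rightarrow> 'a) \<Rightarrow> 'a" where
  "slot_prod r c y = nprod (map (\<lambda>i. c i * y i) [0..<r])"

lemma slot_prod_zero:
  assumes "i < r" "c i * y i = 0"
  shows "slot_prod r c y = 0"
  using nprod_in_ideal[OF ideal_zero, of "c i * y i" "map (\<lambda>i. c i * y i) [0..<r]"] assms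
  by (auto simp: slot_prod_def)

text \<open>Choose \<open>c\<close> of maximal total degree with respect to the powers of \<open>J\<close>: a factor \<open>y i \<in> J\<close> could
  be absorbed by \<open>c i\<close>.\<close>

lemma maximal_multipliers:
  assumes J: "ideal UNIV J" "nilpotent_set J" and c0: "slot_prod r c0 e \<noteq> 0"
  shows "\<exists>c. slot_prod r c e \<noteq> 0 \<and>
    (\<forall>y. (\<forall>i<r. y i * e i = y i) \<and> (\<exists>i<r. y i \<in> J) \<longrightarrow> slot_prod r c y = 0)"
proof (rule ccontr)
  assume neg: "\<not> ?thesis"
  obtain s where s: "nilpotency_bound J s" using nilpotency_bound_exists J by blast
  have "\<exists>c n. (\<forall>i<r. c i \<in> ideal_power J (n i)) \<and> N \<le> (\<Sum>i<r. n i) \<and> slot_prod r c e \<noteq> 0" for N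
  proof (induction N)
    case 0
    then show ?case using c0 by (intro exI[of _ c0] exI[of _ "\<lambda>_. 0"]) auto
  next
    case (Suc N)
    then obtain c n where c: "\<forall>i<r. c i \<in> ideal_power J (n i)" "N \<le> (\<Sum>i<r. n i)" "slot_prod r c e \<noteq> 0"
      by blast
    then obtain y k where y: "\<forall>i<r. y i * e i = y i" "k < r" "y k \<in> J" "slot_prod r c y \<noteq> 0"
      using neg by blast
    \<comment> \<open>The condition \<open>y i * e i = y i\<close> allows a counterexample
      \<open>y\<close> to be moved into the multipliers with \<open>e\<close> restored in the slots.
      The multiplier at \<open>k\<close> thereby gains a factor from \<open>J\<close>, and the
      others keep their degrees.\<close>
    let ?c = "\<lambda>i. c i * y i" and ?n = "n(k := Suc (n k))"
    have "?c i \<in> ideal_power J (?n i)" if "i < r" for i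
    proof (cases "i = k")
      case True
      then have "?c i \<in> ideal_power J (Suc (n k))" using c(1) y(2,3) by (intro ideal_power_Suc) auto
      then show ?thesis using True by simp
    next
      case False
      then show ?thesis using c(1) that ideal_power_mult_right[OF J(1)] by simp
    qed
    moreover have "slot_prod r ?c e = slot_prod r c y"
      unfolding slot_prod_def using y(1) by (intro arg_cong[of _ _ nprod] map_cong) (auto simp: mult.assoc)
    moreover have "(\<Sum>i<r. ?n i) = Suc (\<Sum>i<r. n i)"
      using y(2) by (simp add: sum.remove[of "{..<r}" k])
    ultimately show ?case using c(2) y(4) by (intro exI[of _ ?c] exI[of _ ?n]) auto
  qed
  \<comment> \<open>Total degree \<open>r * s\<close> over \<open>r\<close> positions forces degree
    at least \<open>s\<close> somewhere, and the power \<open>s\<close> of \<open>J\<close> is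
    zero.\<close>
  then obtain c n where c: "\<forall>i<r. c i \<in> ideal_power J (n i)" "r * s \<le> (\<Sum>i<r. n i)" "slot_prod r c e \<noteq> 0"
    by blast
  have "r > 0" using c(3) by (cases r) (auto simp: slot_prod_def)
  have "\<exists>i<r. s \<le> n i"
  proof (rule ccontr)
    assume "\<not> ?thesis"
    then have "(\<Sum>i<r. n i) < (\<Sum>i<r. s)" using \<open>r > 0\<close> by (intro sum_strict_mono) auto
    then show False using c(2) by simp
  qed
  then obtain i where "i < r" "s \<le> n i" by blast
  then have "c i = 0" using ideal_power_eq_0[OF s] c(1) by blast
  then show False using slot_prod_zero[of i r c e] \<open>i < r\<close> c(3) by simp
qed

definition right_linear :: "('a \<Rightarrow> 'a) \<Rightarrow> bool" where
  "right_linear L \<longleftrightarrow> Vector_Spaces.linear scale scale L \<and> (\<forall>x y. L (x * y) = L x * y)"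

lemma right_linear_id: "right_linear (\<lambda>x. x)"
  by (auto simp: right_linear_def Vector_Spaces.linear_iff vector_space_axioms)

lemma right_linear_mult: "right_linear ((*) x)"
  by (auto simp: right_linear_def Vector_Spaces.linear_iff vector_space_axioms distrib_left scale_mult_right mult.assoc)

lemma right_linear_span:
  assumes "right_linear L" "\<And>x. x \<in> S \<Longrightarrow> L x = 0" "x \<in> span S"
  shows "L x = 0"
proof -
  interpret Vector_Spaces.linear scale scale L using assms(1) by (simp add: right_linear_def)
  show ?thesis using eq_0_on_span assms by blast
qed

text \<open>The next two inductions remove the first factor, which is then absorbed by the right linear
  map \<open>L\<close>.\<close>

lemma nprod_zero_if_plus_chain_zero:
  assumes "right_linear L" "length ls = length us"
    and "\<And>j. j < length us \<Longrightarrow> ls ! j \<noteq> 0 \<Longrightarrow> us ! j \<in> V (ls ! j)"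
    and "filter (\<lambda>i. i \<noteq> 0) ls \<noteq> []"
    and "\<And>c a. c \<in> plus_chain (map V (remdups (filter (\<lambda>i. i \<noteq> (0::nat)) ls))) \<Longrightarrow> L c = 0 \<and> L (a * c) = 0"
  shows "L (nprod us) = 0"
  using assms
proof (induction us arbitrary: L ls)
  case (Cons u us)
  obtain l ls' where ls: "ls = l # ls'" "length ls' = length us" using Cons(3) by (cases ls) auto
  interpret L: Vector_Spaces.linear scale scale L using Cons(2) by (simp add: right_linear_def)
  have Lm: "L (x * y) = L x * y" for x y using Cons(2) by (simp add: right_linear_def)
  let ?f = "filter (\<lambda>i. i \<noteq> 0)"
  have us': "\<And>j. j < length us \<Longrightarrow> ls' ! j \<noteq> 0 \<Longrightarrow> us ! j \<in> V (ls' ! j)"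
    using Cons(4) ls by fastforce
  have uV: "u \<in> V l" if "l \<noteq> 0" using Cons(4)[of 0] ls that by simp
  show ?case
  proof (cases "?f ls' = []")
    case True
    then have l: "l \<noteq> 0" using Cons(5) ls(1) by (cases "l = 0") simp_all
    have "?f ls = [l]" using True l ls by simp
    then have "L u = 0" using Cons(6)[of u] uV[OF l] by simp
    then show ?thesis using Lm by (cases us) auto
  next
    case False
    then have us: "us \<noteq> []" using ls by auto
    have n: "nprod (u # us) = u * nprod us" using us by (cases us) auto
    have rl: "right_linear ((*) (L u))" by (rule right_linear_mult)
    have "L u * nprod us = 0"
    proof (rule Cons(1)[OF rl ls(2) us' False])
      fix c a assume c: "c \<in> plus_chain (map V (remdups (?f ls')))"
      show "L u * c = 0 \<and> L u * (a * c) = 0"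
      \<comment> \<open>\<open>remdups\<close> keeps the last occurrence of a label. A factor with
        label 0 or with a label that recurs later is therefore treated as an arbitrary element and
        merges into the neighbouring \<open>A^+\<close>.\<close>
      proof (cases "l = 0 \<or> l \<in> set ls'")
        case True
        then have "remdups (?f ls) = remdups (?f ls')" using ls by auto
        then show ?thesis
          using Cons(6)[of c u] Cons(6)[of c "u * a"] c Lm by (simp add: mult.assoc)
      next
        case l: False
        obtain W Ws where W: "map V (remdups (?f ls')) = W # Ws"
          using False by (cases "map V (remdups (?f ls'))") auto
        have "remdups (?f ls) = l # remdups (?f ls')" using l ls by auto
        then have chain: "plus_chain (map V (remdups (?f ls))) = prod_space (prod_plus (V l)) (plus_chain (W # Ws))"
          using W by simp
        have "u * a' + scale k u \<in> prod_plus (V l)" for a' k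
          unfolding prod_plus_def using uV l by (intro span_base) auto
        then have "(u * a' + scale k u) * c \<in> plus_chain (map V (remdups (?f ls)))" for a' k
          unfolding chain prod_space_def using c W by (intro span_base) auto
        from Cons(6)[OF this] have z: "L ((u * a' + scale k u) * c) = 0" for a' k by blast
        \<comment> \<open>The two instances are the unit part and the algebra part of an element of
          \<open>A^+\<close>.\<close>
        show ?thesis using z[of 0 1] z[of a 0] Lm by (simp add: mult.assoc)
      qed
    qed
    then show ?thesis using n Lm by simp
  qed
qed simp

lemma plus_chain_zero_if_nprod_zero:
  assumes "right_linear L" "jt \<noteq> []"
    and "\<And>i. i \<in> set jt \<Longrightarrow> V i \<subseteq> span {x * e i * y |x y. True}"
    and "\<And>cs. length cs = length jt \<Longrightarrow> L (nprod (map2 (*) cs (map e jt))) = 0"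
    and "c \<in> plus_chain (map V jt)"
  shows "L c = 0"
  using assms
proof (induction "jt" arbitrary: L c)
  case (Cons i jt)
  interpret L: Vector_Spaces.linear scale scale L using Cons(2) by (simp add: right_linear_def)
  have Lm: "L (x * y) = L x * y" for x y using Cons(2) by (simp add: right_linear_def)
  have Vi: "V i \<subseteq> span {x * e i * y |x y. True}" using Cons(4) by simp
  show ?case
  proof (cases "jt = []")
    case True
    have gen: "L (x * e i * y) = 0" for x y
      using Cons(5)[of "[x]"] True Lm by simp
    show ?thesis
    proof (rule right_linear_span[OF Cons(2)])
      show "c \<in> span {x * e i * y |x y. True}" using Cons(6) True Vi by auto
    qed (use gen in auto)
  next
    case False
    then obtain j js0 where js0: "jt = j # js0" by (cases "jt") auto
    have key: "L (x * e i * z * c') = 0" if c': "c' \<in> plus_chain (map V jt)" for x z c'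
    proof -
      have "(L (x * e i * z)) * c' = 0"
      proof (rule Cons(1)[OF right_linear_mult False])
        fix cs :: "'a list" assume cs: "length cs = length jt"
        then obtain d ds where d: "cs = d # ds" using js0 by (cases cs) auto
        have "nprod (map2 (*) (x # (z * d) # ds) (map e (i # jt)))
            = x * e i * nprod ((z * d * e j) # map2 (*) ds (map e js0))"
          using js0 by simp
        also have "nprod ((z * d * e j) # map2 (*) ds (map e js0)) = z * nprod (map2 (*) cs (map e jt))"
          using js0 d by (cases "map2 (*) ds (map e js0)") (auto simp: mult.assoc)
        finally have "L (x * e i * (z * nprod (map2 (*) cs (map e jt)))) = 0"
          using Cons(5)[of "x # (z * d) # ds"] cs d by simp
        then show "L (x * e i * z) * nprod (map2 (*) cs (map e jt)) = 0"
          using Lm by (simp add: mult.assoc)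
      qed (use Cons(4) c' in auto)
      then show ?thesis using Lm by (simp add: mult.assoc)
    qed
    have lin: "Vector_Spaces.linear scale scale (\<lambda>v. L (v * w))" for w
      by (auto simp: Vector_Spaces.linear_iff vector_space_axioms distrib_right scale_mult_left L.add L.scale)
    have zero_on_span: "L (v * w) = 0" if "v \<in> span S" "\<And>u. u \<in> S \<Longrightarrow> L (u * w) = 0" for v w S
    proof -
      interpret M: Vector_Spaces.linear scale scale "\<lambda>v. L (v * w)" by (rule lin)
      show ?thesis using M.eq_0_on_span that by blast
    qed
    have c: "c \<in> span {v * w |v w. v \<in> prod_plus (V i) \<and> w \<in> plus_chain (map V jt)}"
      using Cons(6) unfolding js0 by (simp add: prod_space_def)
    have "L (v * c') = 0" if v: "v \<in> prod_plus (V i)" and c': "c' \<in> plus_chain (map V jt)" for v c'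
    proof (rule zero_on_span[OF v[unfolded prod_plus_def]])
      fix u assume "u \<in> {v * a + scale k v |v a k. v \<in> V i}"
      then obtain v' a k where u: "u = v' * a + scale k v'" "v' \<in> span {x * e i * y |x y. True}"
        using Vi by blast
      have "L (v' * (a * c')) = 0"
        by (rule zero_on_span[OF u(2)]) (use key[OF c', of x "y * a" for x y] in \<open>auto simp: mult.assoc\<close>)
      moreover have "L (v' * c') = 0"
        by (rule zero_on_span[OF u(2)]) (use key[OF c'] in auto)
      ultimately show "L (u * c') = 0"
        using u(1) by (simp add: distrib_right scale_mult_left L.add L.scale mult.assoc)
    qed
    then show ?thesis
      by (intro right_linear_span[OF Cons(2) _ c]) auto
  qed
qed simp

end

context gen_H_action
begin

lemma slot_prod_upd_add:
  assumes "k < r"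
  shows "slot_prod r c (y(k := u + v)) = slot_prod r c (y(k := u)) + slot_prod r c (y(k := v))"
proof -
  have split: "[0..<r] = [0..<k] @ k # [Suc k..<r]"
    using upt_add_eq_append[of 0 k "r - k"] upt_conv_Cons[OF assms] assms by simp
  have "slot_prod r c (y(k := w)) = nprod (map (\<lambda>i. c i * y i) [0..<k] @ c k * w # map (\<lambda>i. c i * y i) [Suc k..<r])" for w
  proof -
    have "map (\<lambda>i. c i * (y(k := w)) i) [0..<k] = map (\<lambda>i. c i * y i) [0..<k]"
      "map (\<lambda>i. c i * (y(k := w)) i) [Suc k..<r] = map (\<lambda>i. c i * y i) [Suc k..<r]"
      using assms by (auto intro!: map_cong)
    then show ?thesis unfolding slot_prod_def split map_append list.map by (simp only: fun_upd_same)
  qed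
  then show ?thesis by (simp add: distrib_left nprod_add)
qed

lemma slot_prod_upd_sum:
  assumes "k < r"
  shows "slot_prod r c (y(k := sum f T)) = (\<Sum>t\<in>T. slot_prod r c (y(k := f t)))"
  using slot_prod_upd_add[OF assms, of c y] slot_prod_zero[OF assms, of c "y(k := 0)"]
  by (induction T rule: infinite_finite_induct) auto

text \<open>Slots are exchanged one at a time, from left to right. The difference between
  \<open>e k\<close> and the sum of the \<open>Y k t\<close> lies in \<open>J\<close>, so its
  contribution is killed, and some summand of the rest is nonzero. The mixed tuples that arise
  remain admissible for \<open>kill\<close>, since the \<open>e i\<close> as well as the
  \<open>Y i t\<close> are fixed by right multiplication with \<open>e i\<close>.\<close>

lemma slot_prod_replace:
  assumes c: "slot_prod r c e \<noteq> 0"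
    and kill: "\<And>y. (\<forall>i<r. y i * e i = y i) \<Longrightarrow> (\<exists>i<r. y i \<in> J) \<Longrightarrow> slot_prod r c y = 0"
    and e: "\<And>i. i < r \<Longrightarrow> e i * e i = e i"
    and Y: "\<And>i t. i < r \<Longrightarrow> t \<in> T i \<Longrightarrow> Y i t * e i = Y i t"
    and sum: "\<And>i. i < r \<Longrightarrow> e i - (\<Sum>t\<in>T i. Y i t) \<in> J"
  shows "\<exists>t. (\<forall>i<r. t i \<in> T i) \<and> slot_prod r c (\<lambda>i. Y i (t i)) \<noteq> 0"
proof -
  have "\<exists>t. (\<forall>i<k. t i \<in> T i) \<and> slot_prod r c (\<lambda>i. if i < k then Y i (t i) else e i) \<noteq> 0" if "k \<le> r" for k
    using that
  proof (induction k)
    case 0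
    then show ?case using c by simp
  next
    case (Suc k)
    then obtain t where t: "\<forall>i<k. t i \<in> T i" "slot_prod r c (\<lambda>i. if i < k then Y i (t i) else e i) \<noteq> 0"
      by auto
    have k: "k < r" using Suc by simp
    let ?y = "\<lambda>i. if i < k then Y i (t i) else e i"
    let ?S = "\<Sum>t\<in>T k. Y k t"
    have S: "?S * e k = ?S" using Y[OF k] by (simp add: sum_distrib_right)
    have "?y = ?y(k := ?S + (e k - ?S))" by auto
    then have "slot_prod r c ?y = slot_prod r c (?y(k := ?S)) + slot_prod r c (?y(k := e k - ?S))"
      using slot_prod_upd_add[OF k, of c ?y ?S "e k - ?S"] by metis
    also have "slot_prod r c (?y(k := e k - ?S)) = 0"
      using S Y t(1) k e sum[OF k] by (intro kill) (auto simp: left_diff_distrib)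
    finally have "(\<Sum>s\<in>T k. slot_prod r c (?y(k := Y k s))) \<noteq> 0"
      using t(2) slot_prod_upd_sum[OF k, of c ?y "Y k" "T k"] by (metis add.right_neutral)
    then obtain s where s: "s \<in> T k" "slot_prod r c (?y(k := Y k s)) \<noteq> 0"
      by (meson sum.neutral)
    have "?y(k := Y k s) = (\<lambda>i. if i < Suc k then Y i ((t(k := s)) i) else e i)"
      by (auto simp: fun_eq_iff)
    then show ?case using s t(1) by (intro exI[of _ "t(k := s)"]) (auto simp: less_Suc_eq)
  qed
  from this[of r] obtain t where t: "\<forall>i<r. t i \<in> T i" "slot_prod r c (\<lambda>i. if i < r then Y i (t i) else e i) \<noteq> 0"
    by auto
  have "slot_prod r c (\<lambda>i. if i < r then Y i (t i) else e i) = slot_prod r c (\<lambda>i. Y i (t i))"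
    unfolding slot_prod_def by (intro arg_cong[of _ _ nprod] map_cong) auto
  then show ?thesis using t by auto
qed

lemma H_ideal_plus:
  assumes "H_ideal UNIV I" "H_ideal UNIV K"
  shows "H_ideal UNIV {x + y |x y. x \<in> I \<and> y \<in> K}"
proof -
  have "act h (x + y) \<in> {x + y |x y. x \<in> I \<and> y \<in> K}" if "x \<in> I" "y \<in> K" for h x y
    unfolding act_add using that assms unfolding H_ideal_def H_invariant_def by blast
  then show ?thesis
    using assms ideal_plus[of I K] unfolding H_ideal_def H_invariant_def by blast
qed

text \<open>A nilpotent H-invariant ideal of maximal dimension contains every other one, because it
  cannot grow by adding it. Hence the \<open>GREATEST\<close> in the definition of \<open>JH\<close>
  is attained.\<close>

lemma JH_nilpotent_H_ideal:
  assumes "finite_dimensional_vector_space scale Basis"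
  shows "H_ideal UNIV JH \<and> nilpotent_set JH"
proof -
  interpret fd: finite_dimensional_vector_space scale Basis by (rule assms)
  let ?P = "\<lambda>I. H_ideal UNIV I \<and> nilpotent_set I"
  have "H_ideal UNIV {0}"
    using ideal_zero by (auto simp: H_ideal_def H_invariant_def act_zero)
  moreover have "nilpotent_set {0 :: 'a}"
    unfolding nilpotent_set_def
  proof (intro exI[of _ 1] conjI allI impI)
    fix as :: "'a list" assume "length as = 1 \<and> set as \<subseteq> {0}"
    then show "nprod as = 0" by (cases as) auto
  qed simp
  ultimately have "?P {0}" by blast
  moreover have "\<forall>I. ?P I \<longrightarrow> dim I < Suc (card Basis)"
    using fd.dim_subset_UNIV fd.dimension_def by (simp add: le_imp_less_Suc)
  ultimately obtain I where I: "?P I" "\<And>K. ?P K \<Longrightarrow> dim K \<le> dim I"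
    using Lattices_Big.ex_has_greatest_nat[of ?P "{0}" dim "Suc (card Basis)"] less_imp_le by blast
  have "K \<subseteq> I" if K: "?P K" for K
  proof -
    let ?S = "{x + y |x y. x \<in> I \<and> y \<in> K}"
    have "?P ?S" using H_ideal_plus nilpotent_set_plus I K by (auto simp: H_ideal_def)
    then have "dim ?S \<le> dim I" "subspace ?S" using I(2) by (auto simp: H_ideal_def ideal_def)
    moreover have "subspace I" "subspace K" using I(1) K by (auto simp: H_ideal_def ideal_def)
    moreover have "I \<subseteq> ?S" "K \<subseteq> ?S"
      using subspace_0[OF \<open>subspace I\<close>] subspace_0[OF \<open>subspace K\<close>] by force+
    ultimately show ?thesis using fd.subspace_dim_equal[of I ?S] by blast
  qed
  then have "JH = I" unfolding JH_def using I by (intro Greatest_equality) auto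
  then show ?thesis using I by simp
qed

end

section \<open>Idempotents and the Jacobson radical\<close>

context assoc_algebra
begin

lemma jacobson_left_ideal: "left_ideal UNIV (jacobson_radical UNIV)"
  unfolding left_ideal_def
proof (intro conjI ballI)
  have *: "\<And>L. modular_maximal_left_ideal UNIV L \<Longrightarrow> subspace L \<and> (\<forall>r x. x \<in> L \<longrightarrow> r * x \<in> L)"
    by (auto simp: modular_maximal_left_ideal_def left_ideal_def)
  show "subspace (jacobson_radical UNIV)"
    using * by (auto simp: jacobson_radical_def subspace_def)
  show "r * x \<in> jacobson_radical UNIV" if "x \<in> jacobson_radical UNIV" for r x
    using * that by (auto simp: jacobson_radical_def)
qed simp

text \<open>A left ideal that contains all \<open>r - r g\<close> but not \<open>g\<close>, and is maximal with these properties, is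
  a modular maximal left ideal.\<close>

lemma idempotent_in_jacobson_radical:
  assumes fd: "finite_dimensional_vector_space scale Basis"
    and g: "g * g = g" "g \<in> jacobson_radical UNIV"
  shows "g = 0"
proof (rule ccontr)
  assume "g \<noteq> 0"
  interpret fd: finite_dimensional_vector_space scale Basis by (rule fd)
  let ?L = "{r - r * g |r. True}"
  let ?P = "\<lambda>L. left_ideal UNIV L \<and> ?L \<subseteq> L \<and> g \<notin> L"
  have "subspace ?L"
    unfolding subspace_def
  proof (intro conjI ballI allI)
    show "0 \<in> ?L" by (auto intro: exI[of _ 0])
    show "x + y \<in> ?L" if "x \<in> ?L" "y \<in> ?L" for x y
    proof -
      from that obtain r t where "x = r - r * g" "y = t - t * g" by blast
      then have "x + y = (r + t) - (r + t) * g" by (simp add: distrib_right)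
      then show ?thesis by blast
    qed
    show "scale c x \<in> ?L" if "x \<in> ?L" for c x
    proof -
      from that obtain r where "x = r - r * g" by blast
      then have "scale c x = scale c r - scale c r * g" by (simp add: scale_mult_left scale_right_diff_distrib)
      then show ?thesis by blast
    qed
  qed
  moreover have "r * x \<in> ?L" if "x \<in> ?L" for r x
  proof -
    from that obtain t where "x = t - t * g" by blast
    then have "r * x = r * t - r * t * g" by (simp add: right_diff_distrib mult.assoc)
    then show ?thesis by blast
  qed
  moreover have "g \<notin> ?L"
  proof
    assume "g \<in> ?L"
    then obtain r where "g = r - r * g" by blast
    then have "g * g = (r - r * g) * g" by (rule arg_cong)
    then show False using g(1) \<open>g \<noteq> 0\<close> by (simp add: left_diff_distrib mult.assoc)
  qed
  ultimately have "?P ?L" by (auto simp: left_ideal_def)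
  moreover have "\<forall>L. ?P L \<longrightarrow> dim L < Suc (card Basis)"
    using fd.dim_subset_UNIV fd.dimension_def by (simp add: le_imp_less_Suc)
  ultimately obtain L where L: "?P L" "\<And>M. ?P M \<Longrightarrow> dim M \<le> dim L"
    using Lattices_Big.ex_has_greatest_nat[of ?P ?L dim "Suc (card Basis)"] by blast
  have LI: "left_ideal UNIV L" and LL: "r - r * g \<in> L" for r using L(1) by auto
  have "modular_maximal_left_ideal UNIV L"
    unfolding modular_maximal_left_ideal_def
  proof (intro conjI allI impI)
    show "L \<noteq> UNIV" using L(1) by blast
    show "\<exists>e\<in>UNIV. \<forall>r\<in>UNIV. r - r * e \<in> L" using LL by (intro bexI[of _ g]) auto
    fix M assume M: "left_ideal UNIV M \<and> L \<subseteq> M"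
    show "M = L \<or> M = UNIV"
    proof (cases "g \<in> M")
      case True
      have "r \<in> M" for r
      proof -
        have "r - r * g \<in> M" "r * g \<in> M" using LL M True by (auto simp: left_ideal_def)
        then have "(r - r * g) + r * g \<in> M" using M subspace_add unfolding left_ideal_def by blast
        then show ?thesis by simp
      qed
      then show ?thesis by blast
    next
      case False
      then have "?P M" using M L(1) by blast
      then have "dim M \<le> dim L" by (rule L(2))
      moreover have "subspace L" "subspace M" using LI M by (auto simp: left_ideal_def)
      ultimately have "L = M" using fd.subspace_dim_equal M by blast
      then show ?thesis by simp
    qed
  qed (rule LI)
  then have "g \<in> L" using g(2) by (auto simp: jacobson_radical_def)
  then show False using L(1) by blast
qed

text \<open>Write \<open>e = b + j\<close>. Since \<open>b * b - b\<close> lies both in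
  \<open>B\<close> and in the radical, \<open>b\<close> is idempotent. Then \<open>j = e - b\<close>
  is a difference of commuting idempotents, so its cube is \<open>j\<close> and \<open>j * j\<close>
  is an idempotent in the radical. Hence \<open>j * j = 0\<close> and \<open>j = 0\<close>.
  Centrality of \<open>e\<close> makes it enough that the radical absorbs left factors.\<close>

lemma central_idempotent_in_radical_complement:
  assumes fd: "finite_dimensional_vector_space scale Basis"
    and B: "subalgebra B" "radical_complement B"
    and e: "e * e = e" "\<And>x. e * x = x * e"
  shows "e \<in> B"
proof -
  let ?J = "jacobson_radical UNIV"
  have J: "subspace ?J" "\<And>r x. x \<in> ?J \<Longrightarrow> r * x \<in> ?J"
    using jacobson_left_ideal by (auto simp: left_ideal_def)
  have "e \<in> {r + j |r j. r \<in> B \<and> j \<in> ?J}" using B(2) by (auto simp: radical_complement_def)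
  then obtain b j where bj: "e = b + j" "b \<in> B" "j \<in> ?J" by blast
  have b: "b = e - j" using bj by simp
  have je: "j * e = e * j" using e(2) by simp
  have "b * b - b = j * j + j - e * j - e * j"
    unfolding b by (simp add: left_diff_distrib right_diff_distrib e(1) je)
  also have "\<dots> \<in> ?J"
    using J bj(3) by (intro subspace_diff subspace_add) auto
  finally have "b * b - b \<in> ?J" .
  moreover have "b * b - b \<in> B"
    using B(1) bj(2) subspace_diff unfolding subalgebra_def by blast
  ultimately have "b * b - b = 0" using B(2) unfolding radical_complement_def by blast
  then have bb: "b * b = b" by simp
  have be: "b * e = e * b" using e(2) by simp
  have j: "j = e - b" using bj(1) by simp
  have jj: "j * j = e - e * b - e * b + b"
    unfolding j by (simp add: left_diff_distrib right_diff_distrib e(1) be bb)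
  have ebe: "e * b * e = e * b" by (metis be e(1) mult.assoc)
  have ebb: "e * b * b = e * b" by (metis bb mult.assoc)
  have jjj: "j * j * j = j"
    unfolding jj unfolding j
    by (simp add: left_diff_distrib right_diff_distrib distrib_right e(1) be bb ebe ebb)
  have "(j * j) * (j * j) = (j * j * j) * j" by (simp only: mult.assoc)
  then have "(j * j) * (j * j) = j * j" unfolding jjj .
  moreover have "j * j \<in> ?J" using J(2) bj(3) by blast
  ultimately have "j * j = 0" using idempotent_in_jacobson_radical[OF fd] by blast
  then have "j = 0" using jjj by simp
  then show ?thesis using bj by simp
qed

end

context gen_H_action
begin

text \<open>The span is a nonzero H-invariant ideal. Its invariance is the point that needs the
  product rule: if all images of one factor under \<open>H\<close> lie in the ideal, so does every
  image of the product, whichever order the rule puts the factors in. The unit \<open>e\<close> puts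
  \<open>act h v\<close> itself into the span.\<close>

lemma H_simple_generates:
  assumes simp: "H_simple R" and e: "e \<in> R" "\<And>x. x \<in> R \<Longrightarrow> e * x = x \<and> x * e = x"
    and v: "v \<in> R" "v \<noteq> 0"
  shows "e \<in> span {b * act h v * b' |b h b'. b \<in> R \<and> b' \<in> R}"
proof -
  let ?G = "{b * act h v * b' |b h b'. b \<in> R \<and> b' \<in> R}"
  have R: "subspace R" "\<And>x y. x \<in> R \<Longrightarrow> y \<in> R \<Longrightarrow> x * y \<in> R" "\<And>h x. x \<in> R \<Longrightarrow> act h x \<in> R"
    using simp by (auto simp: H_simple_def subalgebra_def H_invariant_def)
  have sub: "span ?G \<subseteq> R" using R v(1) by (intro span_minimal) auto
  have left: "r * x \<in> span ?G" if "r \<in> R" "x \<in> span ?G" for r x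
    using that(2)
  proof (induction rule: span_induct_alt)
    case (step c u w)
    then obtain b h b' where u: "u = b * act h v * b'" "b \<in> R" "b' \<in> R" by blast
    have "r * u = (r * b) * act h v * b'" "r * b \<in> R" using u that(1) R(2) by (auto simp: mult.assoc)
    then have "r * u \<in> span ?G" using u(3) by (blast intro: span_base)
    with step(2) show ?case by (simp add: distrib_left scale_mult_right span_add span_scale)
  qed (simp add: span_zero)
  have right: "x * r \<in> span ?G" if "r \<in> R" "x \<in> span ?G" for r x
    using that(2)
  proof (induction rule: span_induct_alt)
    case (step c u w)
    then obtain b h b' where u: "u = b * act h v * b'" "b \<in> R" "b' \<in> R" by blast
    have "u * r = b * act h v * (b' * r)" "b' * r \<in> R" using u that(1) R(2) by (auto simp: mult.assoc)
    then have "u * r \<in> span ?G" using u(2) by (blast intro: span_base)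
    with step(2) show ?case by (simp add: distrib_right scale_mult_left span_add span_scale)
  qed (simp add: span_zero)
  have hv: "act h v \<in> span ?G" for h
  proof -
    have "act h v = e * act h v * e" using e R(3) v(1) by metis
    then show ?thesis using e(1) by (blast intro: span_base)
  qed
  have prod: "act h (x * y) \<in> span ?G"
    if "x \<in> R" "y \<in> R" "(\<forall>h. act h x \<in> span ?G) \<or> (\<forall>h. act h y \<in> span ?G)" for h x y
  proof -
    from act_product[of h] obtain k :: nat and h1 h2 h3 h4 where prod: "\<forall>a b.
        act h (a * b) = (\<Sum>i\<in>{1..k}. act (h1 i) a * act (h2 i) b + act (h3 i) b * act (h4 i) a)"
      by (elim exE)
    have "act (h1 i) x * act (h2 i) y + act (h3 i) y * act (h4 i) x \<in> span ?G" for i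
      using that(3)
    proof
      assume "\<forall>h. act h x \<in> span ?G"
      then show ?thesis using left right R(3)[OF that(2)] by (intro span_add) blast+
    next
      assume "\<forall>h. act h y \<in> span ?G"
      then show ?thesis using left right R(3)[OF that(1)] by (intro span_add) blast+
    qed
    then show ?thesis unfolding prod[rule_format] by (intro span_sum)
  qed
  have inv: "act h x \<in> span ?G" if "x \<in> span ?G" for h x
    using that
  proof (induction rule: span_induct_alt)
    case (step c u w)
    then obtain b h' b' where u: "u = b * act h' v * b'" "b \<in> R" "b' \<in> R" by blast
    have "act g (act h' v) \<in> span ?G" for g using hv[of "g * h'"] by (simp add: act_mult)
    then have "act g (b * act h' v) \<in> span ?G" for g using prod[OF u(2) R(3)[OF v(1)] disjI2] by blast
    then have "act h u \<in> span ?G"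
      unfolding u(1) using prod[OF R(2)[OF u(2) R(3)[OF v(1)]] u(3) disjI1] by blast
    with step(2) show ?case by (simp add: act_add act_scale_right span_add span_scale)
  qed (simp add: act_zero span_zero)
  have "H_ideal R (span ?G)"
    unfolding H_ideal_def ideal_def H_invariant_def using sub left right inv by auto
  then have "span ?G = {0} \<or> span ?G = R" using simp unfolding H_simple_def by blast
  moreover have "v \<in> span ?G" using hv[of 1] by (simp add: act_one)
  ultimately show ?thesis using v(2) e(1) by auto
qed

end

section \<open>Triangular families of H-polynomials\<close>

context gen_H_action
begin

text \<open>The coordinates are freed from \<open>S\<close> one after another by linearity in each
  variable; \<open>k\<close> counts those already arbitrary.\<close>

lemma hfunctions_zero_if_zero_on_tuples:
  fixes n :: nat
  assumes g: "g \<in> hfunctions {1..n}" and S: "span S = UNIV"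
    and zero: "\<And>t. t \<in> {1..n} \<rightarrow>\<^sub>E S \<Longrightarrow> g t = 0"
  shows "g a = 0"
proof -
  have "\<forall>a. (\<forall>x\<in>{1..n}. k < x \<longrightarrow> a x \<in> S) \<longrightarrow> g a = 0" if "k \<le> n" for k
    using that
  proof (induction k)
    case 0
    show ?case
    proof (intro allI impI)
      fix a assume a: "\<forall>x\<in>{1..n}. 0 < x \<longrightarrow> a x \<in> S"
      have "g a = g (restrict a {1..n})" by (rule hfunctions_cong[OF g]) auto
      also have "\<dots> = 0" using a by (intro zero) auto
      finally show "g a = 0" .
    qed
  next
    case (Suc k)
    have k: "Suc k \<in> {1..n}" using Suc by auto
    show ?case
    proof (intro allI impI)
      fix a assume a: "\<forall>x\<in>{1..n}. Suc k < x \<longrightarrow> a x \<in> S"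
      interpret L: Vector_Spaces.linear scale scale "\<lambda>u. g (a(Suc k := u))"
        by (rule linear_hfunctions_upd[OF g k])
      have "g (a(Suc k := u)) = 0" if "u \<in> S" for u
      proof -
        have "\<forall>x\<in>{1..n}. k < x \<longrightarrow> (a(Suc k := u)) x \<in> S" using a that by auto
        then show ?thesis using Suc by simp
      qed
      then have "g (a(Suc k := a (Suc k))) = 0"
        using L.eq_0_on_span[of S] S by blast
      then show "g a = 0" by simp
    qed
  qed
  from this[of n] show ?thesis by auto
qed

lemma PH_hfunctions: "f \<in> PH scaleH n \<Longrightarrow> (\<lambda>a. eval_hp a f) \<in> hfunctions {1..n}"
  by (auto simp: PH_def hfunctions_def)

lemma PH_zero_if_zero_on_tuples:
  assumes "span S = UNIV" "f \<in> PH scaleH n" "\<forall>t\<in>{1..n} \<rightarrow>\<^sub>E S. eval_hp t f = 0"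
  shows "eval_hp a f = 0"
  using hfunctions_zero_if_zero_on_tuples[OF PH_hfunctions[OF assms(2)] assms(1)] assms(3) by blast

text \<open>Here \<open>g\<close>, restricted to values \<open>\<alpha> 0, \<dots>, \<alpha> (d - 1)\<close> of the variables in \<open>X\<close>, behaves like a
  product of determinants, one for each of the \<open>s b\<close> columns. Distributing the columns over the
  cells according to the words gives a triangular system.\<close>

lemma card_block_words_le_codimH:
  fixes g :: "('v \<Rightarrow> 'a) \<Rightarrow> 'a" and \<alpha> :: "nat \<Rightarrow> 'a"
  assumes fd: "finite_dimensional_vector_space scale Basis"
    and V: "finite V" "card V = n" and g: "g \<in> hfunctions V"
    and X: "X \<subseteq> V" and \<xi>: "bij_betw \<xi> X ({..<s * b} \<times> {..<d})" and b: "b > 0"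
    and G: "\<And>u. G u = g (\<lambda>x. if x \<in> X then \<alpha> (u (\<xi> x)) else a0 x)"
    and nz: "G snd \<noteq> 0"
    and kill: "\<And>u c. \<forall>c<s * b. \<forall>j<d. u (c, j) < d \<Longrightarrow> G u \<noteq> 0 \<Longrightarrow> c < s * b \<Longrightarrow>
      inj_on (\<lambda>j. u (c, j)) {..<d}"
  shows "card (block_words d b s) \<le> codimH n"
proof (cases "block_words d b s = {}")
  case False
  interpret fd: finite_dimensional_vector_space scale Basis by (rule fd)
  have "\<forall>w\<in>block_words d b s. \<exists>\<tau>. column_bijection d b s w \<tau>"
    using column_bijection_exists[OF b] by blast
  from bchoice[OF this] obtain \<tau> where
    \<tau>: "\<And>w. w \<in> block_words d b s \<Longrightarrow> column_bijection d b s w (\<tau> w)"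
    by blast
  have \<tau>bij: "bij_betw (\<tau> w) ({..<s * b} \<times> {..<d}) (cells d b s)" if "w \<in> block_words d b s" for w
    using \<tau>[OF that] by (simp add: column_bijection_def)
  have "card (cells d b s) = card X"
  proof -
    obtain w where "w \<in> block_words d b s" using False by blast
    then show ?thesis using bij_betw_same_card[OF \<tau>bij] bij_betw_same_card[OF \<xi>] by simp
  qed
  \<comment> \<open>The \<open>n\<close> positions are the cells together with the variables outside
    \<open>X\<close>. Only the placement of the variables in \<open>X\<close> depends on the
    word.\<close>
  let ?D = "Inl ` cells d b s \<union> Inr ` (V - X) :: (nat \<times> nat + 'v) set"
  have "card ?D = card (cells d b s) + card (V - X)"
    using finite_cells V by (subst card_Un_disjoint) (auto simp: card_image)
  also have "\<dots> = n"
    using \<open>card (cells d b s) = card X\<close> X V card_mono[OF V(1) X]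
    by (simp add: card_Diff_subset finite_subset)
  finally have "card ?D = card {1..n}" by simp
  moreover have "finite ?D" using finite_cells V by auto
  ultimately obtain \<eta> where \<eta>: "bij_betw \<eta> ?D {1..n}"
    using finite_same_card_bij[of ?D "{1..n}"] by blast
  define \<sigma> where "\<sigma> w x = (if x \<in> X then Inl (\<tau> w (\<xi> x)) else Inr x :: nat \<times> nat + 'v)" for w x
  have \<sigma>: "bij_betw (\<sigma> w) V ?D" if w: "w \<in> block_words d b s" for w
  proof -
    have "bij_betw (\<lambda>x. \<tau> w (\<xi> x)) X (cells d b s)"
      using bij_betw_trans[OF \<xi> \<tau>bij[OF w]] by (simp add: comp_def)
    then have "bij_betw (\<lambda>x. Inl (\<tau> w (\<xi> x)) :: nat \<times> nat + 'v) X (Inl ` cells d b s)"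
      using bij_betw_trans[of "\<lambda>x. \<tau> w (\<xi> x)" X "cells d b s" Inl "Inl ` cells d b s"]
      by (simp add: bij_betw_def inj_on_def comp_def)
    then have 1: "bij_betw (\<sigma> w) X (Inl ` cells d b s)"
      by (rule bij_betw_cong[THEN iffD1, rotated]) (simp add: \<sigma>_def)
    have 2: "bij_betw (\<sigma> w) (V - X) (Inr ` (V - X))"
      by (rule bij_betw_cong[THEN iffD1, of _ Inr]) (auto simp: \<sigma>_def bij_betw_def inj_on_def)
    have "bij_betw (\<sigma> w) (X \<union> (V - X)) ?D"
      by (rule bij_betw_combine[OF 1 2]) auto
    moreover have "X \<union> (V - X) = V" using X by blast
    ultimately show ?thesis by simp
  qed
  define \<rho> where "\<rho> w x = \<eta> (\<sigma> w x)" for w x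
  have \<rho>: "bij_betw (\<rho> w) V {1..n}" if "w \<in> block_words d b s" for w
  proof -
    have "\<rho> w = \<eta> \<circ> \<sigma> w" by (auto simp: \<rho>_def)
    then show ?thesis using bij_betw_trans[OF \<sigma>[OF that] \<eta>] by (simp only:)
  qed
  have "\<exists>f. f \<in> PH scaleH n \<and> (\<forall>a. g (\<lambda>x. a (\<rho> w x)) = eval_hp a f)" if "w \<in> block_words d b s" for w
    using hfunctions_rename[OF g, of "\<rho> w"] \<rho>[OF that]
    by (auto simp: bij_betw_def hfunctions_def PH_def)
  then have "\<forall>w\<in>block_words d b s. \<exists>f. f \<in> PH scaleH n \<and> (\<forall>a. g (\<lambda>x. a (\<rho> w x)) = eval_hp a f)"
    by blast
  from bchoice[OF this] obtain f where
    f': "\<forall>w\<in>block_words d b s. f w \<in> PH scaleH n \<and> (\<forall>a. g (\<lambda>x. a (\<rho> w x)) = eval_hp a (f w))"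
    by (elim exE)
  have f: "f w \<in> PH scaleH n" "eval_hp a (f w) = g (\<lambda>x. a (\<rho> w x))" if "w \<in> block_words d b s" for w a
    using bspec[OF f' that] by simp_all
  \<comment> \<open>The assignment for the word \<open>u\<close> depends on the position alone and
    not on the word \<open>w\<close> of the polynomial. Applied to \<open>f w\<close>, it gives the
    variable at \<open>c\<close> the letter \<open>u (\<tau> w c)\<close>.\<close>
  define A where "A u y = (case inv_into ?D \<eta> y of Inl z \<Rightarrow> \<alpha> (u z) | Inr x \<Rightarrow> a0 x)" for u y
  have eval: "eval_hp (A u) (f w) = G (\<lambda>c. u (\<tau> w c))" if w: "w \<in> block_words d b s" for u w
    unfolding f(2)[OF w] G
  proof (rule hfunctions_cong[OF g])
    fix x assume "x \<in> V"
    then have "\<sigma> w x \<in> ?D" using \<sigma>[OF w] by (auto simp: bij_betw_def)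
    then have "inv_into ?D \<eta> (\<rho> w x) = \<sigma> w x"
      unfolding \<rho>_def using \<eta> by (intro inv_into_f_f) (auto simp: bij_betw_def)
    then show "A u (\<rho> w x) = (if x \<in> X then \<alpha> (u (\<tau> w (\<xi> x))) else a0 x)"
      by (simp add: A_def \<sigma>_def)
  qed
  show ?thesis
  proof (rule codimH_ge[OF fd, where T = "{1..n} \<rightarrow>\<^sub>E Basis" and g = f and a = A and rank = "moment d b s"])
    show "finite ({1..n} \<rightarrow>\<^sub>E Basis)" using fd.finite_Basis by (intro finite_PiE) auto
    show "eval_hp a h = 0" if "h \<in> PH scaleH n" "\<forall>t\<in>{1..n} \<rightarrow>\<^sub>E Basis. eval_hp t h = 0" for h a
      using PH_zero_if_zero_on_tuples[OF fd.span_Basis that] .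
    show "finite (block_words d b s)" by (rule finite_block_words)
    show "f w \<in> PH scaleH n" if "w \<in> block_words d b s" for w using f(1)[OF that] .
    show "eval_hp (A w) (f w) \<noteq> 0" if w: "w \<in> block_words d b s" for w
    proof -
      have "G (\<lambda>c. w (\<tau> w c)) = G snd"
        unfolding G
      proof (rule hfunctions_cong[OF g])
        fix x
        show "(if x \<in> X then \<alpha> (w (\<tau> w (\<xi> x))) else a0 x) = (if x \<in> X then \<alpha> (snd (\<xi> x)) else a0 x)"
        proof (cases "x \<in> X")
          case True
          then have "\<xi> x \<in> {..<s * b} \<times> {..<d}" using \<xi> by (auto simp: bij_betw_def)
          then show ?thesis using \<tau>[OF w] by (cases "\<xi> x") (auto simp: column_bijection_def)
        qed simp
      qed
      then show ?thesis using eval[OF w] nz by simp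
    qed
    show "u = w \<or> moment d b s u < moment d b s w"
      if u: "u \<in> block_words d b s" and w: "w \<in> block_words d b s" and uw: "eval_hp (A u) (f w) \<noteq> 0" for u w
    proof (rule moment_less[OF u w \<tau>[OF w]])
      have "u (\<tau> w (c, j)) < d" if "c < s * b" "j < d" for c j
      proof -
        have "\<tau> w (c, j) \<in> cells d b s" using \<tau>bij[OF w] that by (auto simp: bij_betw_def)
        then show ?thesis using u by (auto simp: block_words_def PiE_iff)
      qed
      then show "inj_on (\<lambda>i. u (\<tau> w (c, i))) {..<d}" if "c < s * b" for c
        using kill[of "\<lambda>c. u (\<tau> w c)" c] uw that unfolding eval[OF w] by blast
    qed
  qed
qed simp

end

section \<open>The quotient, its H-simple summands and the lifts of their units\<close>

locale H_quotient =
  A: gen_H_action scaleH scaleA actA + Q: gen_H_action scaleH scaleQ actQ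
  for scaleH :: "'f::field_char_0 \<Rightarrow> 'h::ring_1 \<Rightarrow> 'h"
    and scaleA :: "'f \<Rightarrow> 'a::ring \<Rightarrow> 'a" and actA :: "'h \<Rightarrow> 'a \<Rightarrow> 'a"
    and scaleQ :: "'f \<Rightarrow> 'q::ring \<Rightarrow> 'q" and actQ :: "'h \<Rightarrow> 'q \<Rightarrow> 'q" +
  fixes p :: "'a \<Rightarrow> 'q" and q :: nat and Bs :: "nat \<Rightarrow> 'q set" and B :: "'q set"
    and \<kappa> :: "'q \<Rightarrow> 'a" and Basis :: "'a set"
  assumes fdA: "finite_dimensional_vector_space scaleA Basis"
    and not_nilpotent: "\<not> nilpotent_set (UNIV :: 'a set)"
    and quotient: "quotient_map scaleA actA scaleQ actQ A.JH p"
    and direct_sum: "Q.internal_direct_sum q Bs"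
    and Bs_ideal: "\<And>i. i \<in> {1..q} \<Longrightarrow> Q.H_ideal UNIV (Bs i)"
    and Bs_simple: "\<And>i. i \<in> {1..q} \<Longrightarrow> Q.H_simple (Bs i)"
    and Bs_star: "\<And>i. i \<in> {1..q} \<Longrightarrow> Q.property_star (Bs i)"
    and B_subalgebra: "Q.subalgebra B"
    and B_complement: "Q.radical_complement B"
    and kappa_linear: "Vector_Spaces.linear scaleQ scaleA \<kappa>"
    and p_kappa: "\<And>x. p (\<kappa> x) = x"
    and kappa_left: "\<And>x b. b \<in> B \<Longrightarrow> \<kappa> (b * x) = \<kappa> b * \<kappa> x"
    and kappa_right: "\<And>x b. b \<in> B \<Longrightarrow> \<kappa> (x * b) = \<kappa> x * \<kappa> b"
begin

abbreviation J :: "'a set" where "J \<equiv> A.JH"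

lemma J_ideal: "A.ideal UNIV J" and J_nilpotent: "nilpotent_set J"
  using A.JH_nilpotent_H_ideal[OF fdA] by (auto simp: A.H_ideal_def)

lemma J_subspace: "A.subspace J"
  using J_ideal by (simp add: A.ideal_def)

lemma p_add: "p (x + y) = p x + p y" and p_scale: "p (scaleA c x) = scaleQ c (p x)"
  and p_mult: "p (x * y) = p x * p y" and p_act: "p (actA h x) = actQ h (p x)"
  and p_zero_iff: "p x = 0 \<longleftrightarrow> x \<in> J" and p_surj: "surj p"
  using quotient by (auto simp: quotient_map_def Vector_Spaces.linear_iff)

lemma p_linear: "Vector_Spaces.linear scaleA scaleQ p"
  using quotient by (simp add: quotient_map_def)

lemma p_diff: "p (x - y) = p x - p y"
  by (metis add_diff_cancel diff_add_cancel p_add)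

lemma p_sum: "p (sum f S) = (\<Sum>x\<in>S. p (f x))"
proof -
  interpret P: Vector_Spaces.linear scaleA scaleQ p by (rule p_linear)
  show ?thesis by (rule P.sum)
qed

lemma diff_in_J: "p x = p y \<Longrightarrow> x - y \<in> J"
  unfolding p_zero_iff[symmetric] by (simp add: p_diff)

lemma p_nprod: "p (nprod as) = nprod (map p as)"
proof (induction as rule: nprod.induct)
  case 1
  then show ?case using A.subspace_0[OF J_subspace] p_zero_iff by simp
qed (simp_all add: p_mult)

lemma p_eval: "p (A.eval_hp a f) = Q.eval_hp (\<lambda>x. p (a x)) f"
  unfolding A.eval_hp_def Q.eval_hp_def p_sum p_scale p_nprod
  by (intro sum.cong arg_cong2[where f = scaleQ] arg_cong[where f = nprod] refl) (auto simp: p_act)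

lemma fdQ: "\<exists>BQ. finite_dimensional_vector_space scaleQ BQ"
proof -
  interpret fd: finite_dimensional_vector_space scaleA Basis by (rule fdA)
  interpret P: Vector_Spaces.linear scaleA scaleQ p by (rule p_linear)
  obtain BQ where BQ: "BQ \<subseteq> p ` Basis" "Q.independent BQ" "p ` Basis \<subseteq> Q.span BQ"
    using Q.maximal_independent_subset by blast
  have "p ` A.span Basis = Q.span (p ` Basis)" by (rule P.span_image[symmetric])
  then have "Q.span (p ` Basis) = UNIV" using fd.span_Basis p_surj by simp
  then have "Q.span BQ = UNIV" using BQ(3) Q.span_minimal[OF BQ(3) Q.subspace_span] by blast
  moreover have "finite BQ" using BQ(1) fd.finite_Basis finite_subset by blast
  ultimately have "finite_dimensional_vector_space scaleQ BQ"
    using BQ(2) by unfold_locales auto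
  then show ?thesis ..
qed

lemma Bs_subspace: "i \<in> {1..q} \<Longrightarrow> Q.subspace (Bs i)"
  and Bs_mult_left: "i \<in> {1..q} \<Longrightarrow> x \<in> Bs i \<Longrightarrow> r * x \<in> Bs i"
  and Bs_mult_right: "i \<in> {1..q} \<Longrightarrow> x \<in> Bs i \<Longrightarrow> x * r \<in> Bs i"
  and Bs_act: "i \<in> {1..q} \<Longrightarrow> x \<in> Bs i \<Longrightarrow> actQ h x \<in> Bs i"
  using Bs_ideal[of i] by (auto simp: Q.H_ideal_def Q.ideal_def Q.H_invariant_def)

lemma Bs_disjoint:
  assumes i: "i \<in> {1..q}" and l: "l \<in> {1..q}" and "i \<noteq> l" "x \<in> Bs i" "x \<in> Bs l"
  shows "x = 0"
proof -
  define b where "b k = (\<lambda>j\<in>{1..q}. if j = k then x else 0)" for k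
  have "b k \<in> (\<Pi>\<^sub>E j\<in>{1..q}. Bs j)" if "x \<in> Bs k" for k
    using that Bs_subspace Q.subspace_0 by (auto simp: b_def)
  moreover have "x = (\<Sum>j\<in>{1..q}. b k j)" if "k \<in> {1..q}" for k
    using that by (simp add: b_def)
  ultimately have "b i = b l"
    using direct_sum assms unfolding Q.internal_direct_sum_def by blast
  then have "b i i = b l i" by simp
  then show ?thesis using i \<open>i \<noteq> l\<close> by (simp add: b_def)
qed

lemma Bs_mult_zero:
  assumes "i \<in> {1..q}" "l \<in> {1..q}" "i \<noteq> l" "x \<in> Bs i" "y \<in> Bs l"
  shows "x * y = 0"
  using assms Bs_disjoint[OF assms(1-3)] Bs_mult_left Bs_mult_right by blast

lemma Bs_decompose: "\<exists>b. (\<forall>i\<in>{1..q}. b i \<in> Bs i) \<and> x = (\<Sum>i\<in>{1..q}. b i)"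
proof -
  obtain b where "b \<in> (\<Pi>\<^sub>E i\<in>{1..q}. Bs i)" "x = (\<Sum>i\<in>{1..q}. b i)"
    using direct_sum unfolding Q.internal_direct_sum_def by blast
  then show ?thesis by (auto intro!: exI[of _ b])
qed

definition unit :: "nat \<Rightarrow> 'q" where
  "unit i = (SOME e. e \<in> Bs i \<and> (\<forall>x\<in>Bs i. e * x = x \<and> x * e = x))"

lemma unit_spec:
  assumes "i \<in> {1..q}"
  shows "unit i \<in> Bs i" "x \<in> Bs i \<Longrightarrow> unit i * x = x" "x \<in> Bs i \<Longrightarrow> x * unit i = x"
proof -
  have "\<exists>e. e \<in> Bs i \<and> (\<forall>x\<in>Bs i. e * x = x \<and> x * e = x)"
    using Bs_star[OF assms] by (auto simp: Q.property_star_def unital_on_def)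
  from someI_ex[OF this, folded unit_def]
  show "unit i \<in> Bs i" "x \<in> Bs i \<Longrightarrow> unit i * x = x" "x \<in> Bs i \<Longrightarrow> x * unit i = x" by auto
qed

lemma unit_central:
  assumes i: "i \<in> {1..q}"
  shows "unit i * x = x * unit i"
proof -
  obtain b where b: "\<forall>i\<in>{1..q}. b i \<in> Bs i" "x = (\<Sum>i\<in>{1..q}. b i)" using Bs_decompose by blast
  have "unit i * b j = b j * unit i" if "j \<in> {1..q}" for j
    using Bs_mult_zero[of i j] Bs_mult_zero[of j i] unit_spec[OF i] b(1) that i by (cases "i = j") auto
  then show ?thesis unfolding b(2) sum_distrib_left sum_distrib_right by (intro sum.cong) auto
qed

lemma unit_in_B:
  assumes i: "i \<in> {1..q}"
  shows "unit i \<in> B"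
proof -
  obtain BQ where BQ: "finite_dimensional_vector_space scaleQ BQ" using fdQ ..
  have "unit i * unit i = unit i" using unit_spec[OF i] by blast
  then show ?thesis
    using unit_central[OF i]
    by (rule Q.central_idempotent_in_radical_complement[OF BQ B_subalgebra B_complement])
qed

definition idem :: "nat \<Rightarrow> 'a" where "idem i = \<kappa> (unit i)"

lemma p_idem: "p (idem i) = unit i"
  by (simp add: idem_def p_kappa)

lemma kappa_idem:
  assumes "i \<in> {1..q}" "x \<in> Bs i"
  shows "\<kappa> x * idem i = \<kappa> x" "idem i * \<kappa> x = \<kappa> x"
  unfolding idem_def kappa_left[OF unit_in_B[OF assms(1)], symmetric]
    kappa_right[OF unit_in_B[OF assms(1)], symmetric]
  using unit_spec[OF assms(1)] assms(2) by auto

lemma idem_idem: "i \<in> {1..q} \<Longrightarrow> idem i * idem i = idem i"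
  unfolding idem_def using kappa_idem(1)[of i "unit i"] unit_spec(1) idem_def by simp

end

context gen_H_action
begin

lemma hfunctions_nprod:
  fixes V :: "nat \<Rightarrow> 'v set"
  assumes "N \<ge> 1" "\<And>i. i < N \<Longrightarrow> g i \<in> hfunctions (V i)"
    and "\<And>i j. i < j \<Longrightarrow> j < N \<Longrightarrow> V i \<inter> V j = {}"
  shows "(\<lambda>a. nprod (map (\<lambda>i. g i a) [0..<N])) \<in> hfunctions (\<Union>i<N. V i)"
  using assms
proof (induction N rule: dec_induct)
  case base
  then show ?case by (simp add: lessThan_Suc)
next
  case (step N)
  have "(\<Union>i<N. V i) \<inter> V N = {}" using step(5) by blast
  then have "(\<lambda>a. nprod (map (\<lambda>i. g i a) [0..<N]) * g N a) \<in> hfunctions ((\<Union>i<N. V i) \<union> V N)"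
    using step by (intro hfunctions_mult) auto
  moreover have "nprod (map (\<lambda>i. g i a) [0..<Suc N]) = nprod (map (\<lambda>i. g i a) [0..<N]) * g N a" for a
    using step(1) by (simp add: nprod_append)
  moreover have "(\<Union>i<Suc N. V i) = (\<Union>i<N. V i) \<union> V N" by (auto simp: less_Suc_eq)
  ultimately show ?case by simp
qed

lemma eval_in_H_ideal:
  assumes f: "f \<in> multilinear_hpolys scaleH V" and I: "H_ideal UNIV I" and x: "x \<in> V" "a x \<in> I"
  shows "eval_hp a f \<in> I"
proof -
  have "(\<lambda>a. eval_hp a f) \<in> hfunctions V" using f by (auto simp: hfunctions_def)
  then show ?thesis
  proof (rule hfunctions_subspace)
    show "subspace I" using I by (simp add: H_ideal_def ideal_def)
    fix m :: "('b \<times> 'h) list" assume "set (map fst m) = V"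
    then obtain h where "(x, h) \<in> set m" using x(1) by auto
    then have "act h (a x) \<in> set (map (\<lambda>(x, h). act h (a x)) m)" by force
    moreover have "act h (a x) \<in> I" using I x(2) by (simp add: H_ideal_def H_invariant_def)
    ultimately show "monomial_value m a \<in> I"
      unfolding monomial_value_def using I nprod_in_ideal by (auto simp: H_ideal_def)
  qed
qed

lemma span_generated_sum:
  assumes "x \<in> span {b * act h v * b' |b h b'. b \<in> R \<and> b' \<in> R}" and R: "subspace R"
  shows "\<exists>N b h b'. (\<forall>t<N. b t \<in> R \<and> b' t \<in> R) \<and> x = (\<Sum>t<(N::nat). b t * act (h t) v * b' t)"
  using assms(1)
proof (induction rule: span_induct_alt)
  case base
  show ?case by (rule exI[of _ 0]) simp
next
  case (step c u y)
  obtain b0 h0 b0' where u: "u = b0 * act h0 v * b0'" "b0 \<in> R" "b0' \<in> R" using step(1) by blast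
  obtain N b h b' where y: "\<forall>t<N. b t \<in> R \<and> b' t \<in> R" "y = (\<Sum>t<(N::nat). b t * act (h t) v * b' t)"
    using step(2) by blast
  let ?b = "b(N := scale c b0)" and ?h = "h(N := h0)" and ?b' = "b'(N := b0')"
  have "\<forall>t<Suc N. ?b t \<in> R \<and> ?b' t \<in> R"
    using y(1) u R by (auto simp: less_Suc_eq subspace_scale)
  moreover have "scale c u + y = (\<Sum>t<Suc N. ?b t * act (?h t) v * ?b' t)"
    unfolding y(2) u(1) by (simp add: scale_mult_left add.commute)
  ultimately show ?case by blast
qed

end

context H_quotient
begin

text \<open>\<open>dim\<close> of a union is the dimension of its span. The sum is direct because
  \<open>unit i\<close> fixes \<open>Bs i\<close> and annihilates the other summands.\<close>

lemma dim_Union: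
  assumes "S \<subseteq> {1..q}"
  shows "Q.dim (\<Union>i\<in>S. Bs i) = (\<Sum>i\<in>S. Q.dim (Bs i))"
proof -
  obtain BQ where "finite_dimensional_vector_space scaleQ BQ" using fdQ ..
  then interpret fd: finite_dimensional_vector_space scaleQ BQ .
  have "finite S" using assms finite_subset by blast
  then show ?thesis using assms
  proof (induction S rule: finite_induct)
    case empty
    show ?case by simp
  next
    case (insert i S)
    let ?U = "Q.span (\<Union>l\<in>S. Bs l)"
    have i: "i \<in> {1..q}" using insert by blast
    have zero: "unit i * y = 0" if "y \<in> ?U" for y
    proof (rule Q.right_linear_span[OF Q.right_linear_mult _ that])
      fix x assume "x \<in> (\<Union>l\<in>S. Bs l)"
      then obtain l where "l \<in> S" "x \<in> Bs l" by blast
      moreover from this have "l \<in> {1..q}" "i \<noteq> l" using insert by auto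
      ultimately show "unit i * x = 0"
        using Bs_mult_zero[OF i _ _ unit_spec(1)[OF i]] by blast
    qed
    have "x = 0" if "x \<in> Bs i" "x \<in> ?U" for x
      using zero[OF that(2)] unit_spec(2)[OF i that(1)] by simp
    then have inter: "Bs i \<inter> ?U = {0}"
      using Q.subspace_0[OF Bs_subspace[OF i]] Q.span_zero by blast
    have "Q.dim (\<Union>l\<in>insert i S. Bs l) = Q.dim (Q.span (Bs i \<union> (\<Union>l\<in>S. Bs l)))"
      by simp
    also have "Q.span (Bs i \<union> (\<Union>l\<in>S. Bs l)) = {x + y |x y. x \<in> Bs i \<and> y \<in> ?U}"
      unfolding Q.span_Un Q.span_eq_iff[THEN iffD2, OF Bs_subspace[OF i]] ..
    also have "Q.dim {x + y |x y. x \<in> Bs i \<and> y \<in> ?U} = Q.dim (Bs i) + Q.dim ?U"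
      using fd.dim_sums_Int[OF Bs_subspace[OF i] Q.subspace_span, of "\<Union>l\<in>S. Bs l"] inter by simp
    also have "Q.dim ?U = (\<Sum>i\<in>S. Q.dim (Bs i))" using insert by simp
    finally show ?case using insert by simp
  qed
qed

abbreviation Hk :: "nat \<Rightarrow> 'a set" where "Hk i \<equiv> A.H_span (\<kappa> ` Bs i)"

text \<open>Since \<open>h \<kappa>(b) = h(\<epsilon> \<kappa>(b))\<close> for \<open>\<epsilon> = \<kappa>(1)\<close> is a sum of products of two elements of \<open>H \<kappa>(B\<^sub>i)\<close>,
  and \<open>H \<kappa>(B\<^sub>i)\<close> agrees with \<open>\<kappa>(B\<^sub>i) \<subseteq> A \<epsilon> A\<close> modulo \<open>J\<close>, it is contained in \<open>A \<epsilon> A\<close> modulo each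
  power of \<open>J\<close>.\<close>

lemma Hk_subset:
  assumes i: "i \<in> {1..q}"
  shows "Hk i \<subseteq> A.span {x * idem i * y |x y. True}"
proof -
  let ?E = "A.span {x * idem i * y |x y. True}"
  have E_left: "r * x \<in> ?E" and E_right: "x * r \<in> ?E" if "x \<in> ?E" for r x
  proof -
    show "r * x \<in> ?E" using that
    proof (induction rule: A.span_induct_alt)
      case (step c u w)
      then obtain x y where "u = x * idem i * y" by blast
      then have "r * u = (r * x) * idem i * y" by (simp add: mult.assoc)
      then have "r * u \<in> ?E" by (blast intro: A.span_base)
      with step(2) show ?case by (simp add: distrib_left A.scale_mult_right A.span_add A.span_scale)
    qed (simp add: A.span_zero)
    show "x * r \<in> ?E" using that
    proof (induction rule: A.span_induct_alt)
      case (step c u w)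
      then obtain x y where "u = x * idem i * y" by blast
      then have "u * r = x * idem i * (y * r)" by (simp add: mult.assoc)
      then have "u * r \<in> ?E" by (blast intro: A.span_base)
      with step(2) show ?case by (simp add: distrib_right A.scale_mult_left A.span_add A.span_scale)
    qed (simp add: A.span_zero)
  qed
  have kE: "\<kappa> x \<in> ?E" if "x \<in> Bs i" for x
  proof -
    have "\<kappa> x = idem i * idem i * \<kappa> x"
      using kappa_idem(2)[OF i that] idem_idem[OF i] by simp
    then show ?thesis by (blast intro: A.span_base)
  qed
  let ?R = "\<lambda>n. {u + w |u w. u \<in> ?E \<and> w \<in> A.ideal_power J n}"
  have R: "A.subspace (?R n)" for n
    by (rule A.subspace_sums[OF A.subspace_span A.subspace_ideal_power])
  have "\<forall>x\<in>Bs i. \<forall>h. actA h (\<kappa> x) \<in> ?R n" for n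
  proof (induction n)
    case 0
    have "x \<in> ?R 0" for x
      by (intro CollectI exI[of _ "0::'a"] exI[of _ x]) (simp add: A.span_zero)
    then show ?case by blast
  next
    case (Suc n)
    have prod: "actA h (\<kappa> x) * actA h' (\<kappa> y) \<in> ?R (Suc n)" if xy: "x \<in> Bs i" "y \<in> Bs i" for x y h h'
    proof -
      let ?Y = "\<kappa> (actQ h' y)"
      have j: "actA h' (\<kappa> y) - ?Y \<in> J" by (rule diff_in_J) (simp add: p_act p_kappa)
      obtain u w where uw: "actA h (\<kappa> x) = u + w" "u \<in> ?E" "w \<in> A.ideal_power J n"
        using Suc xy by blast
      have "actA h (\<kappa> x) * actA h' (\<kappa> y)
          = actA h (\<kappa> x) * ?Y + (u + w) * (actA h' (\<kappa> y) - ?Y)"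
        unfolding uw(1) by (simp add: right_diff_distrib)
      also have "\<dots> = (actA h (\<kappa> x) * ?Y + u * (actA h' (\<kappa> y) - ?Y)) + w * (actA h' (\<kappa> y) - ?Y)"
        by (simp add: distrib_right)
      finally have "actA h (\<kappa> x) * actA h' (\<kappa> y)
        = (actA h (\<kappa> x) * ?Y + u * (actA h' (\<kappa> y) - ?Y)) + w * (actA h' (\<kappa> y) - ?Y)" .
      moreover have "actA h (\<kappa> x) * ?Y + u * (actA h' (\<kappa> y) - ?Y) \<in> ?E"
        by (intro A.span_add E_left E_right kE Bs_act i xy uw(2))
      moreover have "w * (actA h' (\<kappa> y) - ?Y) \<in> A.ideal_power J (Suc n)"
        using uw(3) j by (rule A.ideal_power_Suc)
      ultimately show ?thesis by blast
    qed
    show ?case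
    proof (intro ballI allI)
      fix x h assume x: "x \<in> Bs i"
      have e: "unit i \<in> Bs i" using unit_spec(1)[OF i] .
      from A.act_product[of h] obtain k :: nat and h1 h2 h3 h4 where act: "\<forall>a b. actA h (a * b)
          = (\<Sum>i\<in>{1..k}. actA (h1 i) a * actA (h2 i) b + actA (h3 i) b * actA (h4 i) a)"
        by (elim exE)
      have "actA h (\<kappa> x) = actA h (\<kappa> (unit i) * \<kappa> x)"
        using kappa_idem(2)[OF i x] by (simp add: idem_def)
      also have "\<dots> \<in> ?R (Suc n)"
        unfolding act[rule_format] by (intro A.subspace_sum[OF R] A.subspace_add[OF R] prod e x)
      finally show "actA h (\<kappa> x) \<in> ?R (Suc n)" .
    qed
  qed
  moreover obtain s where s: "A.nilpotency_bound J s"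
    using A.nilpotency_bound_exists[OF J_ideal J_nilpotent] ..
  ultimately have "\<forall>x\<in>Bs i. \<forall>h. actA h (\<kappa> x) \<in> ?R s" by blast
  moreover have "?R s \<subseteq> ?E"
  proof clarify
    fix u w assume "u \<in> ?E" "w \<in> A.ideal_power J s"
    then show "u + w \<in> ?E" using A.ideal_power_eq_0[OF s order_refl, of w] by simp
  qed
  ultimately have "\<forall>x\<in>Bs i. \<forall>h. actA h (\<kappa> x) \<in> ?E" by blast
  then show ?thesis
    unfolding A.H_span_def by (intro A.span_minimal[OF _ A.subspace_span]) blast
qed

text \<open>\<open>Hk_subset\<close> eliminates \<open>H\<close> and \<open>A^+\<close> from the
  chain: its nonvanishing becomes that of a product of arbitrary multipliers and the idempotents, to
  which the choice of maximal degree applies.\<close>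

lemma chain_multipliers:
  assumes js: "js \<noteq> []" "set js \<subseteq> {1..q}" and chain: "A.plus_chain (map Hk js) \<noteq> {0}"
  shows "\<exists>c. A.slot_prod (length js) c (\<lambda>i. idem (js ! i)) \<noteq> 0 \<and>
    (\<forall>y. (\<forall>i<length js. y i * idem (js ! i) = y i) \<and> (\<exists>i<length js. y i \<in> J) \<longrightarrow>
      A.slot_prod (length js) c y = 0)"
proof -
  have "\<exists>cs. length cs = length js \<and> nprod (map2 (*) cs (map idem js)) \<noteq> 0"
  proof (rule ccontr)
    assume neg: "\<not> ?thesis"
    have "c = 0" if "c \<in> A.plus_chain (map Hk js)" for c
      using A.plus_chain_zero_if_nprod_zero[OF A.right_linear_id js(1), of Hk idem c] Hk_subset js(2) neg that
      by blast
    moreover have "0 \<in> A.plus_chain (map Hk js)"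
    proof -
      obtain j js' where "js = j # js'" using js(1) by (cases js) auto
      then show ?thesis
        by (cases js') (simp_all add: A.prod_space_def A.H_span_def A.span_zero)
    qed
    ultimately show False using chain by blast
  qed
  then obtain cs where cs: "length cs = length js" "nprod (map2 (*) cs (map idem js)) \<noteq> 0" by blast
  have "map2 (*) cs (map idem js) = map (\<lambda>i. cs ! i * idem (js ! i)) [0..<length js]"
    using cs(1) by (intro nth_equalityI) auto
  then have "A.slot_prod (length js) (\<lambda>i. cs ! i) (\<lambda>i. idem (js ! i)) \<noteq> 0"
    using cs(2) by (simp add: A.slot_prod_def)
  from A.maximal_multipliers[OF J_ideal J_nilpotent this] show ?thesis .
qed

end

section \<open>Values of the alternating polynomials in the slots\<close>

context H_quotient
begin

definition star_vars :: "nat \<Rightarrow> nat \<Rightarrow> nat \<Rightarrow> star_var set" where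
  "star_vars k l n1 = {XVar i j |i j. i \<in> {1..2*k} \<and> j \<in> {1..l}} \<union> {ZVar m |m. m \<in> {1..n1}}"

definition star_value :: "(nat \<Rightarrow> 'q) \<Rightarrow> (nat \<Rightarrow> 'q) \<Rightarrow> star_var \<Rightarrow> 'q" where
  "star_value a z v = (case v of XVar i j \<Rightarrow> a j | ZVar m \<Rightarrow> z m)"

lemma star_poly:
  assumes i: "i \<in> {1..q}"
  shows "\<exists>l a n0. Q.is_basis_family (Bs i) l a \<and> (\<forall>k\<ge>1. \<exists>n1\<le>n0. \<exists>f z.
    f \<in> multilinear_hpolys scaleH (star_vars k l n1) \<and>
    (\<forall>c\<in>{1..2*k}. alternating_in scaleH {XVar c j |j. j \<in> {1..l}} f) \<and>
    (\<forall>m\<in>{1..n1}. z m \<in> Bs i) \<and> Q.eval_hp (star_value a z) f \<noteq> 0)"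
  using Bs_star[OF i] unfolding Q.property_star_def star_vars_def star_value_def
  by (elim conjE exE) (intro exI conjI, assumption+)

lemma card_star_vars: "card (star_vars k l n1) = 2 * k * l + n1" "finite (star_vars k l n1)"
proof -
  have X: "{XVar i j |i j. i \<in> {1..2*k} \<and> j \<in> {1..l}} = (\<lambda>(i, j). XVar i j) ` ({1..2*k} \<times> {1..l})"
    by auto
  have Z: "{ZVar m |m. m \<in> {1..n1}} = ZVar ` {1..n1}" by auto
  have "card ((\<lambda>(i, j). XVar i j) ` ({1..2*k} \<times> {1..l})) = 2 * k * l"
    by (subst card_image) (auto simp: inj_on_def)
  moreover have "card (ZVar ` {1..n1}) = n1" by (subst card_image) (auto simp: inj_on_def)
  ultimately show "card (star_vars k l n1) = 2 * k * l + n1" "finite (star_vars k l n1)"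
    unfolding star_vars_def X Z by (subst card_Un_disjoint) auto
qed

lemma unit_sum:
  assumes i: "i \<in> {1..q}" and v: "v \<in> Bs i" "v \<noteq> 0"
  shows "\<exists>N b h b'. (\<forall>t<N. b t \<in> Bs i \<and> b' t \<in> Bs i) \<and> unit i = (\<Sum>t<(N::nat). b t * actQ (h t) v * b' t)"
proof (rule Q.span_generated_sum[OF _ Bs_subspace[OF i]])
  show "unit i \<in> Q.span {b * actQ h v * b' |b h b'. b \<in> Bs i \<and> b' \<in> Bs i}"
    using Bs_simple[OF i] unit_spec[OF i] v by (intro Q.H_simple_generates) auto
qed

definition slot_value :: "'a \<Rightarrow> 'h \<Rightarrow> 'a \<Rightarrow> (star_var, 'h, 'f) hpoly \<Rightarrow> (star_var \<Rightarrow> 'a) \<Rightarrow> 'a" where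
  "slot_value b h b' f a = b * (actA h (A.eval_hp a f) * b')"

lemma p_slot_value: "p (slot_value b h b' f a) = p b * (actQ h (Q.eval_hp (\<lambda>x. p (a x)) f) * p b')"
  by (simp add: slot_value_def p_mult p_act p_eval)

lemma nprod_idem:
  assumes "i \<in> {1..q}" "N \<ge> 1"
  shows "nprod (map (\<lambda>t. idem i) [0..<N]) = idem i"
  using assms(2)
proof (induction N rule: dec_induct)
  case (step N)
  then show ?case using idem_idem[OF assms(1)] by (simp add: nprod_append)
qed simp

end

context H_quotient
begin

text \<open>By H-simplicity the nonzero value of \<open>f i\<close> generates the unit of its
  summand. The lifted expansion agrees with \<open>idem (js ! i)\<close> modulo \<open>J\<close>, so
  in every slot one of its summands can replace the idempotent.\<close>

lemma star_slots:
  assumes js: "js \<noteq> []" "set js \<subseteq> {1..q}" and chain: "A.plus_chain (map Hk js) \<noteq> {0}"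
    and v: "\<And>i. i < length js \<Longrightarrow> Q.eval_hp (val i) (f i) \<in> Bs (js ! i) \<and> Q.eval_hp (val i) (f i) \<noteq> 0"
  shows "\<exists>c b h b'. (\<forall>i<length js. b i \<in> Bs (js ! i) \<and> b' i \<in> Bs (js ! i)) \<and>
    A.slot_prod (length js) c (\<lambda>i. slot_value (\<kappa> (b i)) (h i) (\<kappa> (b' i)) (f i) (\<lambda>x. \<kappa> (val i x))) \<noteq> 0 \<and>
    (\<forall>y. (\<forall>i<length js. y i * idem (js ! i) = y i) \<and> (\<exists>i<length js. y i \<in> J) \<longrightarrow>
      A.slot_prod (length js) c y = 0)"
proof -
  let ?r = "length js"
  have jq: "js ! i \<in> {1..q}" if "i < ?r" for i using js(2) that nth_mem by blast
  obtain c where c: "A.slot_prod ?r c (\<lambda>i. idem (js ! i)) \<noteq> 0"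
    and kill: "\<And>y. (\<forall>i<?r. y i * idem (js ! i) = y i) \<Longrightarrow> (\<exists>i<?r. y i \<in> J) \<Longrightarrow> A.slot_prod ?r c y = 0"
    using chain_multipliers[OF js chain] by blast
  define P where "P i N b h b' \<longleftrightarrow> (\<forall>t<N. b t \<in> Bs (js ! i) \<and> b' t \<in> Bs (js ! i)) \<and>
    unit (js ! i) = (\<Sum>t<(N::nat). b t * actQ (h t) (Q.eval_hp (val i) (f i)) * b' t)" for i N b h b'
  have "\<forall>i\<in>{..<?r}. \<exists>X. case X of (N, b, h, b') \<Rightarrow> P i N b h b'"
  proof
    fix i assume "i \<in> {..<?r}"
    then have "\<exists>N b h b'. P i N b h b'"
      unfolding P_def using unit_sum[OF jq] v by simp
    then show "\<exists>X. case X of (N, b, h, b') \<Rightarrow> P i N b h b'" by auto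
  qed
  from bchoice[OF this] obtain X where X: "\<forall>i\<in>{..<?r}. case X i of (N, b, h, b') \<Rightarrow> P i N b h b'"
    by (elim exE)
  define N b h b' where "N i = fst (X i)" and "b i = fst (snd (X i))"
    and "h i = fst (snd (snd (X i)))" and "b' i = snd (snd (snd (X i)))" for i
  have P: "P i (N i) (b i) (h i) (b' i)" if "i < ?r" for i
    using X that by (auto simp: N_def b_def h_def b'_def split: prod.splits)
  define Y where "Y i t = slot_value (\<kappa> (b i t)) (h i t) (\<kappa> (b' i t)) (f i) (\<lambda>x. \<kappa> (val i x))" for i t
  have "\<exists>t. (\<forall>i<?r. t i \<in> {..<N i}) \<and> A.slot_prod ?r c (\<lambda>i. Y i (t i)) \<noteq> 0"
  proof (rule A.slot_prod_replace[where T = "\<lambda>i. {..<N i}", OF c kill])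
    show "idem (js ! i) * idem (js ! i) = idem (js ! i)" if "i < ?r" for i
      using idem_idem[OF jq[OF that]] .
    show "Y i t * idem (js ! i) = Y i t" if "i < ?r" "t \<in> {..<N i}" for i t
      using P[OF that(1)] that(2) kappa_idem(1)[OF jq[OF that(1)]]
      by (simp add: Y_def slot_value_def mult.assoc P_def)
    show "idem (js ! i) - (\<Sum>t<N i. Y i t) \<in> J" if "i < ?r" for i
    proof (rule diff_in_J)
      show "p (idem (js ! i)) = p (\<Sum>t<N i. Y i t)"
        using P[OF that] by (simp add: p_sum p_idem Y_def p_slot_value p_kappa P_def mult.assoc)
    qed
  qed
  then obtain t where t: "\<forall>i<?r. t i \<in> {..<N i}" "A.slot_prod ?r c (\<lambda>i. Y i (t i)) \<noteq> 0" by blast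
  show ?thesis
  proof (intro exI conjI)
    show "\<forall>i<?r. b i (t i) \<in> Bs (js ! i) \<and> b' i (t i) \<in> Bs (js ! i)"
      using P t(1) by (simp add: P_def)
    show "A.slot_prod ?r c (\<lambda>i. slot_value (\<kappa> (b i (t i))) (h i (t i)) (\<kappa> (b' i (t i))) (f i) (\<lambda>x. \<kappa> (val i x))) \<noteq> 0"
      using t(2) by (simp add: Y_def)
    show "\<forall>y. (\<forall>i<?r. y i * idem (js ! i) = y i) \<and> (\<exists>i<?r. y i \<in> J) \<longrightarrow> A.slot_prod ?r c y = 0"
      using kill by blast
  qed
qed

text \<open>The multiplier and the two elements around the polynomial must be values of variables,
  \<open>y0\<close>, \<open>y1\<close> and \<open>y2\<close>, because an H-polynomial has no
  coefficients in the algebra.\<close>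

lemma slot_hfunction:
  fixes V :: "star_var set" and i :: nat
  assumes f: "f \<in> multilinear_hpolys scaleH V" and y: "distinct [y0, y1, y2]" "V \<inter> {y0, y1, y2} = {}"
  shows "(\<lambda>a. a (i, y0) * slot_value (a (i, y1)) h (a (i, y2)) f (\<lambda>x. a (i, x)))
    \<in> A.hfunctions (Pair i ` (V \<union> {y0, y1, y2}))"
proof -
  have "(\<lambda>a. A.eval_hp a f) \<in> A.hfunctions V" using f by (auto simp: A.hfunctions_def)
  from A.hfunctions_rename[OF this, of "Pair i"]
  have "(\<lambda>a. A.eval_hp (\<lambda>x. a (i, x)) f) \<in> A.hfunctions (Pair i ` V)" by (simp add: inj_on_def)
  from A.hfunctions_act[OF this, of h]
  have "(\<lambda>a. actA h (A.eval_hp (\<lambda>x. a (i, x)) f)) \<in> A.hfunctions (Pair i ` V)" .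
  from A.hfunctions_mult[OF this A.hfunctions_var[of "(i, y2)"]]
  have 1: "(\<lambda>a. actA h (A.eval_hp (\<lambda>x. a (i, x)) f) * a (i, y2)) \<in> A.hfunctions (Pair i ` V \<union> {(i, y2)})"
    using y(2) by auto
  have 2: "(\<lambda>a. a (i, y1) * (actA h (A.eval_hp (\<lambda>x. a (i, x)) f) * a (i, y2)))
      \<in> A.hfunctions ({(i, y1)} \<union> (Pair i ` V \<union> {(i, y2)}))"
    using y by (intro A.hfunctions_mult[OF A.hfunctions_var 1]) auto
  have "(\<lambda>a. a (i, y0) * (a (i, y1) * (actA h (A.eval_hp (\<lambda>x. a (i, x)) f) * a (i, y2))))
      \<in> A.hfunctions ({(i, y0)} \<union> ({(i, y1)} \<union> (Pair i ` V \<union> {(i, y2)})))"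
    using y by (intro A.hfunctions_mult[OF A.hfunctions_var 2]) auto
  moreover have "{(i, y0)} \<union> ({(i, y1)} \<union> (Pair i ` V \<union> {(i, y2)})) = Pair i ` (V \<union> {y0, y1, y2})" by auto
  ultimately show ?thesis by (simp add: slot_value_def)
qed

text \<open>Column \<open>c\<close> joins the \<open>c\<close>-th alternating sets of all
  \<open>f i\<close>, hence has \<open>D\<close> variables. The degree bound adds, for each
  \<open>i\<close>, the \<open>z\<close> variables and three variables for the constants of the
  slot, and finally one padding variable. A nonvanishing assignment is injective on each column for
  two reasons: a basis vector of a foreign summand puts a slot into \<open>J\<close>, and a repeated
  vector within one summand is excluded by alternation.\<close>

lemma lower_bound_aux:
  fixes l n1 :: "nat \<Rightarrow> nat" and a z :: "nat \<Rightarrow> nat \<Rightarrow> 'q"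
  assumes js: "js \<noteq> []" "distinct js" "set js \<subseteq> {1..q}"
    and chain: "A.plus_chain (map Hk js) \<noteq> {0}"
    and b: "b \<ge> 1" and s: "s \<ge> 1" and k: "k = s * b"
    and D: "D = (\<Sum>i<length js. l i)"
    and l: "\<And>i. i < length js \<Longrightarrow> l i \<ge> 1"
    and a: "\<And>i j. i < length js \<Longrightarrow> j \<in> {1..l i} \<Longrightarrow> a i j \<in> Bs (js ! i)"
    and f: "\<And>i. i < length js \<Longrightarrow> f i \<in> multilinear_hpolys scaleH (star_vars k (l i) (n1 i))"
    and alt: "\<And>i c. i < length js \<Longrightarrow> c \<in> {1..2*k} \<Longrightarrow>
      alternating_in scaleH {XVar c j |j. j \<in> {1..l i}} (f i)"
    and nz: "\<And>i. i < length js \<Longrightarrow> Q.eval_hp (star_value (a i) (z i)) (f i) \<noteq> 0"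
    and n: "n \<ge> 2 * k * D + (\<Sum>i<length js. n1 i + 3) + 1"
  shows "card (block_words D b (2 * s)) \<le> A.codimH n"
proof -
  define r where "r = length js"
  have r: "r \<ge> 1" using js(1) by (cases js) (auto simp: r_def)
  have jq: "js ! i \<in> {1..q}" if "i < r" for i using js(3) that nth_mem unfolding r_def by blast
  have k1: "k \<ge> 1" using b s k by simp
  define val where "val i = star_value (a i) (z i)" for i
  have fi: "f i \<in> multilinear_hpolys scaleH (star_vars k (l i) (n1 i))" if "i < r" for i
    using f that by (simp add: r_def)
  \<comment> \<open>One variable with a value in an ideal suffices to place the whole value of
    \<open>f i\<close> there; this needs an alternating variable to exist.\<close>
  have X11: "XVar 1 1 \<in> star_vars k (l i) (n1 i)" if "i < r" for i
    using k1 l[of i] that by (auto simp: star_vars_def r_def)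
  have v: "Q.eval_hp (val i) (f i) \<in> Bs (js ! i) \<and> Q.eval_hp (val i) (f i) \<noteq> 0" if "i < length js" for i
  proof
    show "Q.eval_hp (val i) (f i) \<in> Bs (js ! i)"
      using that l[OF that] a[OF that, of 1] X11[of i]
      by (intro Q.eval_in_H_ideal[OF f[OF that] Bs_ideal[OF jq]]) (auto simp: val_def star_value_def r_def)
    show "Q.eval_hp (val i) (f i) \<noteq> 0" using nz[OF that] by (simp add: val_def)
  qed
  obtain c e h e' where e: "\<And>i. i < r \<Longrightarrow> e i \<in> Bs (js ! i)" "\<And>i. i < r \<Longrightarrow> e' i \<in> Bs (js ! i)"
    and slot: "A.slot_prod r c (\<lambda>i. slot_value (\<kappa> (e i)) (h i) (\<kappa> (e' i)) (f i) (\<lambda>x. \<kappa> (val i x))) \<noteq> 0"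
    and kill: "\<And>y. (\<forall>i<r. y i * idem (js ! i) = y i) \<Longrightarrow> (\<exists>i<r. y i \<in> J) \<Longrightarrow> A.slot_prod r c y = 0"
    using star_slots[where val = val and f = f, OF js(1,3) chain v] unfolding r_def by blast
  \<comment> \<open>Padding raises the degree to exactly \<open>n\<close>. It must not be empty,
    since \<open>nprod []\<close> is the dummy value 0 and not a unit.\<close>
  define pad where "pad = n - 2 * k * D - (\<Sum>i<r. n1 i + 3)"
  have pad: "pad \<ge> 1" "n = 2 * k * D + (\<Sum>i<r. n1 i + 3) + pad"
    using n by (auto simp: pad_def r_def)
  define core where "core i = star_vars k (l i) (n1 i)" for i
  \<comment> \<open>The variables with first index 0 are free for the constants, since those of
    Property star are numbered from 1.\<close>
  define ext where "ext i = core i \<union> {XVar 0 0, XVar 0 1, XVar 0 2}" for i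
  have core0: "core i \<inter> {XVar 0 0, XVar 0 1, XVar 0 2} = {}" for i
    by (auto simp: core_def star_vars_def)
  define V where "V = (\<Union>i<r. Pair i ` ext i) \<union> (\<lambda>t. (r, XVar 0 t)) ` {..<pad}"
  define g where "g = (\<lambda>w. nprod (map (\<lambda>i. w (i, XVar 0 0) *
      slot_value (w (i, XVar 0 1)) (h i) (w (i, XVar 0 2)) (f i) (\<lambda>x. w (i, x))) [0..<r])
    * nprod (map (\<lambda>t. w (r, XVar 0 t)) [0..<pad]))"
  have fin_core: "finite (core i)" and card_core: "card (core i) = 2 * k * l i + n1 i" for i
    using card_star_vars by (auto simp: core_def)
  have fin_ext: "finite (ext i)" and card_ext: "card (ext i) = 2 * k * l i + (n1 i + 3)" for i
  proof -
    show "finite (ext i)" using fin_core by (simp add: ext_def)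
    have "card (ext i) = card (core i) + card {XVar 0 0, XVar 0 1, XVar 0 2}"
      unfolding ext_def using fin_core core0 by (intro card_Un_disjoint) auto
    then show "card (ext i) = 2 * k * l i + (n1 i + 3)" using card_core by simp
  qed
  have g: "g \<in> A.hfunctions V"
    unfolding g_def V_def
  proof (rule A.hfunctions_mult)
    show "(\<lambda>w. nprod (map (\<lambda>i. w (i, XVar 0 0) *
        slot_value (w (i, XVar 0 1)) (h i) (w (i, XVar 0 2)) (f i) (\<lambda>x. w (i, x))) [0..<r]))
        \<in> A.hfunctions (\<Union>i<r. Pair i ` ext i)"
    proof (rule A.hfunctions_nprod[OF r])
      show "(\<lambda>w. w (i, XVar 0 0) * slot_value (w (i, XVar 0 1)) (h i) (w (i, XVar 0 2)) (f i) (\<lambda>x. w (i, x)))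
          \<in> A.hfunctions (Pair i ` ext i)" if "i < r" for i
        unfolding ext_def using core0[of i] unfolding core_def
        by (intro slot_hfunction[OF fi[OF that]]) auto
    qed auto
    have "(\<lambda>w. nprod (map (\<lambda>t. w (r, XVar 0 t)) [0..<pad])) \<in> A.hfunctions (\<Union>t<pad. {(r, XVar 0 t)})"
      by (rule A.hfunctions_nprod[OF pad(1) A.hfunctions_var]) auto
    moreover have "(\<Union>t<pad. {(r, XVar 0 t)}) = (\<lambda>t. (r, XVar 0 t)) ` {..<pad}" by auto
    ultimately show "(\<lambda>w. nprod (map (\<lambda>t. w (r, XVar 0 t)) [0..<pad]))
        \<in> A.hfunctions ((\<lambda>t. (r, XVar 0 t)) ` {..<pad})" by simp
  qed auto
  have finV: "finite V" using fin_ext by (auto simp: V_def)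
  have cardV: "card V = n"
  proof -
    have "card V = card (\<Union>i<r. Pair i ` ext i) + card ((\<lambda>t. (r, XVar 0 t)) ` {..<pad})"
      unfolding V_def using fin_ext by (intro card_Un_disjoint) auto
    also have "card ((\<lambda>t. (r, XVar 0 t)) ` {..<pad}) = pad"
      by (subst card_image) (auto simp: inj_on_def)
    also have "card (\<Union>i<r. Pair i ` ext i) = (\<Sum>i<r. card (Pair i ` ext i))"
      using fin_ext by (intro card_UN_disjoint) auto
    also have "\<dots> = (\<Sum>i<r. 2 * k * l i + (n1 i + 3))"
      by (intro sum.cong refl) (simp add: card_image inj_on_def card_ext)
    also have "\<dots> = 2 * k * D + (\<Sum>i<r. n1 i + 3)"
      unfolding D r_def by (simp add: sum.distrib sum_distrib_left)
    finally show ?thesis using pad(2) by simp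
  qed
  \<comment> \<open>The letters \<open>0, ..., D - 1\<close> number the basis vectors of all
    summands of the chain; \<open>\<theta>\<close> is this numbering.\<close>
  define Sg where "Sg = (SIGMA i:{..<r}. {1..l i})"
  have "card Sg = card {..<D}" by (simp add: Sg_def D r_def)
  then obtain \<theta> where \<theta>: "bij_betw \<theta> Sg {..<D}"
    using finite_same_card_bij[of Sg "{..<D}"] by (auto simp: Sg_def)
  define \<theta>i where "\<theta>i = inv_into Sg \<theta>"
  have \<theta>i: "\<theta>i t \<in> Sg" "\<theta> (\<theta>i t) = t" if "t < D" for t
    using that \<theta> unfolding \<theta>i_def by (auto simp: bij_betw_def inv_into_into f_inv_into_f)
  have \<theta>i': "\<theta>i (\<theta> x) = x" "\<theta> x < D" if "x \<in> Sg" for x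
    using that \<theta> unfolding \<theta>i_def by (auto simp: bij_betw_def)
  define X where "X = {(i, XVar c j) |i c j. i < r \<and> c \<in> {1..2*k} \<and> j \<in> {1..l i}}"
  \<comment> \<open>Columns are counted from 0 here and from 1 in the variables. The value at a
    \<open>z\<close> variable is a dummy outside \<open>X\<close>.\<close>
  define \<xi> where "\<xi> x = (case x of (i, XVar c j) \<Rightarrow> (c - 1, \<theta> (i, j)) | (i, ZVar m) \<Rightarrow> (0, 0))" for x
  have \<xi>: "bij_betw \<xi> X ({..<2 * s * b} \<times> {..<D})"
    unfolding bij_betw_def
  proof
    show "inj_on \<xi> X"
    proof (rule inj_onI)
      fix x y assume xy: "x \<in> X" "y \<in> X" "\<xi> x = \<xi> y"
      then obtain i c j i' c' j' where x: "x = (i, XVar c j)" "i < r" "c \<in> {1..2*k}" "j \<in> {1..l i}"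
        and y: "y = (i', XVar c' j')" "i' < r" "c' \<in> {1..2*k}" "j' \<in> {1..l i'}"
        unfolding X_def by blast
      have "c - 1 = c' - 1" "\<theta> (i, j) = \<theta> (i', j')" using xy(3) x(1) y(1) by (auto simp: \<xi>_def)
      moreover have "(i, j) \<in> Sg" "(i', j') \<in> Sg" using x y by (auto simp: Sg_def)
      ultimately have "c = c'" "(i, j) = (i', j')" using x(3) y(3) \<theta>i'(1) by (auto, metis prod.inject, metis prod.inject)
      then show "x = y" using x(1) y(1) by simp
    qed
    show "\<xi> ` X = {..<2 * s * b} \<times> {..<D}"
    proof (intro equalityI subsetI)
      fix w assume "w \<in> \<xi> ` X"
      then obtain i c j where x: "w = (c - 1, \<theta> (i, j))" "i < r" "c \<in> {1..2*k}" "j \<in> {1..l i}"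
        unfolding X_def \<xi>_def by auto
      then have "\<theta> (i, j) < D" by (intro \<theta>i'(2)) (auto simp: Sg_def)
      then show "w \<in> {..<2 * s * b} \<times> {..<D}" using x k by auto
    next
      fix w assume w: "w \<in> {..<2 * s * b} \<times> {..<D}"
      obtain c t where ct: "w = (c, t)" by (cases w)
      obtain i j where ij: "\<theta>i t = (i, j)" by (cases "\<theta>i t")
      have "t < D" using w ct by simp
      from \<theta>i[OF this] have "(i, j) \<in> Sg" "\<theta> (i, j) = t" using ij by auto
      then have "(i, XVar (Suc c) j) \<in> X" "\<xi> (i, XVar (Suc c) j) = w"
        using w ct k by (auto simp: X_def \<xi>_def Sg_def)
      then show "w \<in> \<xi> ` X" by blast
    qed
  qed
  have XV: "X \<subseteq> V"
    by (auto simp: X_def V_def ext_def core_def star_vars_def)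
  define \<alpha> where "\<alpha> t = \<kappa> (a (fst (\<theta>i t)) (snd (\<theta>i t)))" for t
  \<comment> \<open>All padding variables receive the idempotent of the last slot, which the last
    slot absorbs on its right. The other values are the constants of the slots and the
    \<open>z\<close> values of Property star.\<close>
  define a0 where "a0 x = (case x of (i, y) \<Rightarrow> if i = r then idem (js ! (r - 1)) else
     (case y of XVar c' j \<Rightarrow> if j = 0 then c i else if j = 1 then \<kappa> (e i) else \<kappa> (e' i) | ZVar m \<Rightarrow> \<kappa> (z i m)))" for x
  define asg where "asg u x = (if x \<in> X then \<alpha> (u (\<xi> x)) else a0 x)" for u x
  define y where "y u i = slot_value (\<kappa> (e i)) (h i) (\<kappa> (e' i)) (f i) (\<lambda>x. asg u (i, x))" for u i
  have asg_ext: "asg u (i, XVar 0 0) = c i" "asg u (i, XVar 0 1) = \<kappa> (e i)" "asg u (i, XVar 0 2) = \<kappa> (e' i)"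
    if "i < r" for u i
    using that by (auto simp: asg_def X_def a0_def)
  have asg_pad: "asg u (r, w) = idem (js ! (r - 1))" for u w
    by (auto simp: asg_def X_def a0_def)
  have asg_X: "asg u (i, XVar c' j) = \<alpha> (u (c' - 1, \<theta> (i, j)))" if "i < r" "c' \<in> {1..2*k}" "j \<in> {1..l i}" for u i c' j
    using that by (auto simp: asg_def X_def \<xi>_def)
  have asg_Z: "asg u (i, ZVar m) = \<kappa> (z i m)" if "i < r" for u i m
    using that by (auto simp: asg_def X_def a0_def)
  have y_idem: "y u i * idem (js ! i) = y u i" if "i < r" for u i
    using kappa_idem(1)[OF jq[OF that] e(2)[OF that]] by (simp add: y_def slot_value_def mult.assoc)
  have g_asg: "g (asg u) = A.slot_prod r c (y u)" for u
  proof -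
    have "map (\<lambda>i. asg u (i, XVar 0 0) *
        slot_value (asg u (i, XVar 0 1)) (h i) (asg u (i, XVar 0 2)) (f i) (\<lambda>x. asg u (i, x))) [0..<r]
      = map (\<lambda>i. c i * y u i) [0..<r]"
      by (rule map_cong[OF refl]) (simp add: asg_ext[simplified] y_def)
    moreover have "nprod (map (\<lambda>t. asg u (r, XVar 0 t)) [0..<pad]) = idem (js ! (r - 1))"
      unfolding asg_pad using r by (intro nprod_idem[OF jq pad(1)]) auto
    ultimately have "g (asg u) = A.slot_prod r c (y u) * idem (js ! (r - 1))"
      by (simp only: g_def A.slot_prod_def)
    also have "\<dots> = A.slot_prod r c (y u)"
      unfolding A.slot_prod_def
    proof (rule nprod_right_absorb)
      show "last (map (\<lambda>i. c i * y u i) [0..<r]) * idem (js ! (r - 1)) = last (map (\<lambda>i. c i * y u i) [0..<r])"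
        using r y_idem[of "r - 1" u] by (simp add: last_map mult.assoc)
    qed (use r in simp)
    finally show ?thesis .
  qed
  show ?thesis
  proof (rule A.card_block_words_le_codimH[OF fdA finV cardV g XV \<xi>, where \<alpha> = \<alpha> and ?a0.0 = a0
        and G = "\<lambda>u. g (\<lambda>x. if x \<in> X then \<alpha> (u (\<xi> x)) else a0 x)"])
    show "b > 0" using b by simp
    have asg_eq: "(\<lambda>x. if x \<in> X then \<alpha> (u (\<xi> x)) else a0 x) = asg u" for u
      by (auto simp: asg_def)
    have "y snd i = slot_value (\<kappa> (e i)) (h i) (\<kappa> (e' i)) (f i) (\<lambda>x. \<kappa> (val i x))" if i: "i < r" for i
    proof -
      have "(\<lambda>w. A.eval_hp w (f i)) \<in> A.hfunctions (core i)"
        using fi[OF i] by (auto simp: A.hfunctions_def core_def)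
      then have "A.eval_hp (\<lambda>x. asg snd (i, x)) (f i) = A.eval_hp (\<lambda>x. \<kappa> (val i x)) (f i)"
      proof (rule A.hfunctions_cong)
        fix x assume "x \<in> core i"
        then consider (X) c' j where "x = XVar c' j" "c' \<in> {1..2*k}" "j \<in> {1..l i}" | (Z) m where "x = ZVar m"
          by (auto simp: core_def star_vars_def)
        then show "asg snd (i, x) = \<kappa> (val i x)"
        proof cases
          case X
          then have "(i, j) \<in> Sg" using i by (auto simp: Sg_def)
          then show ?thesis
            unfolding X(1) asg_X[OF i X(2,3)] by (simp add: \<alpha>_def \<theta>i'(1) val_def star_value_def)
        next
          case Z
          then show ?thesis using asg_Z[OF i] by (simp add: val_def star_value_def)
        qed
      qed
      then show ?thesis by (simp add: y_def slot_value_def)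
    qed
    then have "A.slot_prod r c (y snd)
        = A.slot_prod r c (\<lambda>i. slot_value (\<kappa> (e i)) (h i) (\<kappa> (e' i)) (f i) (\<lambda>x. \<kappa> (val i x)))"
      unfolding A.slot_prod_def by (intro arg_cong[of _ _ nprod] map_cong) auto
    then show "g (\<lambda>x. if x \<in> X then \<alpha> (snd (\<xi> x)) else a0 x) \<noteq> 0"
      unfolding asg_eq g_asg using slot by simp
    fix u :: "nat \<times> nat \<Rightarrow> nat" and c0
    assume u: "\<forall>c<2 * s * b. \<forall>j<D. u (c, j) < D"
      and "g (\<lambda>x. if x \<in> X then \<alpha> (u (\<xi> x)) else a0 x) \<noteq> 0" and c0: "c0 < 2 * s * b"
    then have nz: "A.slot_prod r c (y u) \<noteq> 0" unfolding asg_eq g_asg by simp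
    have c0k: "Suc c0 \<in> {1..2*k}" using c0 k by simp
    have notJ: "y u i \<notin> J" if "i < r" for i
      using kill[of "y u"] y_idem nz that by blast
    \<comment> \<open>If a variable of \<open>f i\<close> receives a vector of another summand, the
      image of the slot in the quotient lies in both summands and so is 0. The slot then lies in
      \<open>J\<close>, which maximality of the multipliers forbids.\<close>
    have block: "fst (\<theta>i (u (c0, \<theta> (i, j)))) = i" if i: "i < r" and j: "j \<in> {1..l i}" for i j
    proof (rule ccontr)
      obtain i' j' where ij': "\<theta>i (u (c0, \<theta> (i, j))) = (i', j')" by (cases "\<theta>i (u (c0, \<theta> (i, j)))")
      assume "\<not> ?thesis"
      then have ne: "i' \<noteq> i" using ij' by simp
      have "\<theta> (i, j) < D" using i j by (intro \<theta>i'(2)) (auto simp: Sg_def)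
      then have "u (c0, \<theta> (i, j)) < D" using u c0 by blast
      from \<theta>i(1)[OF this] have i'j': "i' < r" "j' \<in> {1..l i'}" unfolding ij' by (auto simp: Sg_def)
      let ?x = "XVar (Suc c0) j"
      have x: "?x \<in> star_vars k (l i) (n1 i)" using c0k j by (auto simp: star_vars_def)
      have "p (asg u (i, ?x)) = a i' j'"
        using asg_X[OF i c0k j, of u] ij' by (simp add: \<alpha>_def p_kappa)
      then have px: "p (asg u (i, ?x)) \<in> Bs (js ! i')" using a[of i' j'] i'j' by (simp add: r_def)
      have "Q.eval_hp (\<lambda>x. p (asg u (i, x))) (f i) \<in> Bs (js ! i')"
        using Q.eval_in_H_ideal[where a = "\<lambda>x. p (asg u (i, x))", OF fi[OF i] Bs_ideal[OF jq[OF i'j'(1)]] x px] .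
      then have "p (y u i) \<in> Bs (js ! i')"
        unfolding y_def p_slot_value
        by (intro Bs_mult_left Bs_mult_right Bs_act jq i'j'(1))
      moreover have "p (y u i) \<in> Bs (js ! i)"
        unfolding y_def p_slot_value p_kappa by (intro Bs_mult_right jq i e(1))
      moreover have "js ! i \<noteq> js ! i'"
        using js(2) i i'j'(1) ne nth_eq_iff_index_eq unfolding r_def by metis
      ultimately have "p (y u i) = 0"
        using Bs_disjoint[OF jq[OF i] jq[OF i'j'(1)]] by blast
      then show False using notJ[OF i] p_zero_iff by blast
    qed
    show "inj_on (\<lambda>j. u (c0, j)) {..<D}"
    proof (rule inj_onI, rule ccontr)
      fix t1 t2 assume t: "t1 \<in> {..<D}" "t2 \<in> {..<D}" "u (c0, t1) = u (c0, t2)" "t1 \<noteq> t2"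
      obtain i1 j1 where 1: "\<theta>i t1 = (i1, j1)" by (cases "\<theta>i t1")
      obtain i2 j2 where 2: "\<theta>i t2 = (i2, j2)" by (cases "\<theta>i t2")
      have t1: "t1 = \<theta> (i1, j1)" "i1 < r" "j1 \<in> {1..l i1}" using \<theta>i[of t1] t(1) 1 by (auto simp: Sg_def)
      have t2: "t2 = \<theta> (i2, j2)" "i2 < r" "j2 \<in> {1..l i2}" using \<theta>i[of t2] t(2) 2 by (auto simp: Sg_def)
      have i: "i2 = i1" using block[OF t1(2,3)] block[OF t2(2,3)] t(3) t1(1) t2(1) by simp
      have j: "j1 \<noteq> j2" using t(4) t1(1) t2(1) i by blast
      have "asg u (i1, XVar (Suc c0) j1) = asg u (i1, XVar (Suc c0) j2)"
        using asg_X[OF t1(2) c0k t1(3), of u] asg_X[OF t1(2) c0k, of j2 u] t2(3) i t(3) t1(1) t2(1) by simp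
      then have "A.eval_hp (\<lambda>x. asg u (i1, x)) (f i1) = 0"
        using alt[of i1 "Suc c0"] t1(2,3) t2(3) i j c0k
        by (intro A.eval_alternating_eq[where x = "XVar (Suc c0) j1" and y = "XVar (Suc c0) j2"]) (auto simp: r_def)
      then have "y u i1 = 0" by (simp add: y_def slot_value_def A.act_zero)
      then have "A.slot_prod r c (y u) = 0" using t1(2) by (intro A.slot_prod_zero) auto
      then show False using nz by simp
    qed
  qed (rule refl)
qed

end

section \<open>The two bounds\<close>

text \<open>Each such set is the image of a map from \<open>{..<s}\<close> to \<open>{0..n}\<close>
  with the filler 0 removed.\<close>

lemma card_small_subsets:
  "card {P. P \<subseteq> {1..n} \<and> card P < s} \<le> (n + 1) ^ s"
proof -
  let ?F = "{..<s} \<rightarrow>\<^sub>E {0..n}"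
  have "{P. P \<subseteq> {1..n} \<and> card P < s} \<subseteq> (\<lambda>f. f ` {..<s} - {0}) ` ?F"
  proof
    fix P assume "P \<in> {P. P \<subseteq> {1..n} \<and> card P < s}"
    then have P: "P \<subseteq> {1..n}" "card P < s" by auto
    then obtain h where h: "bij_betw h {0..<card P} P"
      using ex_bij_betw_nat_finite finite_subset by blast
    define f where "f = (\<lambda>j\<in>{..<s}. if j < card P then h j else 0)"
    have "h j \<in> {0..n}" if "j < card P" for j
    proof -
      have "h j \<in> P" using h that by (auto simp: bij_betw_def)
      then show ?thesis using P(1) by auto
    qed
    then have "f \<in> ?F" by (auto simp: f_def)
    moreover have "f ` {..<s} - {0} = P"
    proof (intro equalityI subsetI)
      fix y assume "y \<in> f ` {..<s} - {0}"
      then obtain j where j: "j < s" "y = f j" "y \<noteq> 0" by blast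
      then have "j < card P" "y = h j" by (auto simp: f_def split: if_splits)
      then show "y \<in> P" using h by (auto simp: bij_betw_def)
    next
      fix y assume y: "y \<in> P"
      then have "y \<in> h ` {0..<card P}" using h by (simp add: bij_betw_def)
      then obtain j where j: "j < card P" "y = h j" by auto
      then have "f j = y" "j \<in> {..<s}" using P(2) by (auto simp: f_def)
      moreover have "y \<noteq> 0" using y P(1) by auto
      ultimately show "y \<in> f ` {..<s} - {0}" by blast
    qed
    ultimately show "P \<in> (\<lambda>f. f ` {..<s} - {0}) ` ?F" by blast
  qed
  then have "card {P. P \<subseteq> {1..n} \<and> card P < s} \<le> card ?F"
    by (intro surj_card_le) (auto intro: finite_PiE)
  then show ?thesis by (simp add: card_PiE)
qed

lemma card_PiE_two_sets:
  assumes "P \<subseteq> {1..n}" "card S \<le> M" "card U \<le> d" "d \<ge> 1" "M \<ge> 1" "card P \<le> s"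
  shows "card (\<Pi>\<^sub>E x\<in>{1..n}. if x \<in> P then S else U) \<le> M ^ s * d ^ n"
proof -
  have "card (\<Pi>\<^sub>E x\<in>{1..n}. if x \<in> P then S else U) = (\<Prod>x\<in>{1..n}. card (if x \<in> P then S else U))"
    by (simp add: card_PiE)
  also have "\<dots> \<le> (\<Prod>x\<in>{1..n}. if x \<in> P then M else d)"
    using assms by (intro prod_mono) auto
  also have "\<dots> = M ^ card P * d ^ card ({1..n} - P)"
    using assms(1) by (subst prod.If_cases) (auto simp: Int_absorb1 Diff_eq)
  also have "\<dots> \<le> M ^ s * d ^ n"
  proof (intro mult_mono power_increasing)
    show "card ({1..n} - P) \<le> n" using card_mono[of "{1..n}" "{1..n} - P"] by simp
  qed (use assms in auto)
  finally show ?thesis .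
qed

context H_quotient
begin

text \<open>\<open>C\<close> is the sum of the \<open>n0 i + 3\<close> plus 1. It works for all
  \<open>b\<close> and \<open>s\<close> at once because the bound on the number of \<open>z\<close>
  variables is chosen in Property star before \<open>k\<close>.\<close>

lemma lower_bound:
  assumes js: "js \<noteq> []" "distinct js" "set js \<subseteq> {1..q}"
    and chain: "A.plus_chain (map Hk js) \<noteq> {0}"
    and D: "D = Q.dim (\<Union>i\<in>set js. Bs i)"
  shows "\<exists>C. \<forall>b\<ge>1. \<forall>s\<ge>1. \<forall>n\<ge>2 * (s * b) * D + C. card (block_words D b (2 * s)) \<le> A.codimH n"
proof -
  define P where "P i l a n0 \<longleftrightarrow> Q.is_basis_family (Bs i) l a \<and> (\<forall>k\<ge>1. \<exists>n1\<le>n0. \<exists>f z.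
    f \<in> multilinear_hpolys scaleH (star_vars k l n1) \<and>
    (\<forall>c\<in>{1..2*k}. alternating_in scaleH {XVar c j |j. j \<in> {1..l}} f) \<and>
    (\<forall>m\<in>{1..n1}. z m \<in> Bs i) \<and> Q.eval_hp (star_value a z) f \<noteq> 0)" for i l a n0
  let ?r = "length js"
  have jq: "js ! i \<in> {1..q}" if "i < ?r" for i using js(3) that nth_mem by blast
  have "\<forall>i\<in>{..<?r}. \<exists>X. case X of (l, a, n0) \<Rightarrow> P (js ! i) l a n0"
  proof
    fix i assume "i \<in> {..<?r}"
    then have "\<exists>l a n0. P (js ! i) l a n0" unfolding P_def using star_poly[OF jq] by simp
    then show "\<exists>X. case X of (l, a, n0) \<Rightarrow> P (js ! i) l a n0" by auto
  qed
  from bchoice[OF this] obtain X where X: "\<forall>i\<in>{..<?r}. case X i of (l, a, n0) \<Rightarrow> P (js ! i) l a n0"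
    by (elim exE)
  define l a n0 where "l i = fst (X i)" and "a i = fst (snd (X i))" and "n0 i = snd (snd (X i))" for i
  have P: "P (js ! i) (l i) (a i) (n0 i)" if "i < ?r" for i
    using X that by (auto simp: l_def a_def n0_def split: prod.splits)
  have basis: "inj_on (a i) {1..l i}" "Q.independent (a i ` {1..l i})" "Q.span (a i ` {1..l i}) = Bs (js ! i)"
    if "i < ?r" for i
    using P[OF that] by (auto simp: P_def Q.is_basis_family_def)
  have dim: "Q.dim (Bs (js ! i)) = l i" if "i < ?r" for i
    using Q.dim_eq_card[of "a i ` {1..l i}" "Bs (js ! i)"] basis[OF that]
      Q.span_eq_iff[THEN iffD2, OF Bs_subspace[OF jq[OF that]]]
    by (simp add: card_image)
  have a: "a i j \<in> Bs (js ! i)" if "i < ?r" "j \<in> {1..l i}" for i j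
    using basis(3)[OF that(1)] Q.span_superset[of "a i ` {1..l i}"] that(2) by blast
  have l1: "l i \<ge> 1" if "i < ?r" for i
  proof (rule ccontr)
    assume "\<not> l i \<ge> 1"
    then have "Bs (js ! i) = {0}" using basis(3)[OF that] by (simp add: not_le)
    then show False using Bs_simple[OF jq[OF that]] by (auto simp: Q.H_simple_def)
  qed
  have Dsum: "D = (\<Sum>i<?r. l i)"
  proof -
    have "D = (\<Sum>i\<in>set js. Q.dim (Bs i))" unfolding D by (rule dim_Union[OF js(3)])
    also have "\<dots> = sum_list (map (\<lambda>i. Q.dim (Bs i)) js)"
      using js(2) by (simp add: sum_list_distinct_conv_sum_set)
    also have "\<dots> = (\<Sum>i<?r. Q.dim (Bs (js ! i)))"
      by (simp add: sum_list_sum_nth atLeast0LessThan)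
    also have "\<dots> = (\<Sum>i<?r. l i)" using dim by (intro sum.cong) auto
    finally show ?thesis .
  qed
  show ?thesis
  proof (intro exI allI impI)
    fix b s n :: nat
    assume b: "b \<ge> 1" and s: "s \<ge> 1" and n: "n \<ge> 2 * (s * b) * D + ((\<Sum>i<?r. n0 i + 3) + 1)"
    let ?k = "s * b"
    have k: "?k \<ge> 1" using b s by simp
    define R where "R i n1 f z \<longleftrightarrow> n1 \<le> n0 i \<and> f \<in> multilinear_hpolys scaleH (star_vars ?k (l i) n1) \<and>
      (\<forall>c\<in>{1..2*?k}. alternating_in scaleH {XVar c j |j. j \<in> {1..l i}} f) \<and>
      Q.eval_hp (star_value (a i) z) f \<noteq> 0" for i n1 f z
    have "\<forall>i\<in>{..<?r}. \<exists>Y. case Y of (n1, f, z) \<Rightarrow> R i n1 f z"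
    proof
      fix i assume "i \<in> {..<?r}"
      then have "P (js ! i) (l i) (a i) (n0 i)" using P by simp
      from this[unfolded P_def, THEN conjunct2, THEN spec, THEN mp, OF k]
      obtain n1 f z where "n1 \<le> n0 i" "f \<in> multilinear_hpolys scaleH (star_vars ?k (l i) n1)"
        "\<forall>c\<in>{1..2*?k}. alternating_in scaleH {XVar c j |j. j \<in> {1..l i}} f"
        "Q.eval_hp (star_value (a i) z) f \<noteq> 0"
        by (elim exE conjE)
      then have "\<exists>n1 f z. R i n1 f z" unfolding R_def by (intro exI conjI)
      then show "\<exists>Y. case Y of (n1, f, z) \<Rightarrow> R i n1 f z" by auto
    qed
    from bchoice[OF this] obtain Y where Y: "\<forall>i\<in>{..<?r}. case Y i of (n1, f, z) \<Rightarrow> R i n1 f z"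
      by (elim exE)
    define n1 f z where "n1 i = fst (Y i)" and "f i = fst (snd (Y i))" and "z i = snd (snd (Y i))" for i
    have R: "R i (n1 i) (f i) (z i)" if "i < ?r" for i
      using Y that by (auto simp: n1_def f_def z_def split: prod.splits)
    have "(\<Sum>i<?r. n1 i + 3) \<le> (\<Sum>i<?r. n0 i + 3)"
      using R by (intro sum_mono) (auto simp: R_def)
    then have n': "n \<ge> 2 * ?k * D + (\<Sum>i<?r. n1 i + 3) + 1" using n by linarith
    show "card (block_words D b (2 * s)) \<le> A.codimH n"
      using R by (intro lower_bound_aux[OF js chain b s refl Dsum l1 a _ _ _ n']) (auto simp: R_def)
  qed
qed

text \<open>A nonzero value comes from a nonzero monomial. H-invariance of \<open>J\<close> keeps
  its entries from \<open>J\<close> in \<open>J\<close>, so they are fewer than \<open>s\<close>;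
  \<open>n \<ge> s\<close> then leaves an entry outside. In the label list 0 marks the entries from
  \<open>J\<close>, which is possible since the summands are numbered from 1.\<close>

lemma tuple_labels:
  assumes f: "f \<in> PH scaleH n" and t: "A.eval_hp t f \<noteq> 0"
    and s: "A.nilpotency_bound J s" and n: "n \<ge> s"
    and lab: "\<And>x. x \<in> {1..n} \<Longrightarrow> t x \<notin> J \<Longrightarrow> lab x \<in> {1..q} \<and> t x \<in> \<kappa> ` Bs (lab x)"
  shows "card {x \<in> {1..n}. t x \<in> J} < s \<and>
    (\<exists>js. js \<noteq> [] \<and> distinct js \<and> set js = lab ` {x \<in> {1..n}. t x \<notin> J} \<and>
      A.plus_chain (map Hk js) \<noteq> {0})"
proof -
  have "\<exists>m. distinct (map fst m) \<and> set (map fst m) = {1..n} \<and> A.monomial_value m t \<noteq> 0"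
  proof (rule ccontr)
    assume "\<not> ?thesis"
    then have "A.eval_hp t f \<in> {0}"
      by (intro A.hfunctions_subspace[OF A.PH_hfunctions[OF f]]) auto
    then show False using t by simp
  qed
  then obtain m where m: "distinct (map fst m)" "set (map fst m) = {1..n}" "A.monomial_value m t \<noteq> 0"
    by blast
  let ?us = "map (\<lambda>(x, h). actA h (t x)) m"
  have us: "nprod ?us \<noteq> 0" using m(3) by (simp add: A.monomial_value_def)
  have J_act: "actA h x \<in> J" if "x \<in> J" for h x
    using that A.JH_nilpotent_H_ideal[OF fdA] by (auto simp: A.H_ideal_def A.H_invariant_def)
  have "card {x \<in> {1..n}. t x \<in> J} = length (filter (\<lambda>x. t x \<in> J) (map fst m))"
    unfolding distinct_card[OF distinct_filter[OF m(1)], symmetric] set_filter m(2) ..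
  also have "\<dots> = length (filter (\<lambda>(x, h). t x \<in> J) m)"
    by (simp add: filter_map comp_def case_prod_unfold)
  also have "\<dots> \<le> length (filter (\<lambda>x. x \<in> J) ?us)"
    using J_act by (induction m) auto
  also have "\<dots> < s" using s us by (auto simp: A.nilpotency_bound_def not_le[symmetric])
  finally have small: "card {x \<in> {1..n}. t x \<in> J} < s" .
  let ?ls = "map (\<lambda>(x, h). if t x \<in> J then 0 else lab x) m"
  let ?js = "remdups (filter (\<lambda>i. i \<noteq> 0) ?ls)"
  have lab0: "lab x \<noteq> 0" if "x \<in> {1..n}" "t x \<notin> J" for x using lab[OF that] by auto
  have mem: "fst y \<in> {1..n}" if "y \<in> set m" for y using m(2) that by force
  have set: "set ?js = lab ` {x \<in> {1..n}. t x \<notin> J}"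
  proof (intro equalityI subsetI)
    fix i assume "i \<in> set ?js"
    then show "i \<in> lab ` {x \<in> {1..n}. t x \<notin> J}" using mem by (force split: if_splits)
  next
    fix i assume "i \<in> lab ` {x \<in> {1..n}. t x \<notin> J}"
    then obtain x where x: "x \<in> {1..n}" "t x \<notin> J" "i = lab x" by blast
    then obtain h where "(x, h) \<in> set m" using m(2) by force
    then show "i \<in> set ?js" using x lab0 by force
  qed
  have "{x \<in> {1..n}. t x \<notin> J} \<noteq> {}"
  proof
    assume "{x \<in> {1..n}. t x \<notin> J} = {}"
    then have "{x \<in> {1..n}. t x \<in> J} = {1..n}" by blast
    then show False using small n by simp
  qed
  then have nonempty: "lab ` {x \<in> {1..n}. t x \<notin> J} \<noteq> {}" unfolding image_is_empty .
  have ne: "?js \<noteq> []"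
  proof
    assume "?js = []"
    then have "set ?js = {}" by (simp only: list.set)
    then show False using nonempty unfolding set by blast
  qed
  have "A.plus_chain (map Hk ?js) \<noteq> {0}"
  proof
    assume z: "A.plus_chain (map Hk ?js) = {0}"
    have "nprod ?us = 0"
    proof (rule A.nprod_zero_if_plus_chain_zero[OF A.right_linear_id, where ls = ?ls and V = Hk])
      show "?us ! j \<in> Hk (?ls ! j)" if "j < length ?us" "?ls ! j \<noteq> 0" for j
      proof -
        obtain x h where xh: "m ! j = (x, h)" by (cases "m ! j")
        have "j < length m" using that(1) by simp
        then have "x \<in> {1..n}" using mem[OF nth_mem, of j] xh by simp
        moreover have "t x \<notin> J" using that(2) \<open>j < length m\<close> xh by (auto split: if_splits)
        moreover note xh
        moreover have "t x \<in> \<kappa> ` Bs (lab x)" using lab calculation by blast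
        ultimately show ?thesis using that by (auto simp: A.H_span_def intro!: A.span_base)
      qed
      show "filter (\<lambda>i. i \<noteq> 0) ?ls \<noteq> []" using ne by auto
      show "c = 0 \<and> a * c = 0" if "c \<in> A.plus_chain (map Hk ?js)" for c a
        using that z by auto
    qed simp
    then show False using us by simp
  qed
  then show ?thesis using small ne set by (intro conjI exI[of _ ?js]) auto
qed

text \<open>A tuple with nonzero value is described by the set \<open>P\<close> of its positions in
  \<open>J\<close>, the set \<open>I\<close> of summands that occur, and its entries. The three
  counts are at most \<open>(n + 1) ^ s\<close>, \<open>2 ^ q\<close> and
  \<open>M ^ s * d ^ n\<close>; the factor \<open>card Basis\<close> accounts for the coordinates of
  a value.\<close>

lemma upper_bound:
  assumes d: "d \<ge> 1" and max: "\<And>js. js \<noteq> [] \<Longrightarrow> distinct js \<Longrightarrow> set js \<subseteq> {1..q} \<Longrightarrow>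
      A.plus_chain (map Hk js) \<noteq> {0} \<Longrightarrow> Q.dim (\<Union>i\<in>set js. Bs i) \<le> d"
  shows "\<exists>N K s. \<forall>n\<ge>N. A.codimH n \<le> K * (n + 1) ^ s * d ^ n"
proof -
  interpret fdA: finite_dimensional_vector_space scaleA Basis by (rule fdA)
  obtain BQ where "finite_dimensional_vector_space scaleQ BQ" using fdQ ..
  then interpret fdQ: finite_dimensional_vector_space scaleQ BQ .
  interpret K: Vector_Spaces.linear scaleQ scaleA \<kappa> by (rule kappa_linear)
  obtain s where s: "A.nilpotency_bound J s"
    using A.nilpotency_bound_exists[OF J_ideal J_nilpotent] ..
  have "\<exists>b. b \<subseteq> Bs i \<and> Q.independent b \<and> Bs i \<subseteq> Q.span b \<and> card b = Q.dim (Bs i)" for i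
    by (rule Q.basis_exists[of "Bs i"]) (intro exI conjI)
  then have "\<forall>i. \<exists>b. b \<subseteq> Bs i \<and> Q.independent b \<and> Bs i \<subseteq> Q.span b \<and> card b = Q.dim (Bs i)"
    by (intro allI)
  from choice[OF this] obtain bs where
    bs: "\<forall>i. bs i \<subseteq> Bs i \<and> Q.independent (bs i) \<and> Bs i \<subseteq> Q.span (bs i) \<and> card (bs i) = Q.dim (Bs i)"
    by (elim exE)
  have bs': "bs i \<subseteq> Bs i" "Q.independent (bs i)" "Bs i \<subseteq> Q.span (bs i)" "card (bs i) = Q.dim (Bs i)" for i
    using bs[THEN spec, of i] by simp_all
  have fin_bs: "finite (bs i)" for i using fdQ.finiteI_independent[OF bs'(2)] .
  obtain S0 where S0: "S0 \<subseteq> J" "A.independent S0" "J \<subseteq> A.span S0"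
    by (rule A.maximal_independent_subset)
  have fin_S0: "finite S0" using fdA.finiteI_independent[OF S0(2)] .
  define C where "C I = (\<Union>i\<in>I. \<kappa> ` bs i)" for I
  define S where "S = S0 \<union> C {1..q}"
  have finC: "finite (C I)" if "finite I" for I using that fin_bs by (simp add: C_def)
  have finS: "finite S" using fin_S0 finC by (simp add: S_def)
  have spanS: "A.span S = UNIV"
  proof -
    have kS: "\<kappa> x \<in> A.span S" if "i \<in> {1..q}" "x \<in> Bs i" for i x
    proof -
      have "x \<in> Q.span (bs i)" using bs'(3) that(2) by blast
      then have "\<kappa> x \<in> A.span (\<kappa> ` bs i)" unfolding K.span_image by (rule imageI)
      moreover have "\<kappa> ` bs i \<subseteq> S" using that(1) by (auto simp: S_def C_def)
      ultimately show ?thesis using A.span_mono by blast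
    qed
    have "x \<in> A.span S" for x
    proof -
      obtain b where b: "\<forall>i\<in>{1..q}. b i \<in> Bs i" "p x = (\<Sum>i\<in>{1..q}. b i)" using Bs_decompose by blast
      have "\<kappa> (p x) = (\<Sum>i\<in>{1..q}. \<kappa> (b i))" unfolding b(2) by (rule K.sum)
      then have "\<kappa> (p x) \<in> A.span S" using b(1) kS by (auto intro: A.span_sum)
      moreover have "x - \<kappa> (p x) \<in> J" by (rule diff_in_J) (simp add: p_kappa)
      then have "x - \<kappa> (p x) \<in> A.span S" using S0(3) A.span_mono[of S0 S] by (auto simp: S_def)
      ultimately have "\<kappa> (p x) + (x - \<kappa> (p x)) \<in> A.span S" by (rule A.span_add)
      then show ?thesis by simp
    qed
    then show ?thesis by blast
  qed
  define good where "good I \<longleftrightarrow> I \<subseteq> {1..q} \<and> (\<exists>js. js \<noteq> [] \<and> distinct js \<and> set js = I \<and>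
      A.plus_chain (map Hk js) \<noteq> {0})" for I
  have cardC: "card (C I) \<le> d" if gd: "good I" for I
  proof -
    obtain js where js: "js \<noteq> []" "distinct js" "set js = I" "A.plus_chain (map Hk js) \<noteq> {0}"
      and I: "I \<subseteq> {1..q}" using gd unfolding good_def by blast
    have "finite I" using I finite_subset by blast
    then have "card (C I) \<le> (\<Sum>i\<in>I. card (\<kappa> ` bs i))" unfolding C_def by (rule card_UN_le)
    also have "\<dots> \<le> (\<Sum>i\<in>I. Q.dim (Bs i))"
      using card_image_le[OF fin_bs, of \<kappa>] unfolding bs'(4) by (intro sum_mono)
    also have "\<dots> = Q.dim (\<Union>i\<in>I. Bs i)" using dim_Union[OF I] by simp
    also have "\<dots> \<le> d" using max[OF js(1,2) _ js(4)] js(3) I by simp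
    finally show ?thesis .
  qed
  \<comment> \<open>The added 1 makes \<open>M\<close> positive, so that \<open>M ^ card P\<close>
    is at most \<open>M ^ s\<close>.\<close>
  define M where "M = card S + 1"
  have "A.codimH n \<le> (2 ^ q * M ^ s * card Basis) * (n + 1) ^ s * d ^ n" if n: "n \<ge> s" for n
  proof -
    let ?Ps = "{P. P \<subseteq> {1..n} \<and> card P < s}"
    let ?Is = "{I. good I}"
    let ?T = "\<lambda>(P, I). \<Pi>\<^sub>E x\<in>{1..n}. if x \<in> P then S else C I"
    let ?U = "\<Union>X\<in>?Ps \<times> ?Is. ?T X"
    have Is: "?Is \<subseteq> Pow {1..q}" by (auto simp: good_def)
    have finIs: "finite ?Is" using Is finite_subset by blast
    have finPs: "finite ?Ps" by (rule finite_subset[of _ "Pow {1..n}"]) auto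
    have cardIs: "card ?Is \<le> 2 ^ q" using card_mono[OF _ Is] by (simp add: card_Pow)
    have fin_T: "finite (?T X)" if "X \<in> ?Ps \<times> ?Is" for X
    proof -
      obtain P I where X: "X = (P, I)" by (cases X)
      then have "good I" using that by simp
      then have "finite I" using finite_subset unfolding good_def by blast
      then have "finite (if x \<in> P then S else C I)" for x using finS finC by simp
      then have "finite (\<Pi>\<^sub>E x\<in>{1..n}. if x \<in> P then S else C I)"
        by (intro finite_PiE finite_atLeastAtMost)
      then show ?thesis unfolding X prod.case .
    qed
    have finU: "finite ?U" by (intro finite_UN_I finite_cartesian_product finPs finIs fin_T)
    have "card ?U \<le> (\<Sum>X\<in>?Ps \<times> ?Is. card (?T X))" by (intro card_UN_le finite_cartesian_product finPs finIs)
    also have "\<dots> \<le> (\<Sum>X\<in>?Ps \<times> ?Is. M ^ s * d ^ n)"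
    proof (intro sum_mono)
      fix X assume X: "X \<in> ?Ps \<times> ?Is"
      obtain P I where PI: "X = (P, I)" by (cases X)
      have "card (\<Pi>\<^sub>E x\<in>{1..n}. if x \<in> P then S else C I) \<le> M ^ s * d ^ n"
      proof (rule card_PiE_two_sets)
        show "P \<subseteq> {1..n}" "card P \<le> s" using X PI by simp_all
        have "good I" using X PI by simp
        then show "card (C I) \<le> d" by (rule cardC)
        show "d \<ge> 1" by (rule d)
      qed (simp_all add: M_def)
      then show "card (?T X) \<le> M ^ s * d ^ n" unfolding PI prod.case .
    qed
    also have "\<dots> = card ?Ps * card ?Is * (M ^ s * d ^ n)" by (simp add: card_cartesian_product)
    also have "\<dots> \<le> (n + 1) ^ s * 2 ^ q * (M ^ s * d ^ n)"
      by (intro mult_right_mono mult_mono card_small_subsets cardIs) auto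
    finally have U: "card ?U \<le> (n + 1) ^ s * 2 ^ q * (M ^ s * d ^ n)" .
    have "A.codimH n \<le> card ?U * card Basis"
    proof (rule A.codimH_le[OF fdA finU])
      fix f a assume f: "f \<in> PH scaleH n" and zero: "\<forall>t\<in>?U. A.eval_hp t f = 0"
      show "A.eval_hp a f = 0"
      proof (rule A.PH_zero_if_zero_on_tuples[OF spanS f], rule ballI, rule ccontr)
        fix t assume t: "t \<in> {1..n} \<rightarrow>\<^sub>E S" and nz: "A.eval_hp t f \<noteq> 0"
        have "\<exists>i. i \<in> {1..q} \<and> t x \<in> \<kappa> ` bs i" if "x \<in> {1..n}" "t x \<notin> J" for x
        proof -
          have "t x \<in> S" using t that(1) by (auto simp: PiE_iff)
          then show ?thesis using that(2) S0(1) by (auto simp: S_def C_def)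
        qed
        then have "\<forall>x. \<exists>i. x \<in> {1..n} \<longrightarrow> t x \<notin> J \<longrightarrow> i \<in> {1..q} \<and> t x \<in> \<kappa> ` bs i" by blast
        from choice[OF this] obtain lab where
          lab: "\<forall>x. x \<in> {1..n} \<longrightarrow> t x \<notin> J \<longrightarrow> lab x \<in> {1..q} \<and> t x \<in> \<kappa> ` bs (lab x)"
          by (elim exE)
        let ?P = "{x \<in> {1..n}. t x \<in> J}" and ?I = "lab ` {x \<in> {1..n}. t x \<notin> J}"
        have lab': "lab x \<in> {1..q} \<and> t x \<in> \<kappa> ` Bs (lab x)" if "x \<in> {1..n}" "t x \<notin> J" for x
          using lab that bs'(1)[of "lab x"] by blast
        have "card ?P < s \<and> (\<exists>js. js \<noteq> [] \<and> distinct js \<and> set js = ?I \<and> A.plus_chain (map Hk js) \<noteq> {0})"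
          using tuple_labels[OF f nz s n lab'] .
        moreover have "?I \<subseteq> {1..q}" using lab by blast
        ultimately have "(?P, ?I) \<in> ?Ps \<times> ?Is" unfolding good_def by blast
        moreover have "t \<in> (\<Pi>\<^sub>E x\<in>{1..n}. if x \<in> ?P then S else C ?I)"
        proof (rule PiE_I)
          fix x assume x: "x \<in> {1..n}"
          show "t x \<in> (if x \<in> ?P then S else C ?I)"
          proof (cases "t x \<in> J")
            case True
            then show ?thesis using x t by (auto simp: PiE_iff)
          next
            case False
            then have "lab x \<in> ?I" "t x \<in> \<kappa> ` bs (lab x)" using x lab by auto
            then have "t x \<in> C ?I" unfolding C_def by blast
            then show ?thesis using False by simp
          qed
        qed (use t in \<open>auto simp: PiE_iff extensional_def\<close>)
        ultimately have "t \<in> ?U" by blast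
        then show False using zero nz by blast
      qed
    qed
    also have "\<dots> \<le> (n + 1) ^ s * 2 ^ q * (M ^ s * d ^ n) * card Basis"
      using U by (rule mult_right_mono) simp
    finally show ?thesis by (simp add: ac_simps)
  qed
  then show ?thesis by blast
qed

end

section \<open>The limit\<close>

lemma tendsto_root_poly_times_power:
  assumes "K > 0"
  shows "(\<lambda>n. root n (K * real n ^ s * real d ^ n)) \<longlonglongrightarrow> real d"
proof -
  have "(\<lambda>n. root n K * root n (real n) ^ s * real d) \<longlonglongrightarrow> 1 * 1 ^ s * real d"
    using assms by (intro tendsto_intros LIMSEQ_root_const LIMSEQ_root)
  moreover have "\<forall>\<^sub>F n in sequentially. root n K * root n (real n) ^ s * real d = root n (K * real n ^ s * real d ^ n)"
    using eventually_gt_at_top[of 0]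
    by eventually_elim (simp add: real_root_mult real_root_power real_root_power_cancel)
  ultimately show ?thesis by (simp add: filterlim_cong)
qed

text \<open>For the lower estimate \<open>b\<close> is fixed with \<open>d (e b)^(-1/b)\<close>
  above \<open>y\<close>. Growing \<open>n\<close> only increases the number of complete blocks,
  each of which has length \<open>d b\<close> and contributes a factor
  \<open>card (balanced_words d b)\<close>, so the rate is at least the \<open>d b\<close>-th root
  of this factor.\<close>

lemma root_tendsto_of_balanced_words:
  fixes c :: "nat \<Rightarrow> nat"
  assumes d: "d \<ge> 1"
    and up: "\<And>n. n \<ge> N \<Longrightarrow> c n \<le> K * (n + 1) ^ s * d ^ n"
    and low: "\<And>b s n. b \<ge> 1 \<Longrightarrow> s \<ge> 1 \<Longrightarrow> n \<ge> 2 * (s * b) * d + C \<Longrightarrow>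
      card (balanced_words d b) ^ (Suc (2 * s) - d) \<le> c n"
  shows "(\<lambda>n. root n (real (c n))) \<longlonglongrightarrow> real d"
proof (rule order_tendstoI)
  fix y :: real assume y: "real d < y"
  let ?K = "(real K + 1) * 2 ^ s"
  have "(\<lambda>n. root n (?K * real n ^ s * real d ^ n)) \<longlonglongrightarrow> real d"
    by (rule tendsto_root_poly_times_power) (simp add: add_nonneg_pos)
  from order_tendstoD(2)[OF this y] eventually_ge_at_top[of "max 1 N"]
  show "\<forall>\<^sub>F n in sequentially. root n (real (c n)) < y"
  proof eventually_elim
    case (elim n)
    have "real (c n) \<le> real (K * (n + 1) ^ s * d ^ n)"
      using up[of n] elim(2) by (subst of_nat_le_iff) simp
    also have "\<dots> = real K * (real n + 1) ^ s * real d ^ n" by (simp add: add.commute)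
    also have "\<dots> \<le> (real K + 1) * (2 * real n) ^ s * real d ^ n"
      using elim(2) by (intro mult_right_mono mult_mono power_mono) auto
    also have "\<dots> = ?K * real n ^ s * real d ^ n" by (simp add: power_mult_distrib)
    finally have "root n (real (c n)) \<le> root n (?K * real n ^ s * real d ^ n)"
      using elim(2) by (intro real_root_le_mono) auto
    with elim(1) show ?case by linarith
  qed
next
  fix y :: real assume y: "y < real d"
  have "(\<lambda>b. real d * (exp 1 * real b) powr (- 1 / real b)) \<longlonglongrightarrow> real d"
    by real_asymp
  from order_tendstoD(1)[OF this y] eventually_ge_at_top[of 1]
  have "\<forall>\<^sub>F b in sequentially. b \<ge> 1 \<and> y < real d * (exp 1 * real b) powr (- 1 / real b)"
    by eventually_elim simp
  then obtain b where b: "b \<ge> 1" "y < real d * (exp 1 * real b) powr (- 1 / real b)"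
    by (auto simp: eventually_sequentially)
  define k where "k = card (balanced_words d b)"
  have k: "real d ^ (d * b) / (exp 1 * real b) ^ d \<le> real k"
    unfolding k_def by (rule card_balanced_words_ge[OF b(1)])
  moreover have "real d ^ (d * b) / (exp 1 * real b) ^ d > 0" using b d by simp
  ultimately have "real k > 0" by linarith
  then have k1: "real k \<ge> 1" by (cases k) auto
  have db: "real d * real b > 0" using b d by simp
  have "real d * (exp 1 * real b) powr (- 1 / real b)
      = (real d ^ (d * b) / (exp 1 * real b) ^ d) powr (1 / (real d * real b))"
  proof -
    have "(real d ^ (d * b)) powr (1 / (real d * real b)) = real d"
      using b d by (simp add: powr_realpow[symmetric] powr_powr)
    moreover have "((exp 1 * real b) ^ d) powr (1 / (real d * real b)) = (exp 1 * real b) powr (1 / real b)"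
      using b d by (simp add: powr_realpow[symmetric] powr_powr)
    ultimately show ?thesis using b d by (simp add: powr_divide powr_minus_divide)
  qed
  also have "\<dots> \<le> real k powr (1 / (real d * real b))"
    using k b d by (intro powr_mono2) auto
  finally have yk: "y < real k powr (1 / (real d * real b))" using b(2) by linarith
  \<comment> \<open>\<open>M\<close> bounds the loss in the number of complete blocks: from the
    offset \<open>C\<close>, from rounding in \<open>t\<close>, and from the incomplete blocks,
    whose cost does not grow with \<open>n\<close>.\<close>
  define M where "M = real C / (real d * real b) + 1 + real d"
  have "(\<lambda>n. 1 / (real d * real b) - M / real n) \<longlonglongrightarrow> 1 / (real d * real b) - 0"
    by (intro tendsto_intros lim_const_over_n)
  then have "(\<lambda>n. real k powr (1 / (real d * real b) - M / real n)) \<longlonglongrightarrow> real k powr (1 / (real d * real b))"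
    using k1 by (intro tendsto_powr tendsto_const) auto
  from order_tendstoD(1)[OF this yk] eventually_ge_at_top[of "2 * b * d + C + 1"]
  show "\<forall>\<^sub>F n in sequentially. y < root n (real (c n))"
  proof eventually_elim
    case (elim n)
    define t where "t = (n - C) div (2 * b * d)"
    have pos: "2 * b * d > 0" using b d by simp
    have "2 * b * d \<le> n - C" using elim(2) by simp
    then have t1: "t \<ge> 1" unfolding t_def using pos by (simp add: Suc_le_eq div_greater_zero_iff)
    have "t * (2 * b * d) \<le> n - C" unfolding t_def by (rule div_times_less_eq_dividend)
    moreover have "C \<le> n" using elim(2) by simp
    ultimately have "2 * (t * b) * d + C \<le> n" by (simp add: algebra_simps)
    from low[OF b(1) t1 this] have c: "real k ^ (Suc (2 * t) - d) \<le> real (c n)"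
      unfolding k_def by (metis of_nat_le_iff of_nat_power)
    have "n - C < (t + 1) * (2 * b * d)"
      unfolding t_def using pos dividend_less_div_times[of "2 * b * d" "n - C"] by (simp add: algebra_simps)
    then have "real n - real C < (real t + 1) * (2 * real b * real d)"
    proof -
      assume "n - C < (t + 1) * (2 * b * d)"
      then have "real (n - C) < real ((t + 1) * (2 * b * d))" by (simp only: of_nat_less_iff)
      then show ?thesis using \<open>C \<le> n\<close> by (simp add: of_nat_diff algebra_simps)
    qed
    then have "(real n - real C) / (real d * real b) < 2 * real t + 2"
      using db by (subst pos_divide_less_eq) (auto simp: algebra_simps)
    then have e: "real n / (real d * real b) - M \<le> real (Suc (2 * t) - d)"
      unfolding M_def by (simp add: diff_divide_distrib)
    have n: "n > 0" using elim(2) by simp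
    have "y < real k powr (1 / (real d * real b) - M / real n)" by (rule elim(1))
    also have "\<dots> = (real k powr (real n / (real d * real b) - M)) powr (1 / real n)"
      using n by (simp add: powr_powr diff_divide_distrib)
    also have "\<dots> \<le> (real k powr real (Suc (2 * t) - d)) powr (1 / real n)"
      using k1 e by (intro powr_mono2 powr_mono) auto
    also have "\<dots> = (real k ^ (Suc (2 * t) - d)) powr (1 / real n)"
      using k1 by (simp add: powr_realpow)
    also have "\<dots> \<le> real (c n) powr (1 / real n)"
      using c k1 by (intro powr_mono2) auto
    also have "\<dots> = root n (real (c n))"
      using n by (simp add: root_powr_inverse)
    finally show ?case .
  qed
qed

context H_quotient
begin

text \<open>The maximum that defines \<open>d\<close> is taken over a nonempty set: if
  \<open>q = 0\<close> then \<open>A\<close> equals its radical and is nilpotent, and otherwise a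
  single summand is a nonzero chain.\<close>

lemma exists_chain:
  "\<exists>js. js \<noteq> [] \<and> distinct js \<and> set js \<subseteq> {1..q} \<and> A.plus_chain (map Hk js) \<noteq> {0}"
proof -
  have "q \<noteq> 0"
  proof
    assume "q = 0"
    then have "p x = 0" for x using Bs_decompose[of "p x"] by simp
    then have "J = UNIV" using p_zero_iff by blast
    then show False using J_nilpotent not_nilpotent by simp
  qed
  then have 1: "1 \<in> {1..q}" by simp
  obtain x y where xy: "x \<in> Bs 1" "x * y \<noteq> 0" using Bs_simple[OF 1] by (auto simp: Q.H_simple_def)
  have "\<kappa> x \<in> Hk 1"
    unfolding A.H_span_def
  proof (rule A.span_base, intro CollectI exI conjI)
    show "\<kappa> x = actA 1 (\<kappa> x)" by (simp only: A.act_one)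
    show "\<kappa> x \<in> \<kappa> ` Bs 1" using xy(1) by (rule imageI)
  qed
  moreover have "\<kappa> x \<noteq> 0"
  proof
    assume "\<kappa> x = 0"
    then have "x = p 0" using p_kappa[of x] by simp
    also have "p 0 = 0" using p_add[of 0 0] by simp
    finally show False using xy(2) by simp
  qed
  ultimately have "A.plus_chain (map Hk [1]) \<noteq> {0}" by auto
  then show ?thesis using 1 by (intro exI[of _ "[1]"]) auto
qed

lemma codim_limit:
  assumes d: "d = Max {Q.dim (\<Union>i\<in>set js. Bs i) |js.
      js \<noteq> [] \<and> distinct js \<and> set js \<subseteq> {1..q} \<and> A.plus_chain (map Hk js) \<noteq> {0}}"
  shows "(\<lambda>n. root n (real (A.codimH n))) \<longlonglongrightarrow> real d"
proof -
  let ?D = "{Q.dim (\<Union>i\<in>set js. Bs i) |js.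
      js \<noteq> [] \<and> distinct js \<and> set js \<subseteq> {1..q} \<and> A.plus_chain (map Hk js) \<noteq> {0}}"
  have "?D \<subseteq> (\<lambda>I. Q.dim (\<Union>i\<in>I. Bs i)) ` Pow {1..q}" by blast
  then have fin: "finite ?D" by (rule finite_subset) simp
  have "?D \<noteq> {}" using exists_chain by blast
  then have "d \<in> ?D" unfolding d using fin by (intro Max_in)
  then obtain js where js: "js \<noteq> []" "distinct js" "set js \<subseteq> {1..q}" "A.plus_chain (map Hk js) \<noteq> {0}"
    and djs: "d = Q.dim (\<Union>i\<in>set js. Bs i)" by blast
  have max: "Q.dim (\<Union>i\<in>set ls. Bs i) \<le> d"
    if "ls \<noteq> []" "distinct ls" "set ls \<subseteq> {1..q}" "A.plus_chain (map Hk ls) \<noteq> {0}" for ls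
    unfolding d using that by (intro Max_ge[OF fin]) blast
  have d1: "d \<ge> 1"
  proof -
    obtain BQ where "finite_dimensional_vector_space scaleQ BQ" using fdQ ..
    then interpret fdQ: finite_dimensional_vector_space scaleQ BQ .
    have i: "hd js \<in> set js" "hd js \<in> {1..q}" using js(1,3) hd_in_set by blast+
    obtain x y where xy: "x \<in> Bs (hd js)" "x * y \<noteq> 0"
      using Bs_simple[OF i(2)] by (auto simp: Q.H_simple_def)
    then have "x \<in> (\<Union>i\<in>set js. Bs i)" "x \<noteq> 0" using i(1) by auto
    then have "\<not> (\<Union>i\<in>set js. Bs i) \<subseteq> {0}" by blast
    then have "Q.dim (\<Union>i\<in>set js. Bs i) \<noteq> 0" unfolding fdQ.dim_eq_0 .
    then have "d \<noteq> 0" unfolding djs .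
    then show ?thesis by (cases d) simp_all
  qed
  obtain N K s where up: "\<forall>n\<ge>N. A.codimH n \<le> K * (n + 1) ^ s * d ^ n"
    using upper_bound[OF d1 max] by blast
  obtain C where low: "\<forall>b\<ge>1. \<forall>s\<ge>1. \<forall>n\<ge>2 * (s * b) * d + C. card (block_words d b (2 * s)) \<le> A.codimH n"
    using lower_bound[OF js djs] by blast
  show ?thesis
  proof (rule root_tendsto_of_balanced_words[OF d1])
    show "A.codimH n \<le> K * (n + 1) ^ s * d ^ n" if "n \<ge> N" for n using up that by blast
    show "card (balanced_words d b) ^ (Suc (2 * s) - d) \<le> A.codimH n"
      if "b \<ge> 1" "s \<ge> 1" "n \<ge> 2 * (s * b) * d + C" for b s n
    proof -
      have "card (balanced_words d b) ^ (Suc (2 * s) - d) \<le> card (block_words d b (2 * s))"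
        using that(1) d1 by (intro card_block_words_ge) auto
      also have "\<dots> \<le> A.codimH n" using low that by blast
      finally show ?thesis .
    qed
  qed
qed

end

theorem corollary7p3:
  fixes scaleH :: "'f::{alg_closed_field, field_char_0} \<Rightarrow> 'h::ring_1 \<Rightarrow> 'h"
    and scaleA :: "'f \<Rightarrow> 'a::ring \<Rightarrow> 'a"
    and actA :: "'h \<Rightarrow> 'a \<Rightarrow> 'a"
    and scaleQ :: "'f \<Rightarrow> 'q::ring \<Rightarrow> 'q"
    and actQ :: "'h \<Rightarrow> 'q \<Rightarrow> 'q"
    and p :: "'a \<Rightarrow> 'q"
    and q :: nat
    and Bs :: "nat \<Rightarrow> 'q set"
    and B :: "'q set"
    and \<kappa> :: "'q \<Rightarrow> 'a"
    and d :: nat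
  assumes "gen_H_action scaleH scaleA actA"
    and "\<exists>Basis. finite_dimensional_vector_space scaleA Basis"
    and "\<not> nilpotent_set (UNIV :: 'a set)"
    and "gen_H_action scaleH scaleQ actQ"
    and "quotient_map scaleA actA scaleQ actQ (gen_H_action.JH scaleA actA) p"
    and "assoc_algebra.internal_direct_sum scaleQ q Bs"
    and "\<And>i. i \<in> {1..q} \<Longrightarrow> gen_H_action.H_ideal scaleQ actQ UNIV (Bs i)"
    and "\<And>i. i \<in> {1..q} \<Longrightarrow> gen_H_action.H_simple scaleQ actQ (Bs i)"
    and "\<And>i. i \<in> {1..q} \<Longrightarrow> gen_H_action.property_star scaleH scaleQ actQ (Bs i)"
    and "assoc_algebra.maximal_semisimple scaleQ B"
    and "assoc_algebra.radical_complement scaleQ B"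
    and "Vector_Spaces.linear scaleQ scaleA \<kappa>"
    and "\<And>a. p (\<kappa> a) = a"
    and "\<And>a b. b \<in> B \<Longrightarrow> \<kappa> (b * a) = \<kappa> b * \<kappa> a"
    and "\<And>a b. b \<in> B \<Longrightarrow> \<kappa> (a * b) = \<kappa> a * \<kappa> b"
    and "d = Max {vector_space.dim scaleQ (\<Union>i\<in>set js. Bs i) |js.
           js \<noteq> [] \<and> distinct js \<and> set js \<subseteq> {1..q} \<and>
           assoc_algebra.plus_chain scaleA
             (map (\<lambda>i. gen_H_action.H_span scaleA actA (\<kappa> ` Bs i)) js) \<noteq> {0}}"
  shows "(\<lambda>n. root n (real (gen_H_action.codimH scaleH scaleA actA n))) \<longlonglongrightarrow> real d"
proof -
  from assms(2) obtain Basis where fd: "finite_dimensional_vector_space scaleA Basis" by (elim exE)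
  interpret Q: gen_H_action scaleH scaleQ actQ by (rule assms(4))
  have B: "Q.subalgebra B"
    using assms(10) by (simp only: Q.maximal_semisimple_def Q.semisimple_def)
  have "H_quotient_axioms scaleH scaleA actA scaleQ actQ p q Bs B \<kappa> Basis"
    by (rule H_quotient_axioms.intro; fact fd B assms)
  with assms(1,4) have "H_quotient scaleH scaleA actA scaleQ actQ p q Bs B \<kappa> Basis"
    by (rule H_quotient.intro)
  from H_quotient.codim_limit[OF this assms(16)] show ?thesis .
qed

end
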